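(* Let $D_1$ and $D_2$ be bounded pseudoconvex domains in $\mathbb{C}^n$ with Hölder boundary. If there exists a linear isometry between $A^p(D_1)$ and $A^p(D_2)$ for some real number $p>0$ that is not an even integer, then $D_1$ and $D_2$ are holomorphically equivalent (i.e. biholomorphic).
   Context: For a bounded domain $D\subset\mathbb{C}^n$ and $p>0$, $A^p(D)$ denotes the space of holomorphic functions $\phi$ on $D$ with $\|\phi\|_p:=\left(\int_D|\phi|^p\,d\lambda_n\right)^{1/p}<\infty$, where $d\lambda_n$ is Lebesgue measure on $\mathbb{C}^n$. A linear isometry $T:A^p(D_1)\to A^p(D_2)$ is a linear isomorphism (in particular a bijection) with $\|T\phi\|_p=\|\phi\|_p$ for all $\phi\in A^p(D_1)$. Hölder boundary has its standard meaning: near each boundary point, after a change of affine coordinates, the domain is the region on one side of the graph of a Hölder continuous function. *)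

theory Defs
  imports "HOL-Analysis.Analysis"
begin

text \<open>\<open>\<complex>\<^sup>n\<close> is the type \<open>complex ^ 'n\<close> with \<open>n = CARD('n)\<close>; its Euclidean structure is that of
  \<open>\<real>\<^sup>2\<^sup>n\<close>, so \<open>lborel\<close> is Lebesgue measure there. Scalar multiplication by complex numbers is \<open>*s\<close>.\<close>

definition bounded_domain :: "(complex ^ 'n) set \<Rightarrow> bool" where
  "bounded_domain D \<longleftrightarrow> open D \<and> connected D \<and> D \<noteq> {} \<and> bounded D"

text \<open>Real Frechet differentiability with a \<open>\<complex>\<close>-linear derivative.\<close>

definition holo_fun_on :: "(complex ^ 'n \<Rightarrow> complex) \<Rightarrow> (complex ^ 'n) set \<Rightarrow> bool" where
  "holo_fun_on f D \<longleftrightarrow>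
     (\<forall>z\<in>D. \<exists>L. (f has_derivative L) (at z) \<and> (\<forall>c v. L (c *s v) = c * L v))"

definition holo_map_on :: "(complex ^ 'n \<Rightarrow> complex ^ 'm) \<Rightarrow> (complex ^ 'n) set \<Rightarrow> bool" where
  "holo_map_on F D \<longleftrightarrow> (\<forall>i. holo_fun_on (\<lambda>z. F z $ i) D)"

definition biholomorphic :: "(complex ^ 'n) set \<Rightarrow> (complex ^ 'n) set \<Rightarrow> bool" where
  "biholomorphic D1 D2 \<longleftrightarrow>
     (\<exists>F G. holo_map_on F D1 \<and> holo_map_on G D2 \<and> F ` D1 \<subseteq> D2 \<and> G ` D2 \<subseteq> D1 \<and>
            (\<forall>z\<in>D1. G (F z) = z) \<and> (\<forall>w\<in>D2. F (G w) = w))"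

text \<open>Sub-mean value inequality on every closed affine complex disc in \<open>D\<close>; the radius of the disc
  is absorbed in the direction \<open>w\<close>. Only continuous real-valued functions are needed, so the
  integral always exists.\<close>

definition continuous_plurisubharmonic_on :: "(complex ^ 'n \<Rightarrow> real) \<Rightarrow> (complex ^ 'n) set \<Rightarrow> bool" where
  "continuous_plurisubharmonic_on u D \<longleftrightarrow> continuous_on D u \<and>
     (\<forall>z w. (\<forall>\<tau>. cmod \<tau> \<le> 1 \<longrightarrow> z + \<tau> *s w \<in> D) \<longrightarrow>
        u z \<le> 1 / (2 * pi) * integral {0..2 * pi} (\<lambda>\<theta>. u (z + cis \<theta> *s w)))"

definition pseudoconvex :: "(complex ^ 'n) set \<Rightarrow> bool" where
  "pseudoconvex D \<longleftrightarrow>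
     (\<exists>u. continuous_plurisubharmonic_on u D \<and> (\<forall>c. compact {z \<in> D. u z \<le> c}))"

definition holder_on :: "('a::metric_space \<Rightarrow> real) \<Rightarrow> 'a set \<Rightarrow> bool" where
  "holder_on h S \<longleftrightarrow>
     (\<exists>\<alpha> C. 0 < \<alpha> \<and> \<alpha> \<le> 1 \<and> (\<forall>x\<in>S. \<forall>y\<in>S. \<bar>h x - h y\<bar> \<le> C * dist x y powr \<alpha>))"

text \<open>The new (real) affine coordinates are \<open>z \<mapsto> A z + b\<close>. The coordinate along \<open>e\<close> plays the role of
  the last of the \<open>2n\<close> real coordinates, and \<open>y - (y \<bullet> e) *\<^sub>R e\<close> is the orthogonal projection
  to the hyperplane of the remaining \<open>2n - 1\<close>. Taking the region above the graph is no
  restriction, since \<open>A\<close> may contain a reflection.\<close>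

definition holder_boundary :: "(complex ^ 'n) set \<Rightarrow> bool" where
  "holder_boundary D \<longleftrightarrow>
     (\<forall>a \<in> frontier D. \<exists>U (A :: complex ^ 'n \<Rightarrow> complex ^ 'n) b h. \<exists>e \<in> Basis.
        open U \<and> a \<in> U \<and> linear A \<and> bij A \<and>
        (let \<Phi> = (\<lambda>z. A z + b); \<pi> = (\<lambda>y. y - (y \<bullet> e) *\<^sub>R e) in
           holder_on h (\<pi> ` \<Phi> ` U) \<and>
           D \<inter> U = {z \<in> U. h (\<pi> (\<Phi> z)) < \<Phi> z \<bullet> e}))"

text \<open>Functions on \<open>D\<close> are represented by their extension by zero, so that equality in
  \<open>bergman_space p D\<close> is equality on \<open>D\<close>.\<close>

definition bergman_space :: "real \<Rightarrow> (complex ^ 'n) set \<Rightarrow> (complex ^ 'n \<Rightarrow> complex) set" where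
  "bergman_space p D =
     {\<phi>. holo_fun_on \<phi> D \<and> (\<forall>z. z \<notin> D \<longrightarrow> \<phi> z = 0) \<and>
          set_integrable lborel D (\<lambda>z. cmod (\<phi> z) powr p)}"

definition bergman_norm :: "real \<Rightarrow> (complex ^ 'n) set \<Rightarrow> (complex ^ 'n \<Rightarrow> complex) \<Rightarrow> real" where
  "bergman_norm p D \<phi> = (LINT z:D|lborel. cmod (\<phi> z) powr p) powr (1 / p)"

definition bergman_linear_isometry ::
    "real \<Rightarrow> (complex ^ 'n) set \<Rightarrow> (complex ^ 'n) set \<Rightarrow>
       ((complex ^ 'n \<Rightarrow> complex) \<Rightarrow> (complex ^ 'n \<Rightarrow> complex)) \<Rightarrow> bool" where
  "bergman_linear_isometry p D1 D2 T \<longleftrightarrow>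
     bij_betw T (bergman_space p D1) (bergman_space p D2) \<and>
     (\<forall>\<phi>\<in>bergman_space p D1. \<forall>\<psi>\<in>bergman_space p D1.
        T (\<lambda>z. \<phi> z + \<psi> z) = (\<lambda>z. T \<phi> z + T \<psi> z)) \<and>
     (\<forall>c. \<forall>\<phi>\<in>bergman_space p D1. T (\<lambda>z. c * \<phi> z) = (\<lambda>z. c * T \<phi> z)) \<and>
     (\<forall>\<phi>\<in>bergman_space p D1. bergman_norm p D2 (T \<phi>) = bergman_norm p D1 \<phi>)"

end

theory Submission
  imports Defs "HOL-Complex_Analysis.Complex_Analysis"
begin

text \<open>
  Let \<open>\<psi>0 = T 1\<close>, \<open>\<psi> = T z\<close>, \<open>\<phi>0 = T\<inverse> 1\<close>, \<open>\<phi> = T\<inverse> w\<close> (coordinatewise), and let \<open>F = (1, z, \<phi>0, \<phi>)\<close> on \<open>D1\<close>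
  and \<open>G = (\<psi>0, \<psi>, 1, w)\<close> on \<open>D2\<close>. Then \<open>c \<cdot> F\<close> and \<open>c \<cdot> G\<close> have the same \<open>p\<close>-norm for every vector \<open>c\<close>, and
  averaging over \<open>c\<close> in a ball turns this into equality of the integrals of \<open>(\<Sum> t\<^sub>r |f\<^sub>r|\<^sup>2)\<^sup>p\<^sup>/\<^sup>2\<close> and
  \<open>(\<Sum> t\<^sub>r |g\<^sub>r|\<^sup>2)\<^sup>p\<^sup>/\<^sup>2\<close> for linear combinations \<open>f\<^sub>r\<close>, \<open>g\<^sub>r\<close> of the entries and weights \<open>t\<^sub>r > 0\<close>. As
  \<open>p / 2\<close> is not a natural number, the binomial series in the weights and the Stone-Weierstrass theorem show that
  the projective classes of \<open>F\<close> and \<open>G\<close> have the same distribution (Rudin's equimeasurability theorem in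
  projective form, which needs no integrability beyond \<open>L\<^sup>p\<close>). Hence for almost every \<open>w\<close> the vector \<open>G w\<close> is proportional to some \<open>F z\<close>: on
  dense open sets \<open>g = \<psi> / \<psi>0\<close> and \<open>h = \<phi> / \<phi>0\<close> are inverse to each other.

  The exceptional points of \<open>g\<close> are zeros of \<open>\<psi>0\<close> times its Jacobian determinant, because where \<open>g\<close> is open its
  values lie in the interior of the closure of \<open>D1\<close>, which is \<open>D1\<close>. On a complex line such a zero is isolated, so
  \<open>g\<close> extends to a disc with punctured disc in \<open>D1\<close> and centre in the closure. If the centre were a boundary
  point, one could push the disc into \<open>D1\<close> along the graph direction and the maximum principle for the
  plurisubharmonic exhaustion would keep its centre in a compact subset of \<open>D1\<close>. So there are no exceptional points.
\<close>

no_notation fps_nth (infixl "$" 75)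

section \<open>Graph boundaries\<close>

lemma holder_on_imp_continuous_on:
  assumes "holder_on h S"
  shows "continuous_on S h"
proof -
  obtain \<alpha> C where \<alpha>: "0 < \<alpha>" and C: "\<And>x y. x \<in> S \<Longrightarrow> y \<in> S \<Longrightarrow> \<bar>h x - h y\<bar> \<le> C * dist x y powr \<alpha>"
    using assms unfolding holder_on_def by blast
  show ?thesis
    unfolding continuous_on_def
  proof
    fix x assume x: "x \<in> S"
    have "((\<lambda>y. C * dist y x powr \<alpha>) \<longlongrightarrow> C * 0 powr \<alpha>) (at x within S)"
      using \<alpha> by (intro tendsto_intros tendsto_powr') (auto intro!: tendsto_eq_intros)
    then have "((\<lambda>y. C * dist y x powr \<alpha>) \<longlongrightarrow> 0) (at x within S)"
      using \<alpha> by simp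
    moreover have "\<forall>\<^sub>F y in at x within S. norm (h y - h x) \<le> C * dist y x powr \<alpha>"
      using C x by (auto simp: eventually_at_filter)
    ultimately have "((\<lambda>y. h y - h x) \<longlongrightarrow> 0) (at x within S)"
      by (rule Lim_null_comparison[rotated])
    then show "(h \<longlongrightarrow> h x) (at x within S)"
      by (simp add: Lim_null[symmetric])
  qed
qed

text \<open>All later uses of the boundary go through this consequence. In the graph chart a
  translation along the axis raises the height above the graph, and that height is positive on
  \<open>D\<close> and, by continuity, nonnegative on the closure. Every positive shift that stays
  in the chart therefore leads into \<open>D\<close>.\<close>

lemma holder_boundary_translation:
  fixes D :: "(complex ^ 'n) set"
  assumes D: "holder_boundary D" and a: "a \<in> frontier D"
  obtains U e where "open U" "a \<in> U"
    "\<And>x s. x \<in> U \<Longrightarrow> x \<in> closure D \<Longrightarrow> 0 < s \<Longrightarrow> x + s *\<^sub>R e \<in> U \<Longrightarrow> x + s *\<^sub>R e \<in> D"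
proof -
  obtain U and A :: "complex ^ 'n \<Rightarrow> complex ^ 'n" and b h e0 where U: "open U" "a \<in> U" and A: "linear A" "bij A" and e0: "e0 \<in> Basis"
    and h: "holder_on h ((\<lambda>y. y - (y \<bullet> e0) *\<^sub>R e0) ` (\<lambda>z. A z + b) ` U)"
    and DU: "D \<inter> U = {z \<in> U. h ((A z + b) - ((A z + b) \<bullet> e0) *\<^sub>R e0) < (A z + b) \<bullet> e0}"
    using D[unfolded holder_boundary_def Let_def, rule_format, OF a]
    by (elim exE bexE conjE) (rule that; assumption)
  \<comment> \<open>\<open>k\<close> is the height above the graph; \<open>e\<close> is the
    direction that the affine change sends to the graph axis, so moving by \<open>s\<close> along
    \<open>e\<close> adds exactly \<open>s\<close> to \<open>k\<close>.\<close>
  define \<pi> where "\<pi> z = (A z + b) - ((A z + b) \<bullet> e0) *\<^sub>R e0" for z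
  define k where "k z = (A z + b) \<bullet> e0 - h (\<pi> z)" for z
  obtain e where e: "A e = e0"
    using bij_is_surj[OF A(2)] by (metis surjD)
  have contA: "continuous_on V A" for V
    using A linear_continuous_on linear_conv_bounded_linear by blast
  have "continuous_on U (h \<circ> \<pi>)"
  proof (rule continuous_on_compose)
    show "continuous_on U \<pi>"
      unfolding \<pi>_def by (intro continuous_intros contA)
    show "continuous_on (\<pi> ` U) h"
      using holder_on_imp_continuous_on[OF h] by (simp add: image_image \<pi>_def)
  qed
  then have contk: "continuous_on U k"
    unfolding k_def comp_def by (intro continuous_intros contA)
  have DU': "z \<in> D \<longleftrightarrow> 0 < k z" if "z \<in> U" for z
    using DU that unfolding k_def \<pi>_def by auto
  have cl: "0 \<le> k x" if x: "x \<in> U" "x \<in> closure D" for x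
  proof (rule ccontr)
    assume "\<not> 0 \<le> k x"
    then have "x \<in> {z \<in> U. k z < 0}"
      using x by simp
    moreover have "open {z \<in> U. k z < 0}"
      using continuous_open_preimage[OF contk U(1), of "{..<0}"]
      by (simp add: vimage_def Collect_conj_eq)
    ultimately obtain z where "z \<in> D" "z \<in> U" "k z < 0"
      using x(2) by (auto simp: closure_iff_nhds_not_empty)
    then show False
      using DU' by fastforce
  qed
  have step: "k (x + s *\<^sub>R e) = k x + s" for x s
  proof -
    have "A (x + s *\<^sub>R e) = A x + s *\<^sub>R e0"
      using A(1) e by (simp add: linear_add linear_scale)
    moreover have "e0 \<bullet> e0 = 1"
      using e0 by (simp add: inner_Basis)
    ultimately show ?thesis
      by (simp add: k_def \<pi>_def algebra_simps)
  qed
  show ?thesis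
  proof (rule that[of U e])
    fix x s assume "x \<in> U" "x \<in> closure D" "0 < s" "x + s *\<^sub>R e \<in> U"
    then show "x + s *\<^sub>R e \<in> D"
      using cl[of x] step[of x s] DU' by auto
  qed (use U in auto)
qed

text \<open>A graph boundary has no slits or punctures: if a frontier point \<open>a\<close> were
  interior to the closure, then \<open>a - s *\<^sub>R e\<close> would lie in the closure for small
  \<open>s > 0\<close>, and shifting it back would put \<open>a\<close> itself into
  \<open>D\<close>.\<close>

lemma holder_boundary_interior_closure:
  assumes D: "holder_boundary D" and "open D"
  shows "interior (closure D) = D"
proof
  show "D \<subseteq> interior (closure D)"
    using assms by (simp add: closure_subset interior_maximal)
  show "interior (closure D) \<subseteq> D"
  proof
    fix a assume a: "a \<in> interior (closure D)"
    show "a \<in> D"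
    proof (rule ccontr)
      assume "a \<notin> D"
      with a \<open>open D\<close> have "a \<in> frontier D"
        using interior_subset by (auto simp: frontier_def interior_open)
      then obtain U e where U: "open U" "a \<in> U"
        and *: "\<And>x s. x \<in> U \<Longrightarrow> x \<in> closure D \<Longrightarrow> 0 < s \<Longrightarrow> x + s *\<^sub>R e \<in> U \<Longrightarrow> x + s *\<^sub>R e \<in> D"
        using holder_boundary_translation[OF D] by metis
      have "((\<lambda>s. a - s *\<^sub>R e) \<longlongrightarrow> a - 0 *\<^sub>R e) (at_right 0)"
        by (intro tendsto_intros)
      then have "\<forall>\<^sub>F s in at_right 0. a - s *\<^sub>R e \<in> U \<inter> interior (closure D)"
        using U a by (intro topological_tendstoD) auto
      moreover have "\<forall>\<^sub>F s in at_right 0. (0::real) < s"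
        by (simp add: eventually_at_right_less)
      ultimately have "\<forall>\<^sub>F s in at_right (0::real). a - s *\<^sub>R e \<in> U \<inter> interior (closure D) \<and> 0 < s"
        by eventually_elim auto
      then obtain s :: real where "a - s *\<^sub>R e \<in> U \<inter> interior (closure D)" "0 < s"
        using eventually_happens'[OF trivial_limit_at_right_real] by blast
      then have "a - s *\<^sub>R e + s *\<^sub>R e \<in> D"
        using interior_subset U by (intro *) auto
      with \<open>a \<notin> D\<close> show False by simp
    qed
  qed
qed

section \<open>One-variable tools: second-order Taylor remainder and the circle mean\<close>

lemma holomorphic_taylor_order2:
  assumes f: "f holomorphic_on S" and S: "open S" "z \<in> S"
  obtains C R where "0 < R" "ball z R \<subseteq> S"
    "\<And>s. cmod s < R \<Longrightarrow> cmod (f (z + s) - f z - s * deriv f z) \<le> C * (cmod s)\<^sup>2"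
proof -
  obtain R where R: "0 < R" "cball z R \<subseteq> S"
    using S open_contains_cball by blast
  have d1: "deriv f holomorphic_on S" and d2: "deriv (deriv f) holomorphic_on S"
    using f S by (auto intro!: holomorphic_deriv)
  have "compact (deriv (deriv f) ` cball z R)"
    using d2 R by (intro compact_continuous_image holomorphic_on_imp_continuous_on)
      (auto intro: holomorphic_on_subset)
  then obtain B where B: "\<And>x. x \<in> cball z R \<Longrightarrow> cmod (deriv (deriv f) x) \<le> B"
    by (meson bounded_iff compact_imp_bounded imageI)
  show ?thesis
  proof (rule that[of R B])
    fix s assume s: "cmod s < R"
    let ?g = "\<lambda>i::nat. if i = 0 then f else if i = 1 then deriv f else deriv (deriv f)"
    have "cmod (?g 0 (z + s) - (\<Sum>i\<le>1. ?g i z * ((z + s) - z) ^ i / fact i))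
        \<le> B * cmod ((z + s) - z) ^ Suc 1 / fact 1"
    proof (rule complex_Taylor[where S = "cball z R" and f = ?g])
      show "convex (cball z R)" by simp
      fix i x assume x: "x \<in> cball z R" and i: "i \<le> (1::nat)"
      have "x \<in> S" using x R by auto
      then have "(f has_field_derivative deriv f x) (at x)"
        "(deriv f has_field_derivative deriv (deriv f) x) (at x)"
        using f d1 S by (auto intro: holomorphic_derivI)
      with i show "(?g i has_field_derivative ?g (Suc i) x) (at x within cball z R)"
        by (cases "i = 0") (auto intro: has_field_derivative_at_within)
    next
      fix x assume "x \<in> cball z R"
      then show "cmod (?g (Suc 1) x) \<le> B" using B by simp
    qed (use s R in \<open>auto simp: dist_norm\<close>)
    then show "cmod (f (z + s) - f z - s * deriv f z) \<le> B * (cmod s)\<^sup>2"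
      by (simp add: algebra_simps power2_eq_square)
  qed (use R ball_subset_cball in auto)
qed

lemma holomorphic_circle_mean:
  fixes f :: "complex \<Rightarrow> complex"
  assumes f: "f holomorphic_on ball 0 R" and r: "0 < r" "r < R"
  shows "((\<lambda>t. f (complex_of_real r * cis t)) has_integral (complex_of_real (2 * pi) * f 0)) {0..2 * pi}"
proof -
  have "((\<lambda>u. f u / (u - 0)) has_contour_integral (2 * of_real pi * \<i> * f 0)) (circlepath 0 r)"
    using assms by (intro Cauchy_integral_circlepath_simple) (auto intro: holomorphic_on_subset)
  then have "((\<lambda>t. f (0 + r * cis t) / (0 + r * cis t - 0) * r * \<i> * cis t) has_integral (2 * of_real pi * \<i> * f 0)) {0..2*pi}"
    unfolding circlepath_def by (subst (asm) has_contour_integral_part_circlepath_iff) auto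
  \<comment> \<open>Along the circle the Cauchy kernel cancels against the derivative of the
    parametrisation except for a factor \<i>; multiplication by -\<i> clears it.\<close>
  then have "((\<lambda>t. - \<i> * (f (0 + r * cis t) / (0 + r * cis t - 0) * r * \<i> * cis t)) has_integral (- \<i> * (2 * of_real pi * \<i> * f 0))) {0..2*pi}"
    by (rule has_integral_mult_right)
  then show ?thesis
    using r by (simp add: field_simps)
qed

section \<open>The maximum principle on holomorphic discs\<close>

lemma norm_vec_le_sum: "norm (x :: 'a::real_normed_vector ^ 'n) \<le> (\<Sum>i\<in>UNIV. norm (x $ i))"
  unfolding norm_vec_def by (rule L2_set_le_sum) simp

lemma continuous_on_vec:
  fixes f :: "'a::topological_space \<Rightarrow> 'b::topological_space ^ 'n"
  shows "(\<And>i. continuous_on S (\<lambda>x. f x $ i)) \<Longrightarrow> continuous_on S f"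
  unfolding continuous_on_def by (auto intro: vec_tendstoI)

lemma holomorphic_curve_taylor_order2:
  fixes \<gamma> :: "complex \<Rightarrow> complex ^ 'n"
  assumes hol: "\<And>i. (\<lambda>t. \<gamma> t $ i) holomorphic_on S" and S: "open S" "t \<in> S"
  obtains C R v where "0 < R" "ball t R \<subseteq> S"
    "\<And>s. cmod s < R \<Longrightarrow> norm (\<gamma> (t + s) - \<gamma> t - s *s v) \<le> C * (cmod s)\<^sup>2"
proof -
  define v where "v = (\<chi> i. deriv (\<lambda>t. \<gamma> t $ i) t)"
  have "\<exists>C R. 0 < R \<and> ball t R \<subseteq> S \<and> (\<forall>s. cmod s < R \<longrightarrow>
      cmod (\<gamma> (t + s) $ i - \<gamma> t $ i - s * v $ i) \<le> C * (cmod s)\<^sup>2)" for i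
    using holomorphic_taylor_order2[OF hol[of i] S] unfolding v_def vec_lambda_beta by metis
  then obtain C R where R: "\<And>i. 0 < R i" "\<And>i. ball t (R i) \<subseteq> S"
    and C: "\<And>i s. cmod s < R i \<Longrightarrow> cmod (\<gamma> (t + s) $ i - \<gamma> t $ i - s * v $ i) \<le> C i * (cmod s)\<^sup>2"
    by metis
  define r where "r = Min (range R)"
  have r: "r \<le> R i" for i
    unfolding r_def by simp
  show ?thesis
  proof (rule that[of r v "\<Sum>i\<in>UNIV. C i"])
    show "0 < r"
      unfolding r_def using R(1) by (subst Min_gr_iff) auto
    show "ball t r \<subseteq> S"
      using R(2)[of undefined] r[of undefined] by (meson order_trans subset_ball)
    fix s assume s: "cmod s < r"
    have "norm (\<gamma> (t + s) - \<gamma> t - s *s v) \<le> (\<Sum>i\<in>UNIV. norm ((\<gamma> (t + s) - \<gamma> t - s *s v) $ i))"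
      by (rule norm_vec_le_sum)
    also have "\<dots> \<le> (\<Sum>i\<in>UNIV. C i * (cmod s)\<^sup>2)"
      by (rule sum_mono) (use C s r in \<open>auto intro: less_le_trans\<close>)
    finally show "norm (\<gamma> (t + s) - \<gamma> t - s *s v) \<le> (\<Sum>i\<in>UNIV. C i) * (cmod s)\<^sup>2"
      by (simp add: sum_distrib_right)
  qed
qed

lemma norm_diff_square: "(norm (d - q))\<^sup>2 = (norm d)\<^sup>2 - 2 * (d \<bullet> q) + (norm (q :: 'a::real_inner))\<^sup>2"
  by (simp add: power2_norm_eq_inner inner_diff inner_commute algebra_simps)

lemma inner_complex_vec: "d \<bullet> q = Re (\<Sum>i\<in>UNIV. cnj (d $ i) * (q $ i))" for d q :: "complex ^ 'n"
  by (simp add: inner_vec_def inner_complex_def)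

lemma norm_smult_complex_vec: "norm (c *s (v :: complex ^ 'n)) = cmod c * norm v"
  by (simp add: norm_vec_def norm_mult L2_set_right_distrib)

text \<open>A continuous plurisubharmonic function need not be differentiable, so its restriction to the
  curved disc is compared with affine discs by doubling the variables: at a maximum of the penalised
  function below, the affine disc through \<open>y\<close> with the tangent direction of \<open>\<gamma>\<close> at \<open>t\<close>
  violates the sub-mean value inequality, since the error terms have vanishing mean up to fourth order.\<close>

lemma plurisubharmonic_maximum_principle:
  fixes \<gamma> :: "complex \<Rightarrow> complex ^ 'n" and D :: "(complex ^ 'n) set"
  assumes psh: "continuous_plurisubharmonic_on u D" and "open D"
    and hol: "\<And>i. (\<lambda>t. \<gamma> t $ i) holomorphic_on S" and S: "open S" "cball 0 r \<subseteq> S" and r: "0 < r"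
    and \<gamma>D: "\<gamma> ` cball 0 r \<subseteq> D"
    and bd: "\<And>t. cmod t = r \<Longrightarrow> u (\<gamma> t) \<le> C"
  shows "u (\<gamma> 0) \<le> C"
proof (rule ccontr)
  assume "\<not> u (\<gamma> 0) \<le> C"
  \<comment> \<open>A quarter of the assumed gap: the term
    \<open>\<delta> * (cmod t)\<^sup>2\<close> and the replacement of \<open>y\<close> by
    \<open>\<gamma> t\<close> each cost at most \<kappa>, so the maximum point still has
    \<open>u (\<gamma> t) > C + 2 * \<kappa>\<close> and \<open>t\<close> cannot lie on the bounding
    circle.\<close>
  define \<kappa> where "\<kappa> = (u (\<gamma> 0) - C) / 4"
  have \<kappa>: "0 < \<kappa>" and u0: "u (\<gamma> 0) = C + 4 * \<kappa>"
    using \<open>\<not> u (\<gamma> 0) \<le> C\<close> by (auto simp: \<kappa>_def field_simps)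
  define \<delta> where "\<delta> = \<kappa> / r\<^sup>2"
  have \<delta>: "0 < \<delta>" "\<delta> * r\<^sup>2 = \<kappa>"
    using \<kappa> r by (auto simp: \<delta>_def)
  have contu: "continuous_on D u"
    using psh by (simp add: continuous_plurisubharmonic_on_def)
  have cont\<gamma>: "continuous_on S \<gamma>"
    by (intro continuous_on_vec holomorphic_on_imp_continuous_on hol)
  define K where "K = \<gamma> ` cball 0 r"
  have K: "compact K" "K \<subseteq> D"
    using \<gamma>D cont\<gamma> S unfolding K_def by (auto intro!: compact_continuous_image elim: continuous_on_subset)
  obtain \<eta> where \<eta>: "0 < \<eta>" "(\<Union>x\<in>K. cball x \<eta>) \<subseteq> D"
    using compact_subset_open_imp_cball_epsilon_subset[OF K(1) \<open>open D\<close> K(2)] by metis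
  define L where "L = {x + y | x y. x \<in> K \<and> y \<in> cball 0 \<eta>}"
  have L: "compact L"
    unfolding L_def using K by (intro compact_sums) auto
  have LI: "y \<in> L" if "x \<in> K" "dist x y \<le> \<eta>" for x y
  proof -
    have "y = x + (y - x)" "y - x \<in> cball 0 \<eta>"
      using that by (auto simp: dist_norm norm_minus_commute)
    then show ?thesis using that unfolding L_def by blast
  qed
  have LD: "L \<subseteq> D"
    using \<eta>(2) unfolding L_def by (force simp: dist_norm)
  have contL: "continuous_on L u"
    using contu LD by (rule continuous_on_subset)
  then have "uniformly_continuous_on L u"
    using L by (rule compact_uniformly_continuous)
  then obtain \<eta>1 where \<eta>1: "0 < \<eta>1" "\<And>x y. x \<in> L \<Longrightarrow> y \<in> L \<Longrightarrow> dist y x < \<eta>1 \<Longrightarrow> dist (u y) (u x) < \<kappa>"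
    unfolding uniformly_continuous_on_def using \<kappa> by metis
  define \<eta>2 where "\<eta>2 = min \<eta> \<eta>1"
  have \<eta>2: "0 < \<eta>2" "\<eta>2 \<le> \<eta>" "\<eta>2 \<le> \<eta>1"
    using \<eta> \<eta>1 by (auto simp: \<eta>2_def)
  obtain B where B: "\<And>y. y \<in> L \<Longrightarrow> \<bar>u y\<bar> \<le> B"
    using compact_imp_bounded[OF compact_continuous_image[OF contL L]] by (auto simp: bounded_iff)
  have KL: "x \<in> L" if "x \<in> K" for x
    using LI[OF that, of x] \<eta> by simp
  have \<gamma>K: "\<gamma> t \<in> K" if "cmod t \<le> r" for t
    using that by (auto simp: K_def)
  have B0: "0 \<le> B"
    using B[OF KL[OF \<gamma>K[of 0]]] r by auto
  \<comment> \<open>Chosen so that \<open>(norm (y - \<gamma> t))\<^sup>2 / \<epsilon> \<le> 2 * B +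
    \<kappa>\<close>, which holds at the maximum, forces \<open>y\<close> to be closer than
    \<open>\<eta>2\<close> to \<open>\<gamma> t\<close>.\<close>
  define \<epsilon> where "\<epsilon> = \<eta>2\<^sup>2 / (2 * B + \<kappa> + 1)"
  have \<epsilon>: "0 < \<epsilon>" "\<epsilon> * (2 * B + \<kappa> + 1) = \<eta>2\<^sup>2"
    using \<eta>2 B0 \<kappa> by (auto simp: \<epsilon>_def)
  \<comment> \<open>The last term ties the free point \<open>y\<close> to the curve, and the
    strictly subharmonic term in \<open>t\<close> supplies the gain of order \<rho> squared that
    produces the contradiction.\<close>
  define \<Phi> where "\<Phi> = (\<lambda>(y, t). u y + \<delta> * (cmod t)\<^sup>2 - (norm (y - \<gamma> t))\<^sup>2 / \<epsilon>)"
  have "continuous_on (L \<times> cball 0 r) \<Phi>"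
    unfolding \<Phi>_def case_prod_unfold
    by (intro continuous_intros continuous_on_compose2[OF contL] continuous_on_compose2[OF cont\<gamma>])
      (use S \<epsilon> in auto)
  moreover have "(\<gamma> 0, 0) \<in> L \<times> cball 0 r"
    using KL[OF \<gamma>K[of 0]] r by auto
  ultimately obtain ys where "ys \<in> L \<times> cball 0 r" and max': "\<And>z. z \<in> L \<times> cball 0 r \<Longrightarrow> \<Phi> z \<le> \<Phi> ys"
    using continuous_attains_sup[of "L \<times> cball 0 r" \<Phi>] compact_Times[OF L compact_cball] by blast
  then obtain y t where yL: "y \<in> L" and tr: "cmod t \<le> r" and
    max: "\<And>y' t'. y' \<in> L \<Longrightarrow> cmod t' \<le> r \<Longrightarrow> \<Phi> (y', t') \<le> \<Phi> (y, t)"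
    by (cases ys) auto
  have ge: "u (\<gamma> 0) \<le> \<Phi> (y, t)"
    using max[of "\<gamma> 0" 0] KL[OF \<gamma>K[of 0]] r by (simp add: \<Phi>_def)
  have t2: "\<delta> * (cmod t)\<^sup>2 \<le> \<kappa>"
    using \<delta> tr by (metis mult_left_mono norm_ge_zero less_imp_le power_mono)
  have "(norm (y - \<gamma> t))\<^sup>2 / \<epsilon> \<le> 2 * B + \<kappa>"
    using ge t2 B[OF yL] B[OF KL[OF \<gamma>K[of 0]]] r by (simp add: \<Phi>_def)
  then have "(norm (y - \<gamma> t))\<^sup>2 < \<eta>2\<^sup>2"
    using \<epsilon> by (simp add: field_simps)
  then have near: "norm (y - \<gamma> t) < \<eta>2"
    using \<eta>2 by (simp add: power_less_imp_less_base)
  then have "dist (u y) (u (\<gamma> t)) < \<kappa>"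
    using \<eta>1(2)[OF KL[OF \<gamma>K[OF tr]] yL] \<eta>2 by (simp add: dist_norm)
  then have "u (\<gamma> 0) < u (\<gamma> t) + 2 * \<kappa>"
  proof -
    have "0 \<le> (norm (y - \<gamma> t))\<^sup>2 / \<epsilon>" using \<epsilon> by simp
    with ge t2 \<open>dist (u y) (u (\<gamma> t)) < \<kappa>\<close> show ?thesis
      by (simp add: \<Phi>_def dist_real_def)
  qed
  then have "cmod t \<noteq> r"
    using bd[of t] u0 \<kappa> by auto
  with tr have tr': "cmod t < r" by simp
  then have tS: "t \<in> S" using S by auto
  obtain C1 R v where R: "0 < R" "ball t R \<subseteq> S"
    and C1: "\<And>s. cmod s < R \<Longrightarrow> norm (\<gamma> (t + s) - \<gamma> t - s *s v) \<le> C1 * (cmod s)\<^sup>2"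
    using holomorphic_curve_taylor_order2[OF hol S(1) tS] by metis
  define d where "d = y - \<gamma> t"
  define q where "q s = \<gamma> (t + s) - \<gamma> t - s *s v" for s
  \<comment> \<open>The cross terms from expanding both squares in \<Phi> are the real part of this
    function. It is holomorphic and vanishes at 0, so their mean over a circle is 0.\<close>
  define P where "P s = - 2 * \<delta> * cnj t * s - (2 / \<epsilon>) * (\<Sum>i\<in>UNIV. cnj (d $ i) * (q s $ i))" for s
  have "P holomorphic_on ball 0 R"
  proof -
    have "(\<lambda>s. \<gamma> (t + s) $ i) holomorphic_on ball 0 R" for i
      using holomorphic_on_compose_gen[of "\<lambda>s. t + s" "ball 0 R", OF _ hol[of i]] R
      by (force simp: o_def dist_norm intro!: holomorphic_intros)
    then show ?thesis
      unfolding P_def q_def by (auto intro!: holomorphic_intros)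
  qed
  have P0: "P 0 = 0"
    by (simp add: P_def q_def)
  \<comment> \<open>The radius must keep the Taylor bound valid, \<open>t + s\<close> in the closed
    disc of radius \<open>r\<close> and the affine disc inside \<open>L\<close>; the condition with
    \<open>C1\<close> makes the fourth-order error smaller than the gain
    \<open>\<delta> * \<rho>\<^sup>2\<close>.\<close>
  have "\<forall>\<^sub>F \<rho> in at_right 0. \<rho> < R \<and> \<rho> < r - cmod t \<and> \<rho> * norm v < \<eta>2 - norm (y - \<gamma> t)
      \<and> C1\<^sup>2 * \<rho>\<^sup>2 < \<epsilon> * \<delta> \<and> 0 < (\<rho>::real)"
  proof (intro eventually_conj)
    show "\<forall>\<^sub>F \<rho> in at_right 0. \<rho> < R"
      using R by (intro order_tendstoD) (auto intro!: tendsto_eq_intros)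
    show "\<forall>\<^sub>F \<rho> in at_right 0. \<rho> < r - cmod t"
      using tr' by (intro order_tendstoD(2)[where y = 0]) (auto intro!: tendsto_eq_intros)
    show "\<forall>\<^sub>F \<rho> in at_right 0. \<rho> * norm v < \<eta>2 - norm (y - \<gamma> t)"
      using near by (intro order_tendstoD(2)[where y = 0]) (auto intro!: tendsto_eq_intros)
    show "\<forall>\<^sub>F \<rho> in at_right 0. C1\<^sup>2 * \<rho>\<^sup>2 < \<epsilon> * \<delta>"
      using \<epsilon> \<delta> by (intro order_tendstoD(2)[where y = 0]) (auto intro!: tendsto_eq_intros)
    show "\<forall>\<^sub>F \<rho> in at_right 0. (0::real) < \<rho>"
      by (rule eventually_at_right_less)
  qed
  then obtain \<rho> where \<rho>: "0 < \<rho>" "\<rho> < R" "\<rho> < r - cmod t" "\<rho> * norm v < \<eta>2 - norm (y - \<gamma> t)"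
      "C1\<^sup>2 * \<rho>\<^sup>2 < \<epsilon> * \<delta>"
    using eventually_happens'[OF trivial_limit_at_right_real] by blast
  have disc: "y + \<tau> *s (of_real \<rho> *s v) \<in> L" if "cmod \<tau> \<le> 1" for \<tau>
  proof (rule LI)
    show "\<gamma> t \<in> K" using \<gamma>K tr by auto
    have "norm (\<tau> *s (of_real \<rho> *s v)) \<le> \<rho> * norm v"
      using that \<rho> by (auto simp: norm_smult_complex_vec norm_mult intro!: mult_right_mono mult_left_le_one_le)
    moreover have "norm (y + \<tau> *s (of_real \<rho> *s v) - \<gamma> t) \<le> norm (y - \<gamma> t) + norm (\<tau> *s (of_real \<rho> *s v))"
      by (metis add_diff_eq add.commute norm_triangle_ineq)
    ultimately show "dist (\<gamma> t) (y + \<tau> *s (of_real \<rho> *s v)) \<le> \<eta>"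
      using \<rho> \<eta>2 by (simp add: dist_norm norm_minus_commute)
  qed
  let ?I = "integral {0..2 * pi} (\<lambda>\<theta>. u (y + cis \<theta> *s (of_real \<rho> *s v)))"
  have "u y \<le> 1 / (2 * pi) * ?I"
    using psh disc LD unfolding continuous_plurisubharmonic_on_def by blast
  have cinner: "cis \<theta> *s (of_real \<rho> *s v) = (of_real \<rho> * cis \<theta>) *s v" for \<theta>
    by (simp add: mult.commute)
  have pt: "u (y + cis \<theta> *s (of_real \<rho> *s v))
      \<le> u y - \<delta> * \<rho>\<^sup>2 + C1\<^sup>2 * \<rho> ^ 4 / \<epsilon> + Re (P (of_real \<rho> * cis \<theta>))" for \<theta>
  proof -
    let ?s = "of_real \<rho> * cis \<theta> :: complex"
    have s: "cmod ?s = \<rho>" using \<rho> by (simp add: norm_mult)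
    have "cmod (t + ?s) \<le> r"
      using norm_triangle_ineq[of t ?s] s \<rho> by simp
    moreover have "y + ?s *s v \<in> L"
      using disc[of "cis \<theta>"] by (simp only: cinner) simp
    ultimately have "\<Phi> (y + ?s *s v, t + ?s) \<le> \<Phi> (y, t)"
      by (intro max)
    moreover have "y + ?s *s v - \<gamma> (t + ?s) = d - q ?s"
      by (simp add: d_def q_def)
    ultimately have "u (y + ?s *s v) + \<delta> * (cmod (t + ?s))\<^sup>2 - (norm (d - q ?s))\<^sup>2 / \<epsilon>
        \<le> u y + \<delta> * (cmod t)\<^sup>2 - (norm d)\<^sup>2 / \<epsilon>"
      by (simp add: \<Phi>_def d_def)
    moreover have "(cmod (t + ?s))\<^sup>2 = (cmod t)\<^sup>2 + 2 * Re (cnj t * ?s) + \<rho>\<^sup>2"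
    proof -
      have "(cmod (t + ?s))\<^sup>2 = (cmod t)\<^sup>2 + 2 * Re (cnj t * ?s) + (cmod ?s)\<^sup>2"
        by (simp only: cmod_power2) (simp add: power2_eq_square algebra_simps)
      then show ?thesis using s by simp
    qed
    moreover have "(norm (d - q ?s))\<^sup>2 / \<epsilon> = (norm d)\<^sup>2 / \<epsilon> - 2 / \<epsilon> * (d \<bullet> q ?s) + (norm (q ?s))\<^sup>2 / \<epsilon>"
      by (simp add: norm_diff_square diff_divide_distrib add_divide_distrib)
    moreover have "(norm (q ?s))\<^sup>2 / \<epsilon> \<le> C1\<^sup>2 * \<rho> ^ 4 / \<epsilon>"
    proof -
      have "norm (q ?s) \<le> C1 * \<rho>\<^sup>2"
        using C1[of ?s] s \<rho> by (simp add: q_def)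
      then have "(norm (q ?s))\<^sup>2 \<le> (C1 * \<rho>\<^sup>2)\<^sup>2"
        by (rule power_mono) simp
      also have "\<dots> = C1\<^sup>2 * \<rho> ^ 4"
        by (simp add: power_mult_distrib flip: power_mult)
      finally show ?thesis using \<epsilon> by (simp add: divide_right_mono)
    qed
    moreover have "Re (P ?s) = - 2 * \<delta> * Re (cnj t * ?s) - 2 / \<epsilon> * (d \<bullet> q ?s)"
    proof -
      have "P ?s = of_real (- 2 * \<delta>) * (cnj t * ?s) - of_real (2 / \<epsilon>) * (\<Sum>i\<in>UNIV. cnj (d $ i) * (q ?s $ i))"
        by (simp add: P_def)
      moreover have "Re (of_real c * z) = c * Re z" for c z
        by simp
      ultimately show ?thesis
        unfolding inner_complex_vec by (simp only: minus_complex.sel)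
    qed
    ultimately show ?thesis
      unfolding cinner by (simp add: algebra_simps)
  qed
  have mean: "((\<lambda>\<theta>. Re (P (of_real \<rho> * cis \<theta>))) has_integral 0) {0..2 * pi}"
    using has_integral_Re[OF holomorphic_circle_mean[OF \<open>P holomorphic_on ball 0 R\<close> \<rho>(1,2)]] P0 by simp
  have "?I \<le> 2 * pi * (u y - \<delta> * \<rho>\<^sup>2 + C1\<^sup>2 * \<rho> ^ 4 / \<epsilon>)"
  proof (rule has_integral_le)
    have "continuous_on {0..2 * pi} (\<lambda>\<theta>. u (y + cis \<theta> *s (of_real \<rho> *s v)))"
    proof (rule continuous_on_compose2[OF contL])
      show "continuous_on {0..2 * pi} (\<lambda>\<theta>. y + cis \<theta> *s (of_real \<rho> *s v))"
        by (intro continuous_on_vec) (auto intro!: continuous_intros)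
      show "(\<lambda>\<theta>. y + cis \<theta> *s (of_real \<rho> *s v)) ` {0..2 * pi} \<subseteq> L"
        using disc by auto
    qed
    then show "((\<lambda>\<theta>. u (y + cis \<theta> *s (of_real \<rho> *s v))) has_integral ?I) {0..2 * pi}"
      by (intro integrable_integral integrable_continuous_interval)
    have "((\<lambda>\<theta>. (u y - \<delta> * \<rho>\<^sup>2 + C1\<^sup>2 * \<rho> ^ 4 / \<epsilon>) + Re (P (of_real \<rho> * cis \<theta>))) has_integral
        (measure lborel {0..2 * pi} *\<^sub>R (u y - \<delta> * \<rho>\<^sup>2 + C1\<^sup>2 * \<rho> ^ 4 / \<epsilon>) + 0)) {0..2 * pi}"
      by (intro has_integral_add mean has_integral_const_real)
    then show "((\<lambda>\<theta>. (u y - \<delta> * \<rho>\<^sup>2 + C1\<^sup>2 * \<rho> ^ 4 / \<epsilon>) + Re (P (of_real \<rho> * cis \<theta>))) has_integral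
        (2 * pi * (u y - \<delta> * \<rho>\<^sup>2 + C1\<^sup>2 * \<rho> ^ 4 / \<epsilon>))) {0..2 * pi}"
      by simp
  qed (use pt in auto)
  with \<open>u y \<le> 1 / (2 * pi) * ?I\<close> have "2 * pi * u y \<le> 2 * pi * (u y - \<delta> * \<rho>\<^sup>2 + C1\<^sup>2 * \<rho> ^ 4 / \<epsilon>)"
    by (simp add: field_simps)
  then have "u y \<le> u y - \<delta> * \<rho>\<^sup>2 + C1\<^sup>2 * \<rho> ^ 4 / \<epsilon>"
    by (subst (asm) mult_le_cancel_left_pos) auto
  then have "\<delta> * \<rho>\<^sup>2 \<le> C1\<^sup>2 * \<rho> ^ 4 / \<epsilon>"
    by simp
  then have "\<epsilon> * \<delta> * \<rho>\<^sup>2 \<le> (C1\<^sup>2 * \<rho>\<^sup>2) * \<rho>\<^sup>2"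
    using \<epsilon> by (simp add: field_simps power4_eq_xxxx power2_eq_square)
  then show False
    using \<rho> by (subst (asm) mult_le_cancel_right_pos) auto
qed

text \<open>If the centre were a boundary point, pushing a smaller closed disc by
  \<open>s *\<^sub>R e\<close> would move all of it into \<open>D\<close>. The bounding circles stay
  in one compact subset of \<open>D\<close> for all small \<open>s\<close>, so the maximum principle
  bounds the exhaustion at the centres uniformly in \<open>s\<close>. The sublevel set is compact,
  hence contains the limit of the centres as \<open>s\<close> tends to 0, namely
  \<open>\<gamma> 0\<close>.\<close>

lemma pseudoconvex_holder_disc:
  fixes \<gamma> :: "complex \<Rightarrow> complex ^ 'n" and D :: "(complex ^ 'n) set"
  assumes D: "pseudoconvex D" "holder_boundary D" "open D"
    and hol: "\<And>i. (\<lambda>t. \<gamma> t $ i) holomorphic_on ball 0 R" and R: "0 < R"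
    and \<gamma>D: "\<And>t. t \<noteq> 0 \<Longrightarrow> cmod t < R \<Longrightarrow> \<gamma> t \<in> D"
  shows "\<gamma> 0 \<in> D"
proof (rule ccontr)
  assume nD: "\<gamma> 0 \<notin> D"
  obtain u where psh: "continuous_plurisubharmonic_on u D" and cu: "\<And>c. compact {z \<in> D. u z \<le> c}"
    using D(1) unfolding pseudoconvex_def by blast
  have cont\<gamma>: "continuous_on (ball 0 R) \<gamma>"
    by (intro continuous_on_vec holomorphic_on_imp_continuous_on hol)
  have lim\<gamma>: "(\<gamma> \<longlongrightarrow> \<gamma> 0) (at 0)"
    using cont\<gamma> R by (metis centre_in_ball continuous_on_def at_within_open open_ball)
  have cl: "\<gamma> t \<in> closure D" if "cmod t < R" for t
  proof (cases "t = 0")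
    case True
    have "\<forall>\<^sub>F t in at 0. \<gamma> t \<in> closure D"
      using \<gamma>D R closure_subset unfolding eventually_at by (auto intro!: exI[of _ R])
    then have "\<gamma> 0 \<in> closure D"
      using lim\<gamma> by (intro Lim_in_closed_set[of "closure D" \<gamma> "at 0"]) auto
    with True show ?thesis by simp
  next
    case False
    then show ?thesis using \<gamma>D that closure_subset by blast
  qed
  then have "\<gamma> 0 \<in> frontier D"
    using nD D(3) R by (simp add: frontier_def interior_open)
  then obtain U e where U: "open U" "\<gamma> 0 \<in> U"
    and up: "\<And>x s. x \<in> U \<Longrightarrow> x \<in> closure D \<Longrightarrow> 0 < s \<Longrightarrow> x + s *\<^sub>R e \<in> U \<Longrightarrow> x + s *\<^sub>R e \<in> D"
    using holder_boundary_translation[OF D(2)] by metis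
  obtain \<eta> where \<eta>: "0 < \<eta>" "ball (\<gamma> 0) \<eta> \<subseteq> U"
    using U open_contains_ball by blast
  have "\<forall>\<^sub>F t in nhds 0. dist (\<gamma> t) (\<gamma> 0) < \<eta> / 2"
    using tendstoD[OF lim\<gamma>[unfolded tendsto_at_iff_tendsto_nhds], of "\<eta> / 2"] \<eta> by simp
  then obtain r0 where r0: "0 < r0" "\<And>t. cmod t < r0 \<Longrightarrow> dist (\<gamma> t) (\<gamma> 0) < \<eta> / 2"
    unfolding eventually_nhds_metric by (auto simp: dist_norm)
  define r where "r = min r0 R / 2"
  have r: "0 < r" "r < r0" "r < R"
    using r0 R by (auto simp: r_def)
  define s0 where "s0 = \<eta> / (2 * (norm e + 1))"
  have s0: "0 < s0" "s0 * norm e < \<eta> / 2"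
    using \<eta> by (auto simp: s0_def divide_simps add_nonneg_pos)
  have inU: "\<gamma> t + s *\<^sub>R e \<in> U" if "cmod t \<le> r" "0 \<le> s" "s \<le> s0" for t s
  proof -
    have "norm (s *\<^sub>R e) \<le> s0 * norm e"
      using that by (simp add: mult_right_mono)
    then have "dist (\<gamma> 0) (\<gamma> t + s *\<^sub>R e) < \<eta>"
      using r0(2)[of t] that r s0 norm_triangle_ineq[of "\<gamma> t - \<gamma> 0" "s *\<^sub>R e"]
      by (simp add: dist_norm norm_minus_commute algebra_simps)
    then show ?thesis using \<eta> by auto
  qed
  have inD: "\<gamma> t + s *\<^sub>R e \<in> D" if "cmod t \<le> r" "0 < s" "s \<le> s0" for t s
    using inU[of t s] inU[of t 0] that s0 cl[of t] r by (intro up) auto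
  let ?f = "\<lambda>(t, s). \<gamma> t + s *\<^sub>R e"
  \<comment> \<open>The value \<open>s = 0\<close> is included to make \<open>K\<close> compact; it
    does no harm, since on the circle \<open>t\<close> is nonzero and \<open>\<gamma> t\<close> is
    already in \<open>D\<close>.\<close>
  define K where "K = ?f ` (sphere 0 r \<times> {0..s0})"
  have "compact K"
    unfolding K_def case_prod_unfold using r
    by (intro compact_continuous_image compact_Times continuous_intros continuous_on_compose2[OF cont\<gamma>]) auto
  moreover have KD: "K \<subseteq> D"
  proof -
    have "\<gamma> t + s *\<^sub>R e \<in> D" if "cmod t = r" "0 \<le> s" "s \<le> s0" for t s
      using that inD[of t s] \<gamma>D[of t] r by (cases "s = 0") auto
    then show ?thesis unfolding K_def by auto
  qed
  moreover have "continuous_on D u"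
    using psh by (simp add: continuous_plurisubharmonic_on_def)
  ultimately have "bounded (u ` K)"
    by (intro compact_imp_bounded compact_continuous_image) (auto elim: continuous_on_subset)
  then obtain C where C: "\<And>z. z \<in> K \<Longrightarrow> u z \<le> C"
    unfolding bounded_iff by (metis abs_le_D1 imageI real_norm_def)
  have "\<gamma> 0 + s *\<^sub>R e \<in> {z \<in> D. u z \<le> C}" if s: "0 < s" "s \<le> s0" for s
  proof -
    have "u (\<gamma> 0 + s *\<^sub>R e) \<le> C"
    proof (rule plurisubharmonic_maximum_principle[OF psh D(3), of "\<lambda>t. \<gamma> t + s *\<^sub>R e"])
      show "(\<lambda>t. (\<gamma> t + s *\<^sub>R e) $ i) holomorphic_on ball 0 R" for i
        using hol[of i] by (auto intro!: holomorphic_intros)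
      show "u (\<gamma> t + s *\<^sub>R e) \<le> C" if "cmod t = r" for t
        using that s by (intro C) (auto simp: K_def)
    qed (use r inD s in auto)
    then show ?thesis using inD[of 0 s] s r by auto
  qed
  then have ev: "\<forall>\<^sub>F s in at_right 0. \<gamma> 0 + s *\<^sub>R e \<in> {z \<in> D. u z \<le> C}"
    by (intro eventually_at_rightI[OF _ s0(1)]) (auto simp: greaterThanLessThan_iff)
  have "((\<lambda>s. \<gamma> 0 + s *\<^sub>R e) \<longlongrightarrow> \<gamma> 0 + 0 *\<^sub>R e) (at_right 0)"
    by (intro tendsto_intros)
  then have "\<gamma> 0 \<in> {z \<in> D. u z \<le> C}"
    using compact_imp_closed[OF cu] ev
    by (intro Lim_in_closed_set[where f = "\<lambda>s. \<gamma> 0 + s *\<^sub>R e" and F = "at_right (0::real)"]) auto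
  then show False using nD by simp
qed

section \<open>Holomorphic functions on complex lines\<close>

lemma bounded_linear_smult_left: "bounded_linear (\<lambda>c. c *s (v :: complex ^ 'n))"
  unfolding linear_conv_bounded_linear[symmetric]
  by (rule linearI) (simp_all add: vec_eq_iff algebra_simps)

lemma bounded_linear_smult_right: "bounded_linear (\<lambda>v. c *s (v :: complex ^ 'n))"
  unfolding linear_conv_bounded_linear[symmetric]
  by (rule linearI) (simp_all add: vec_eq_iff algebra_simps)

lemmas continuous_on_smult_left [continuous_intros] =
  bounded_linear.continuous_on[OF bounded_linear_smult_left]

lemma continuous_on_smult [continuous_intros]:
  fixes f :: "'a::topological_space \<Rightarrow> complex" and g :: "'a \<Rightarrow> complex ^ 'n"
  assumes "continuous_on S f" "continuous_on S g"
  shows "continuous_on S (\<lambda>x. f x *s g x)"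
  unfolding continuous_on_def vector_scalar_mult_def
  by (auto intro!: vec_tendstoI tendsto_intros tendsto_vec_nth assms[unfolded continuous_on_def, rule_format])

lemma holo_fun_on_imp_continuous_on: "holo_fun_on f D \<Longrightarrow> continuous_on D f"
  unfolding holo_fun_on_def
  by (meson continuous_at_imp_continuous_on has_derivative_continuous)

text \<open>Defined by a one-variable complex derivative, so that one-variable theory applies along
  complex lines.\<close>

definition directional_deriv :: "(complex ^ 'n \<Rightarrow> complex) \<Rightarrow> complex ^ 'n \<Rightarrow> complex ^ 'n \<Rightarrow> complex" where
  "directional_deriv f v z = deriv (\<lambda>t. f (z + t *s v)) 0"

lemma has_field_derivative_along_line:
  fixes f :: "complex ^ 'n \<Rightarrow> complex"
  assumes f: "(f has_derivative L) (at (a + t *s v))" and L: "\<And>c v. L (c *s v) = c * L v"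
  shows "((\<lambda>t. f (a + t *s v)) has_field_derivative L v) (at t)"
proof -
  have "((\<lambda>t. a + t *s v) has_derivative (\<lambda>h. h *s v)) (at t)"
    by (auto intro!: derivative_eq_intros bounded_linear_imp_has_derivative bounded_linear_smult_left)
  then have "((\<lambda>t. f (a + t *s v)) has_derivative (\<lambda>h. L (h *s v))) (at t)"
    using f by (rule has_derivative_compose)
  then show ?thesis
    unfolding has_field_derivative_def L by (simp add: mult.commute[of _ "L v"])
qed

lemma holo_fun_on_line_holomorphic:
  assumes f: "holo_fun_on f D" and D: "\<And>t. t \<in> S \<Longrightarrow> a + t *s v \<in> D" and S: "open S"
  shows "(\<lambda>t. f (a + t *s v)) holomorphic_on S"
  unfolding holomorphic_on_open[OF S]
  using f D has_field_derivative_along_line unfolding holo_fun_on_def by metis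

lemma directional_deriv_eq:
  assumes f: "(f has_derivative L) (at z)" and L: "\<And>c v. L (c *s v) = c * L v"
  shows "directional_deriv f v z = L v"
  unfolding directional_deriv_def
  by (rule DERIV_imp_deriv, rule has_field_derivative_along_line) (use f L in auto)

lemma vec_eq_sum_axis: "v = (\<Sum>j\<in>UNIV. (v $ j) *s axis j (1 :: complex))"
  by (simp add: vec_eq_iff axis_def if_distrib[where f = "\<lambda>x. _ * x"] sum.delta cong: if_cong)

lemma holo_fun_on_has_derivative:
  assumes f: "holo_fun_on f D" and z: "z \<in> D"
  shows "(f has_derivative (\<lambda>v. \<Sum>j\<in>UNIV. v $ j * directional_deriv f (axis j 1) z)) (at z)"
proof -
  obtain L where L: "(f has_derivative L) (at z)" "\<And>c v. L (c *s v) = c * L v"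
    using f z unfolding holo_fun_on_def by blast
  have "linear L"
    using L(1) has_derivative_linear by blast
  have "L v = (\<Sum>j\<in>UNIV. v $ j * directional_deriv f (axis j 1) z)" for v
  proof -
    have "L v = L (\<Sum>j\<in>UNIV. (v $ j) *s axis j 1)"
      by (subst vec_eq_sum_axis[of v]) simp
    also have "\<dots> = (\<Sum>j\<in>UNIV. v $ j * directional_deriv f (axis j 1) z)"
      using \<open>linear L\<close> by (simp add: linear_sum L(2) directional_deriv_eq[OF L])
    finally show ?thesis .
  qed
  then have "L = (\<lambda>v. \<Sum>j\<in>UNIV. v $ j * directional_deriv f (axis j 1) z)" by blast
  with L(1) show ?thesis by simp
qed

text \<open>Every point of the half disc has a disc of radius \<open>\<rho> / 4\<close> around it
  inside the full disc, so Cauchy's inequality bounds the second derivative by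
  \<open>2 * M / (\<rho> / 4)\<^sup>2\<close>, which is the constant 32. As it depends only on
  \<open>M\<close> and \<rho>, the bound is uniform over families of functions.\<close>

lemma holomorphic_taylor_bound:
  assumes F: "F holomorphic_on ball 0 \<rho>" and M: "\<And>h. cmod h < \<rho> \<Longrightarrow> cmod (F h) \<le> M"
    and h: "cmod h \<le> \<rho> / 2" and \<rho>: "0 < \<rho>"
  shows "cmod (F h - F 0 - h * deriv F 0) \<le> 32 * M / \<rho>\<^sup>2 * (cmod h)\<^sup>2"
proof -
  let ?g = "\<lambda>i::nat. (deriv ^^ i) F"
  have hol: "?g i holomorphic_on ball 0 \<rho>" for i
    using F by (intro holomorphic_higher_deriv) auto
  have "cmod (?g 0 h - (\<Sum>i\<le>1. ?g i 0 * (h - 0) ^ i / fact i))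
      \<le> (32 * M / \<rho>\<^sup>2) * cmod (h - 0) ^ Suc 1 / fact 1"
  proof (rule complex_Taylor[where S = "cball 0 (\<rho> / 2)" and f = ?g])
    fix i and x :: complex assume x: "x \<in> cball 0 (\<rho> / 2)" and "i \<le> (1::nat)"
    have "x \<in> ball 0 \<rho>" using x \<rho> by auto
    then show "(?g i has_field_derivative ?g (Suc i) x) (at x within cball 0 (\<rho> / 2))"
      using has_field_derivative_at_within[OF holomorphic_derivI[OF hol[of i] open_ball]] by simp
  next
    fix x :: complex assume x: "x \<in> cball 0 (\<rho> / 2)"
    have sub: "cball x (\<rho> / 4) \<subseteq> ball 0 \<rho>"
    proof
      fix y assume "y \<in> cball x (\<rho> / 4)"
      then show "y \<in> ball 0 \<rho>"
        using x \<rho> norm_triangle_ineq[of x "y - x"] by (auto simp: dist_norm norm_minus_commute)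
    qed
    have "cmod (?g 2 x) \<le> fact 2 * M / (\<rho> / 4) ^ 2"
    proof (rule Cauchy_inequality)
      show "F holomorphic_on ball x (\<rho> / 4)"
        using F sub ball_subset_cball by (meson holomorphic_on_subset order_trans)
      show "continuous_on (cball x (\<rho> / 4)) F"
        using F sub by (meson holomorphic_on_imp_continuous_on holomorphic_on_subset)
      fix y assume "cmod (x - y) = \<rho> / 4"
      then have "y \<in> cball x (\<rho> / 4)" by (simp add: dist_norm)
      then have "y \<in> ball 0 \<rho>" using sub by blast
      then show "cmod (F y) \<le> M" using M by simp
    qed (use \<rho> in auto)
    also have "\<dots> = 32 * M / \<rho>\<^sup>2"
      by (simp add: power2_eq_square)
    finally show "cmod (?g (Suc 1) x) \<le> 32 * M / \<rho>\<^sup>2"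
      by (simp add: numeral_2_eq_2)
  qed (use h \<rho> in auto)
  then show ?thesis
    by (simp add: algebra_simps power2_eq_square)
qed

text \<open>The difference quotients of \<open>f\<close> in direction \<open>v\<close> are
  holomorphic in \<open>t\<close>. By the previous Taylor bound they converge to the directional
  derivative at a rate independent of \<open>t\<close> in a small closed disc, and a locally uniform
  limit of holomorphic functions is holomorphic.\<close>

lemma directional_deriv_line_holomorphic:
  fixes D :: "(complex ^ 'n) set"
  assumes f: "holo_fun_on f D" and "open D" and D: "\<And>t. t \<in> S \<Longrightarrow> a + t *s w \<in> D" and S: "open S"
  shows "(\<lambda>t. directional_deriv f v (a + t *s w)) holomorphic_on S"
proof -
  have "\<exists>d>0. (\<lambda>t. directional_deriv f v (a + t *s w)) holomorphic_on ball t0 d" if "t0 \<in> S" for t0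
  proof -
    obtain d where d: "0 < d" "cball t0 d \<subseteq> S"
      using S \<open>t0 \<in> S\<close> open_contains_cball by blast
    define K where "K = (\<lambda>t. a + t *s w) ` cball t0 d"
    have K: "compact K" "K \<subseteq> D"
      using D d unfolding K_def by (auto intro!: compact_continuous_image continuous_intros)
    obtain \<eta> where \<eta>: "0 < \<eta>" "(\<Union>x\<in>K. cball x \<eta>) \<subseteq> D"
      using compact_subset_open_imp_cball_epsilon_subset[OF K(1) \<open>open D\<close> K(2)] by metis
    define \<rho> where "\<rho> = \<eta> / (norm v + 1)"
    have \<rho>: "0 < \<rho>" "\<rho> * norm v \<le> \<eta>"
      using \<eta> by (auto simp: \<rho>_def divide_simps add_nonneg_pos)
    have inD: "(a + t *s w) + h *s v \<in> D" if "cmod (t - t0) \<le> d" "cmod h \<le> \<rho>" for t h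
    proof -
      have "norm (h *s v) \<le> \<rho> * norm v"
        using that by (simp add: norm_vec_def norm_mult L2_set_right_distrib[symmetric] mult_right_mono L2_set_nonneg)
      then have "(a + t *s w) + h *s v \<in> cball (a + t *s w) \<eta>"
        using \<rho> by (simp add: dist_norm)
      moreover have "a + t *s w \<in> K"
        using that by (auto simp: K_def dist_norm norm_minus_commute)
      ultimately show ?thesis using \<eta> by blast
    qed
    let ?G = "\<lambda>(t, h). (a + t *s w) + h *s v"
    have "continuous_on (cball t0 d \<times> cball 0 \<rho>) (f \<circ> ?G)"
    proof (rule continuous_on_compose)
      show "continuous_on (cball t0 d \<times> cball 0 \<rho>) ?G"
        unfolding case_prod_unfold by (intro continuous_intros)
      show "continuous_on (?G ` (cball t0 d \<times> cball 0 \<rho>)) f"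
        by (rule continuous_on_subset[OF holo_fun_on_imp_continuous_on[OF f]])
          (auto simp: dist_norm norm_minus_commute intro: inD)
    qed
    then have "bounded ((f \<circ> ?G) ` (cball t0 d \<times> cball 0 \<rho>))"
      by (intro compact_imp_bounded compact_continuous_image compact_Times) auto
    then obtain M where M0: "\<And>x. x \<in> cball t0 d \<times> cball 0 \<rho> \<Longrightarrow> cmod ((f \<circ> ?G) x) \<le> M"
      unfolding bounded_iff by blast
    have M: "cmod (f ((a + t *s w) + h *s v)) \<le> M" if "cmod (t - t0) \<le> d" "cmod h \<le> \<rho>" for t h
      using M0[of "(t, h)"] that by (simp add: dist_norm norm_minus_commute)
    \<comment> \<open>Steps tending to 0 whose modulus is at most \<open>\<rho> / 2\<close>, the
      range of the Taylor bound.\<close>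
    define h where "h n = complex_of_real (\<rho> / (2 * real (Suc n)))" for n
    have h: "cmod (h n) \<le> \<rho> / 2" "h n \<noteq> 0" for n
      using \<rho> by (auto simp: h_def divide_simps norm_divide norm_mult simp del: of_nat_Suc)
    have hn: "cmod (h n) = \<rho> / 2 * inverse (real (Suc n))" for n
    proof -
      have "cmod (h n) = \<rho> / (2 * real (Suc n))"
        using \<rho> unfolding h_def norm_of_real by simp
      then show ?thesis
        by (simp only: divide_inverse inverse_mult_distrib mult.assoc)
    qed
    define q where "q n t = (f ((a + t *s w) + h n *s v) - f (a + t *s w)) / h n" for n t
    define g where "g t = directional_deriv f v (a + t *s w)" for t
    have qg: "cmod (q n t - g t) \<le> 32 * M / \<rho>\<^sup>2 * cmod (h n)" if t: "cmod (t - t0) \<le> d" for n t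
    proof -
      let ?F = "\<lambda>h. f ((a + t *s w) + h *s v)"
      have "cmod (?F (h n) - ?F 0 - h n * deriv ?F 0) \<le> 32 * M / \<rho>\<^sup>2 * (cmod (h n))\<^sup>2"
      proof (rule holomorphic_taylor_bound)
        show "?F holomorphic_on ball 0 \<rho>"
          by (rule holo_fun_on_line_holomorphic[OF f]) (auto intro!: inD t)
      qed (use h \<rho> M t in auto)
      moreover have "?F (h n) - ?F 0 - h n * deriv ?F 0 = h n * (q n t - g t)"
        using h(2)[of n] by (simp add: q_def g_def directional_deriv_def field_simps)
      ultimately have "cmod (h n * (q n t - g t)) \<le> 32 * M / \<rho>\<^sup>2 * (cmod (h n))\<^sup>2"
        by (simp only:)
      then have "cmod (h n) * cmod (q n t - g t) \<le> cmod (h n) * (32 * M / \<rho>\<^sup>2 * cmod (h n))"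
        unfolding norm_mult power2_eq_square by (simp only: mult_ac)
      then show ?thesis
        by (rule mult_left_le_imp_le) (use h(2)[of n] in simp)
    qed
    have lim: "(\<lambda>n. 32 * M / \<rho>\<^sup>2 * cmod (h n)) \<longlonglongrightarrow> 0"
    proof -
      have "(\<lambda>n. 32 * M / \<rho>\<^sup>2 * (\<rho> / 2 * inverse (real (Suc n)))) \<longlonglongrightarrow> 32 * M / \<rho>\<^sup>2 * (\<rho> / 2 * 0)"
        by (intro tendsto_intros LIMSEQ_inverse_real_of_nat)
      then show ?thesis by (simp only: hn mult_zero_right)
    qed
    have "uniform_limit (cball t0 d) q g sequentially"
    proof (rule uniform_limitI)
      fix e :: real assume "0 < e"
      then have "\<forall>\<^sub>F n in sequentially. 32 * M / \<rho>\<^sup>2 * cmod (h n) < e"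
        using lim by (simp add: order_tendstoD)
      then show "\<forall>\<^sub>F n in sequentially. \<forall>t\<in>cball t0 d. dist (q n t) (g t) < e"
      proof eventually_elim
        case (elim n)
        show ?case
        proof
          fix t assume "t \<in> cball t0 d"
          then have "cmod (t - t0) \<le> d" by (simp add: dist_norm norm_minus_commute)
          from qg[OF this, of n] elim show "dist (q n t) (g t) < e"
            unfolding dist_norm by (rule le_less_trans)
        qed
      qed
    qed
    moreover have "\<forall>\<^sub>F n in sequentially. continuous_on (cball t0 d) (q n) \<and> q n holomorphic_on ball t0 d"
    proof (intro always_eventually allI conjI)
      fix n
      have 1: "(\<lambda>t. f ((a + t *s w) + h n *s v)) holomorphic_on ball t0 d"
        "(\<lambda>t. f (a + t *s w)) holomorphic_on ball t0 d"
      proof -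
        have hn': "cmod (h n) \<le> \<rho>" using h(1)[of n] \<rho> by linarith
        have "(\<lambda>t. f ((a + h n *s v) + t *s w)) holomorphic_on ball t0 d"
          using inD[OF _ hn'] by (intro holo_fun_on_line_holomorphic[OF f])
            (auto simp: dist_norm norm_minus_commute algebra_simps)
        then show "(\<lambda>t. f ((a + t *s w) + h n *s v)) holomorphic_on ball t0 d"
          by (simp add: algebra_simps)
        show "(\<lambda>t. f (a + t *s w)) holomorphic_on ball t0 d"
          using D d ball_subset_cball by (intro holo_fun_on_line_holomorphic[OF f]) blast+
      qed
      then show "q n holomorphic_on ball t0 d"
        unfolding q_def using h(2) by (intro holomorphic_intros) auto
      have "continuous_on (cball t0 d) (\<lambda>t. f ((a + t *s w) + k *s v))" if "cmod k \<le> \<rho>" for k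
        by (rule continuous_on_compose2[OF holo_fun_on_imp_continuous_on[OF f]])
          (use inD that in \<open>auto simp: dist_norm norm_minus_commute intro!: continuous_intros\<close>)
      from this[of "h n"] this[of 0] show "continuous_on (cball t0 d) (q n)"
        unfolding q_def using h[of n] \<rho> by (auto intro!: continuous_intros)
    qed
    ultimately have "g holomorphic_on ball t0 d"
      using holomorphic_uniform_limit[where f = q and g = g and z = t0 and r = d and F = sequentially] by auto
    then show ?thesis
      using d unfolding g_def by blast
  qed
  note local = this
  show ?thesis
    unfolding holomorphic_on_def
  proof
    fix t0 assume "t0 \<in> S"
    obtain d where d: "d > 0" "(\<lambda>t. directional_deriv f v (a + t *s w)) holomorphic_on ball t0 d"
      using local[OF \<open>t0 \<in> S\<close>] by (elim exE conjE)
    show "(\<lambda>t. directional_deriv f v (a + t *s w)) field_differentiable at t0 within S"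
      by (rule field_differentiable_at_within, rule holomorphic_on_imp_differentiable_at[OF d(2) open_ball])
        (use d(1) in simp)
  qed
qed

section \<open>Removing the exceptional set\<close>

lemma matrix_vector_mult_bounded_linear: "bounded_linear (\<lambda>v. (M :: complex ^ 'n ^ 'm) *v v)"
  unfolding linear_conv_bounded_linear[symmetric]
  by (rule linearI)
    (simp_all add: vec_eq_iff matrix_vector_mult_def algebra_simps sum.distrib scaleR_sum_right)

lemma eq_on_closure:
  fixes f g :: "'a::metric_space \<Rightarrow> 'b::t2_space"
  assumes f: "continuous_on S f" and g: "continuous_on S g" and eq: "\<And>x. x \<in> W \<Longrightarrow> f x = g x"
    and W: "W \<subseteq> S" and x: "x \<in> S" "x \<in> closure W"
  shows "f x = g x"
proof -
  obtain X where X: "\<And>n. X n \<in> W" "X \<longlonglongrightarrow> x"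
    using x(2) closure_sequential by blast
  have "(\<lambda>n. f (X n)) \<longlonglongrightarrow> f x" "(\<lambda>n. g (X n)) \<longlonglongrightarrow> g x"
    using continuous_on_tendsto_compose[OF f X(2) x(1)] continuous_on_tendsto_compose[OF g X(2) x(1)]
    by (simp_all add: X(1) subsetD[OF W])
  then show ?thesis
    using eq X(1) LIMSEQ_unique by fastforce
qed

text \<open>The Jacobian matrix of \<open>f / a\<close> multiplied by the square of
  \<open>a\<close>. This numerator is polynomial in \<open>a\<close>, \<open>f\<close> and their
  first derivatives, so it remains meaningful, and holomorphic along lines, at the zeros of
  \<open>a\<close>.\<close>

definition quotient_jacobian :: "(complex ^ 'n \<Rightarrow> complex) \<Rightarrow> (complex ^ 'n \<Rightarrow> complex ^ 'n) \<Rightarrow> complex ^ 'n \<Rightarrow> complex ^ 'n ^ 'n" where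
  "quotient_jacobian a f w = (\<chi> i j. a w * directional_deriv (\<lambda>z. f z $ i) (axis j 1) w
     - f w $ i * directional_deriv a (axis j 1) w)"

lemma quotient_has_derivative:
  fixes f :: "complex ^ 'n \<Rightarrow> complex ^ 'n"
  assumes a: "holo_fun_on a D" and f: "\<And>i. holo_fun_on (\<lambda>z. f z $ i) D" and w: "w \<in> D" "a w \<noteq> 0"
  shows "((\<lambda>z. (1 / a z) *s f z) has_derivative (\<lambda>v. (1 / (a w)\<^sup>2) *s (quotient_jacobian a f w *v v))) (at w)"
proof -
  have comp: "((\<lambda>z. ((1 / a z) *s f z) $ i) has_derivative
      (\<lambda>v. ((1 / (a w)\<^sup>2) *s (quotient_jacobian a f w *v v)) $ i)) (at w)" for i
  proof -
    let ?A = "\<lambda>v. \<Sum>j\<in>UNIV. v $ j * directional_deriv a (axis j 1) w"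
    let ?F = "\<lambda>v. \<Sum>j\<in>UNIV. v $ j * directional_deriv (\<lambda>z. f z $ i) (axis j 1) w"
    have "((\<lambda>z. f z $ i / a z) has_derivative (\<lambda>v. (?F v * a w - f w $ i * ?A v) / (a w * a w))) (at w)"
      by (rule has_derivative_divide'[OF holo_fun_on_has_derivative[OF f w(1)] holo_fun_on_has_derivative[OF a w(1)] w(2)])
    moreover have "?F v * a w - f w $ i * ?A v = (quotient_jacobian a f w *v v) $ i" for v
      by (simp add: quotient_jacobian_def matrix_vector_mult_def sum_distrib_left sum_distrib_right
          sum_subtractf[symmetric] algebra_simps)
    ultimately show ?thesis
      by (simp only: vector_smult_component power2_eq_square times_divide_eq_left mult_1)
  qed
  show ?thesis
  proof (rule iffD2[OF has_derivative_componentwise_within], rule ballI)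
    fix b :: "complex ^ 'n" assume "b \<in> Basis"
    then obtain i c where b: "b = axis i c"
      unfolding Basis_vec_def by auto
    have "(x \<bullet> b) = (x $ i) \<bullet> c" for x :: "complex ^ 'n"
      unfolding b inner_axis by simp
    then show "((\<lambda>z. ((1 / a z) *s f z) \<bullet> b) has_derivative
       (\<lambda>v. ((1 / (a w)\<^sup>2) *s (quotient_jacobian a f w *v v)) \<bullet> b)) (at w)"
      using has_derivative_inner_left[OF comp[of i], of c] by simp
  qed
qed

lemma det_holomorphic_on:
  fixes A :: "complex \<Rightarrow> complex ^ 'n ^ 'n"
  assumes "\<And>i j. (\<lambda>t. A t $ i $ j) holomorphic_on S"
  shows "(\<lambda>t. det (A t)) holomorphic_on S"
  unfolding det_def by (intro holomorphic_intros assms)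

lemma holomorphic_on_smult_component:
  "a holomorphic_on S \<Longrightarrow> (\<lambda>t. f t $ i) holomorphic_on S \<Longrightarrow> (\<lambda>t. (a t *s f t) $ i) holomorphic_on S"
  by (auto intro!: holomorphic_intros)

text \<open>Here \<open>g = \<psi> / \<psi>0\<close> and \<open>\<phi> / \<phi>0\<close> are mutually inverse on a dense set. The points of \<open>D\<close> not
  mapped into \<open>D'\<close> are zeros of \<open>\<psi>0\<close> times the Jacobian determinant, hence punctures of
  holomorphic discs in \<open>D'\<close>.\<close>

lemma dense_inverse_extends:
  fixes D D' :: "(complex ^ 'n) set" and \<psi> \<phi> :: "complex ^ 'n \<Rightarrow> complex ^ 'n"
  assumes D: "open D" and D': "open D'" "bounded D'" "pseudoconvex D'" "holder_boundary D'"
    and \<psi>0: "holo_fun_on \<psi>0 D" and \<psi>: "\<And>i. holo_fun_on (\<lambda>w. \<psi> w $ i) D"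
    and \<phi>0: "holo_fun_on \<phi>0 D'" and \<phi>: "\<And>i. holo_fun_on (\<lambda>z. \<phi> z $ i) D'"
    and W: "W \<subseteq> D" "D \<subseteq> closure W"
    and W': "\<And>w. w \<in> W \<Longrightarrow> \<exists>z\<in>D'. \<psi> w = \<psi>0 w *s z \<and> \<psi>0 w * \<phi>0 z = 1 \<and> \<psi>0 w *s \<phi> z = w"
    and w: "w \<in> D"
  shows "\<psi>0 w \<noteq> 0 \<and> (1 / \<psi>0 w) *s \<psi> w \<in> D' \<and> \<psi>0 w * \<phi>0 ((1 / \<psi>0 w) *s \<psi> w) = 1
     \<and> \<psi>0 w *s \<phi> ((1 / \<psi>0 w) *s \<psi> w) = w"
proof -
  define g where "g w = (1 / \<psi>0 w) *s \<psi> w" for w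
  \<comment> \<open>\<open>N\<close> is where the quotient \<open>g\<close> is defined and
    \<open>E\<close> is the part of it sent into \<open>D'\<close>; the aim is to show that
    \<open>E\<close> is all of \<open>D\<close>. The identities known on the dense set
    \<open>W\<close> pass to \<open>E\<close> by continuity.\<close>
  define N where "N = {w \<in> D. \<psi>0 w \<noteq> 0}"
  define E where "E = {w \<in> N. g w \<in> D'}"
  have cont0: "continuous_on D \<psi>0" and cont\<psi>: "continuous_on D \<psi>"
    using \<psi>0 \<psi> by (auto intro!: holo_fun_on_imp_continuous_on continuous_on_vec)
  have cont\<phi>0: "continuous_on D' \<phi>0" and cont\<phi>: "continuous_on D' \<phi>"
    using \<phi>0 \<phi> by (auto intro!: holo_fun_on_imp_continuous_on continuous_on_vec)
  have ND: "N \<subseteq> D" by (auto simp: N_def)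
  have "open N"
  proof -
    have "N = D \<inter> \<psi>0 -` (- {0})" by (auto simp: N_def)
    then show ?thesis
      using continuous_open_preimage[OF cont0 D, of "- {0}"] by (simp add: open_Compl)
  qed
  have contg: "continuous_on N g"
    unfolding g_def using ND cont0 cont\<psi>
    by (intro continuous_intros) (auto simp: N_def elim: continuous_on_subset)
  have "open E"
  proof -
    have "E = N \<inter> g -` D'" by (auto simp: E_def)
    then show ?thesis
      using continuous_open_preimage[OF contg \<open>open N\<close> D'(1)] by simp
  qed
  have EN: "E \<subseteq> N" by (auto simp: E_def)
  have gW: "w \<in> E \<and> \<psi>0 w * \<phi>0 (g w) = 1 \<and> \<psi>0 w *s \<phi> (g w) = w" if "w \<in> W" for w
  proof -
    obtain z where z: "z \<in> D'" "\<psi> w = \<psi>0 w *s z" "\<psi>0 w * \<phi>0 z = 1" "\<psi>0 w *s \<phi> z = w"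
      using W'[OF \<open>w \<in> W\<close>] by blast
    then have "\<psi>0 w \<noteq> 0" by auto
    then have "g w = z"
      by (simp add: g_def z(2) vector_smult_assoc)
    with z \<open>\<psi>0 w \<noteq> 0\<close> that W show ?thesis
      by (auto simp: E_def N_def)
  qed
  then have WE: "W \<subseteq> E" by blast
  have id: "\<psi>0 w * \<phi>0 (g w) = 1 \<and> \<psi>0 w *s \<phi> (g w) = w" if "w \<in> E" for w
  proof
    have contE: "continuous_on E g" "continuous_on E \<psi>0"
      using contg cont0 EN ND by (auto elim!: continuous_on_subset)
    have gE: "g ` E \<subseteq> D'" by (auto simp: E_def)
    have "w \<in> closure W" using that EN ND W by blast
    have c: "continuous_on E (\<lambda>w. \<phi>0 (g w))" "continuous_on E (\<lambda>w. \<phi> (g w))"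
      using continuous_on_compose2[OF cont\<phi>0 contE(1) gE] continuous_on_compose2[OF cont\<phi> contE(1) gE] .
    show "\<psi>0 w * \<phi>0 (g w) = 1"
      using gW by (intro eq_on_closure[OF continuous_on_mult[OF contE(2) c(1)] continuous_on_const _ WE that \<open>w \<in> closure W\<close>]) simp
    show "\<psi>0 w *s \<phi> (g w) = w"
      using gW by (intro eq_on_closure[OF continuous_on_smult[OF contE(2) c(2)] continuous_on_id _ WE that \<open>w \<in> closure W\<close>]) simp
  qed
  define M where "M = quotient_jacobian \<psi>0 \<psi>"
  have dg: "(g has_derivative (\<lambda>v. (1 / (\<psi>0 w)\<^sup>2) *s (M w *v v))) (at w)" if "w \<in> N" for w
    unfolding g_def M_def using that by (intro quotient_has_derivative[OF \<psi>0 \<psi>]) (auto simp: N_def)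
  \<comment> \<open>On the open set \<open>E\<close> the map \<open>g\<close> has the differentiable
    left inverse \<open>h\<close>, so the chain rule makes its derivative injective.\<close>
  have detE: "det (M w) \<noteq> 0" if wE: "w \<in> E" for w
  proof -
    define h where "h z = (1 / \<phi>0 z) *s \<phi> z" for z
    have ne: "\<phi>0 (g x) \<noteq> 0" if "x \<in> E" for x using id[OF that] by auto
    have hg: "h (g x) = x" if "x \<in> E" for x
    proof -
      have "1 / \<phi>0 (g x) = \<psi>0 x" using id[OF that] ne[OF that] by (simp add: field_simps)
      then show ?thesis using id[OF that] by (simp add: h_def)
    qed
    obtain H where H: "(h has_derivative H) (at (g w))"
      unfolding h_def using quotient_has_derivative[OF \<phi>0 \<phi>, of "g w"] ne[OF wE] wE
      by (auto simp: E_def)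
    have "((\<lambda>x. h (g x)) has_derivative (\<lambda>v. H ((1 / (\<psi>0 w)\<^sup>2) *s (M w *v v)))) (at w)"
      using has_derivative_compose[OF dg H] wE EN by blast
    moreover have "((\<lambda>x. h (g x)) has_derivative (\<lambda>v. v)) (at w)"
      by (rule has_derivative_transform_within_open[OF _ \<open>open E\<close> wE, of "\<lambda>x. x"])
        (auto simp: hg)
    ultimately have eq: "H ((1 / (\<psi>0 w)\<^sup>2) *s (M w *v v)) = v" for v
      using has_derivative_unique by metis
    have "v = 0" if "M w *v v = 0" for v
    proof -
      have "linear H" using H has_derivative_linear by blast
      then have "H 0 = 0" by (rule linear_0)
      with eq[of v] that show ?thesis by simp
    qed
    then have "\<exists>B. B ** M w = mat 1"
      using matrix_left_invertible_ker[of "M w"] by blast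
    then show ?thesis
      by (metis invertible_det_nz invertible_left_inverse)
  qed
  have gcl: "g w \<in> closure D'" if "w \<in> N" for w
  proof -
    obtain X where X: "\<And>n. X n \<in> W" "X \<longlonglongrightarrow> w"
      using W \<open>w \<in> N\<close> ND closure_sequential by blast
    have "(\<lambda>n. g (X n)) \<longlonglongrightarrow> g w"
      using continuous_on_tendsto_compose[OF contg X(2) that] X(1) WE EN by (simp add: subset_iff)
    moreover have "g (X n) \<in> D'" for n
      using X WE by (auto simp: E_def)
    ultimately show ?thesis
      unfolding closure_sequential by (intro exI[of _ "\<lambda>n. g (X n)"]) simp
  qed
  have regular: "w \<in> E" if w: "w \<in> N" "det (M w) \<noteq> 0" for w
  proof -
    obtain B where B: "M w ** B = mat 1"
      using w(2) by (metis invertible_def invertible_det_nz)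
    \<comment> \<open>An invertible derivative makes \<open>g\<close> open at \<open>w\<close>. By
      density the values of \<open>g\<close> lie in the closure of \<open>D'\<close>, so
      \<open>g w\<close> is interior to that closure, and this interior is
      \<open>D'\<close>.\<close>
    have "g w \<in> interior (g ` N)"
    proof (rule sussmann_open_mapping[OF \<open>open N\<close> contg w(1) dg[OF w(1)]])
      show "bounded_linear (\<lambda>y. B *v ((\<psi>0 w)\<^sup>2 *s y))"
        by (rule bounded_linear_compose[OF matrix_vector_mult_bounded_linear bounded_linear_smult_right])
      have "(1 / (\<psi>0 w)\<^sup>2) *s (M w *v (B *v ((\<psi>0 w)\<^sup>2 *s y))) = y" for y
        using w(1) unfolding N_def
        by (simp add: matrix_vector_mul_assoc B vector_smult_assoc)
      then show "(\<lambda>v. (1 / (\<psi>0 w)\<^sup>2) *s (M w *v v)) \<circ> (\<lambda>y. B *v ((\<psi>0 w)\<^sup>2 *s y)) = id"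
        by (simp add: fun_eq_iff)
      show "w \<in> interior N" using w(1) \<open>open N\<close> by (simp add: interior_open)
    qed simp
    also have "interior (g ` N) \<subseteq> interior (closure D')"
      using gcl by (intro interior_mono) auto
    also have "\<dots> = D'"
      by (rule holder_boundary_interior_closure[OF D'(4,1)])
    finally show ?thesis using w by (simp add: E_def)
  qed
  \<comment> \<open>Exceptional points of both kinds, zeros of \<open>\<psi>0\<close> and degenerate
    points of \<open>g\<close>, are zeros of the single function \<open>Q\<close>.\<close>
  define Q where "Q w = \<psi>0 w * det (M w)" for w
  have "w \<in> E"
  proof (cases "Q w = 0")
    case False
    then show ?thesis using w by (intro regular) (auto simp: Q_def N_def)
  next
    case True
    obtain \<rho> where \<rho>: "0 < \<rho>" "ball w \<rho> \<subseteq> D"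
      using D w open_contains_ball by blast
    have "w \<in> closure W" using W w by blast
    \<comment> \<open>The complex line from \<open>w\<close> to a nearby point of \<open>W\<close>
      is used because \<open>Q\<close> is nonzero at its parameter 1; hence \<open>Q\<close> is not
      identically zero on it and the zero at parameter 0 is isolated.\<close>
    then obtain w' where w': "w' \<in> W" "dist w' w < \<rho>"
      using \<rho> closure_approachable by blast
    define v where "v = w' - w"
    define S where "S = {t. w + t *s v \<in> ball w \<rho>}"
    have S_eq: "S = {t. cmod t * norm v < \<rho>}"
      by (simp add: S_def dist_norm norm_smult_complex_vec)
    have "open S"
      unfolding S_eq by (intro open_Collect_less continuous_intros)
    have "convex S"
    proof -
      have "S = (\<lambda>t. t *s v) -` ball 0 \<rho>"
        unfolding S_eq by (auto simp: norm_smult_complex_vec)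
      then show ?thesis
        using convex_linear_vimage[OF bounded_linear.linear[OF bounded_linear_smult_left]] convex_ball by metis
    qed
    have inS: "0 \<in> S" "1 \<in> S"
      using \<rho> w' by (auto simp: S_eq v_def dist_norm)
    have SD: "w + t *s v \<in> D" if "t \<in> S" for t
      using that \<rho> by (auto simp: S_def)
    have hol0: "(\<lambda>t. \<psi>0 (w + t *s v)) holomorphic_on S"
      and hol\<psi>: "(\<lambda>t. \<psi> (w + t *s v) $ i) holomorphic_on S" for i
      using holo_fun_on_line_holomorphic[OF \<psi>0 SD \<open>open S\<close>]
        holo_fun_on_line_holomorphic[OF \<psi> SD \<open>open S\<close>] by auto
    have "(\<lambda>t. M (w + t *s v) $ i $ j) holomorphic_on S" for i j
      unfolding M_def quotient_jacobian_def vec_lambda_beta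
      by (intro holomorphic_intros hol0 hol\<psi> directional_deriv_line_holomorphic[OF \<psi>0 D SD \<open>open S\<close>]
          directional_deriv_line_holomorphic[OF \<psi> D SD \<open>open S\<close>])
    then have "(\<lambda>t. Q (w + t *s v)) holomorphic_on S"
      unfolding Q_def by (intro holomorphic_intros hol0 det_holomorphic_on)
    moreover have "Q (w + 1 *s v) \<noteq> 0"
      using w'(1) WE EN detE[of w'] by (auto simp: Q_def v_def N_def)
    ultimately obtain R where R: "0 < R" "ball 0 R \<subseteq> S"
      and nz: "\<And>t. t \<in> ball 0 R - {0} \<Longrightarrow> Q (w + t *s v) \<noteq> 0"
      using isolated_zeros[of "\<lambda>t. Q (w + t *s v)" S 0 1] \<open>open S\<close> \<open>convex S\<close> inS True
      by (metis convex_connected add.right_neutral vector_smult_lzero)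
    have punct: "w + t *s v \<in> E" if "t \<noteq> 0" "cmod t < R" for t
    proof -
      have "Q (w + t *s v) \<noteq> 0" using nz that by auto
      then show ?thesis using SD[of t] R that by (intro regular) (auto simp: Q_def N_def)
    qed
    obtain B where B: "\<And>z. z \<in> D' \<Longrightarrow> norm z \<le> B"
      using D'(2) bounded_iff by blast
    \<comment> \<open>On the punctured disc \<open>g\<close> takes values in the bounded set
      \<open>D'\<close>, so each component has a removable singularity, even if
      \<open>\<psi>0\<close> vanishes at \<open>w\<close>.\<close>
    have "\<exists>k. k holomorphic_on ball 0 R \<and> (\<forall>t\<in>ball 0 R - {0}. k t = g (w + t *s v) $ i)" for i
    proof (subst holomorphic_on_extend_bounded)
      show "(\<lambda>t. g (w + t *s v) $ i) holomorphic_on ball 0 R - {0}"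
        unfolding g_def using punct EN R
        by (intro holomorphic_on_smult_component holomorphic_intros
            holomorphic_on_subset[OF hol0] holomorphic_on_subset[OF hol\<psi>])
          (auto simp: E_def N_def)
      show "\<exists>B. \<forall>\<^sub>F t in at 0. cmod (g (w + t *s v) $ i) \<le> B"
      proof (intro exI[of _ B])
        have "cmod (g (w + t *s v) $ i) \<le> B" if "t \<noteq> 0" "cmod t < R" for t
          using B punct[OF that] Finite_Cartesian_Product.norm_nth_le[of "g (w + t *s v)" i]
          by (force simp: E_def)
        then show "\<forall>\<^sub>F t in at 0. cmod (g (w + t *s v) $ i) \<le> B"
          using R unfolding eventually_at by auto
      qed
    qed (use R in auto)
    then obtain k where k: "\<And>i. k i holomorphic_on ball 0 R"
      "\<And>i t. t \<noteq> 0 \<Longrightarrow> cmod t < R \<Longrightarrow> k i t = g (w + t *s v) $ i"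
      by (metis Diff_iff dist_0_norm mem_ball singletonD)
    define \<gamma> where "\<gamma> t = (\<chi> i. k i t)" for t
    have \<gamma>hol: "(\<lambda>t. \<gamma> t $ i) holomorphic_on ball 0 R" for i
      using k(1) by (simp add: \<gamma>_def)
    have \<gamma>g: "\<gamma> t = g (w + t *s v)" if "t \<noteq> 0" "cmod t < R" for t
      using k(2)[OF that] by (simp add: \<gamma>_def vec_eq_iff)
    have "\<gamma> 0 \<in> D'"
      by (rule pseudoconvex_holder_disc[OF D'(3,4,1) \<gamma>hol R(1)])
        (use \<gamma>g punct in \<open>auto simp: E_def\<close>)
    \<comment> \<open>\<open>F\<close> is 1 off the centre, hence at the centre by continuity. This
      excludes \<open>\<psi>0 w = 0\<close>, so \<open>w\<close> lies in \<open>N\<close>, and the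
      filled-in value \<open>\<gamma> 0\<close> is the value of \<open>g\<close> at
      \<open>w\<close>.\<close>
    define F where "F t = \<psi>0 (w + t *s v) * \<phi>0 (\<gamma> t)" for t
    have \<gamma>D: "\<gamma> ` ball 0 R \<subseteq> D'"
    proof -
      have "\<gamma> t \<in> D'" if "cmod t < R" for t
        using that \<gamma>g[of t] punct[of t] \<open>\<gamma> 0 \<in> D'\<close> by (cases "t = 0") (auto simp: E_def)
      then show ?thesis by auto
    qed
    have cont\<gamma>: "continuous_on (ball 0 R) \<gamma>"
      by (intro continuous_on_vec holomorphic_on_imp_continuous_on \<gamma>hol)
    have cont_line: "continuous_on (ball 0 R) (\<lambda>t. \<psi>0 (w + t *s v))"
      using hol0 R holomorphic_on_imp_continuous_on continuous_on_subset by blast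
    have "0 \<in> closure (ball 0 R - {0 :: complex})"
      using R by (simp add: islimpt_in_closure[symmetric] islimpt_ball)
    note cl0 = this
    have F1: "F t = 1" if "t \<in> ball 0 R - {0}" for t
      using that \<gamma>g[of t] id[OF punct, of t] by (simp add: F_def)
    have "continuous_on (ball 0 R) F"
      unfolding F_def by (rule continuous_on_mult[OF cont_line continuous_on_compose2[OF cont\<phi>0 cont\<gamma> \<gamma>D]])
    then have "F 0 = 1"
      by (rule eq_on_closure[OF _ continuous_on_const F1 _ _ cl0]) (use R in auto)
    then have nz0: "\<psi>0 w \<noteq> 0" by (auto simp: F_def)
    then have "w \<in> N" using w by (simp add: N_def)
    have lineN: "w + t *s v \<in> N" if "t \<in> ball 0 R" for t
      using that punct[of t] EN \<open>w \<in> N\<close> by (cases "t = 0") auto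
    have "continuous_on (ball 0 R) (\<lambda>t. g (w + t *s v))"
      by (rule continuous_on_compose2[OF contg])
        (use lineN in \<open>auto intro!: continuous_on_add continuous_on_smult_left\<close>)
    then have "\<gamma> 0 = g (w + 0 *s v)"
      using R \<gamma>g by (intro eq_on_closure[OF cont\<gamma> _ _ _ _ cl0]) auto
    then show ?thesis
      using \<open>\<gamma> 0 \<in> D'\<close> \<open>w \<in> N\<close> by (simp add: E_def)
  qed
  then show ?thesis
    using id[of w] EN unfolding g_def E_def N_def by blast
qed

section \<open>Unitary averages\<close>

lemma nn_integral_lborel_translation:
  fixes f :: "'a::euclidean_space \<Rightarrow> ennreal"
  assumes [measurable]: "f \<in> borel_measurable borel"
  shows "(\<integral>\<^sup>+x. f (c + x) \<partial>lborel) = (\<integral>\<^sup>+x. f x \<partial>lborel)"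
proof -
  have "(\<integral>\<^sup>+x. f x \<partial>lborel) = (\<integral>\<^sup>+x. f x \<partial>distr lborel borel ((+) c))"
    by (simp add: lborel_distr_plus)
  also have "\<dots> = (\<integral>\<^sup>+x. f (c + x) \<partial>lborel)"
    by (subst nn_integral_distr) auto
  finally show ?thesis ..
qed

lemma open_not_null_lborel:
  fixes S :: "'a::euclidean_space set"
  assumes "open S" "S \<noteq> {}"
  shows "S \<notin> null_sets lborel"
  using open_not_negligible[OF assms] null_sets_completionI negligible_iff_null_sets by blast

text \<open>The image of Lebesgue measure under \<open>R\<close> is translation invariant and agrees with Lebesgue measure
  on the unit ball; comparing it with convolutions by the indicator of the ball shows that it is Lebesgue
  measure.\<close>

lemma nn_integral_lborel_linear_isometry:
  fixes R :: "'a::euclidean_space \<Rightarrow> 'a"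
  assumes R: "linear R" and iso: "\<And>x. norm (R x) = norm x" and f [measurable]: "f \<in> borel_measurable borel"
  shows "(\<integral>\<^sup>+x. f (R x) \<partial>lborel) = (\<integral>\<^sup>+x. f x \<partial>lborel)"
proof -
  have [measurable]: "R \<in> borel_measurable borel"
    using R by (intro borel_measurable_continuous_onI linear_continuous_on) (simp add: linear_conv_bounded_linear)
  have "inj R"
    using R iso by (metis linear_injective_0 norm_eq_zero)
  then have "surj R"
    using R linear_injective_imp_surjective by blast
  then obtain S where S: "\<And>y. R (S y) = y"
    by (metis surjD)
  define k where "k x = (indicator (ball 0 1) x :: ennreal)" for x :: 'a
  have [measurable]: "k \<in> borel_measurable borel"
    unfolding k_def by (intro borel_measurable_indicator) simp
  have k_cong: "k x = k y" if "norm x = norm y" for x y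
    using that by (simp add: k_def indicator_def)
  define c where "c = (\<integral>\<^sup>+x. k x \<partial>lborel)"
  have c: "c = emeasure lborel (ball (0::'a) 1)"
    unfolding c_def k_def by simp
  have c_finite: "c \<noteq> \<infinity>"
    unfolding c using emeasure_bounded_finite[of "ball (0::'a) 1"] by (simp add: less_top)
  have c_pos: "c \<noteq> 0"
    unfolding c using open_not_null_lborel[of "ball (0::'a) 1"] by (auto simp: null_sets_def)
  have "c * (\<integral>\<^sup>+x. f (R x) \<partial>lborel) = (\<integral>\<^sup>+x. (\<integral>\<^sup>+y. f (R x) * k (- R x + y) \<partial>lborel) \<partial>lborel)"
  proof -
    have "(\<integral>\<^sup>+y. f (R x) * k (- R x + y) \<partial>lborel) = c * f (R x)" for x
    proof -
      have "(\<integral>\<^sup>+y. f (R x) * k (- R x + y) \<partial>lborel) = f (R x) * (\<integral>\<^sup>+y. k (- R x + y) \<partial>lborel)"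
        by (rule nn_integral_cmult) measurable
      also have "(\<integral>\<^sup>+y. k (- R x + y) \<partial>lborel) = c"
        unfolding c_def by (rule nn_integral_lborel_translation) measurable
      finally show ?thesis by (simp add: mult.commute)
    qed
    then show ?thesis by (simp add: nn_integral_cmult)
  qed
  also have "\<dots> = (\<integral>\<^sup>+y. (\<integral>\<^sup>+x. f (R x) * k (- R x + y) \<partial>lborel) \<partial>lborel)"
    by (rule lborel_pair.Fubini'[symmetric]) measurable
  also have "\<dots> = (\<integral>\<^sup>+y. (\<integral>\<^sup>+x. f (y + R x) * k x \<partial>lborel) \<partial>lborel)"
  proof (rule nn_integral_cong)
    fix y
    \<comment> \<open>After the translation by the preimage \<open>S y\<close> of \<open>y\<close>,
      the kernel is evaluated at \<open>- R x\<close>; it depends only on the norm, so it equals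
      \<open>k x\<close>.\<close>
    have "(\<integral>\<^sup>+x. f (R x) * k (- R x + y) \<partial>lborel) = (\<integral>\<^sup>+x. f (R (S y + x)) * k (- R (S y + x) + y) \<partial>lborel)"
      by (rule nn_integral_lborel_translation[symmetric]) measurable
    also have "\<dots> = (\<integral>\<^sup>+x. f (y + R x) * k x \<partial>lborel)"
      using R by (intro nn_integral_cong arg_cong2[where f = "(*)"] k_cong) (simp_all add: linear_add S iso)
    finally show "(\<integral>\<^sup>+x. f (R x) * k (- R x + y) \<partial>lborel) = (\<integral>\<^sup>+x. f (y + R x) * k x \<partial>lborel)" .
  qed
  also have "\<dots> = (\<integral>\<^sup>+x. (\<integral>\<^sup>+y. f (y + R x) * k x \<partial>lborel) \<partial>lborel)"
    by (rule lborel_pair.Fubini') measurable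
  also have "\<dots> = c * (\<integral>\<^sup>+y. f y \<partial>lborel)"
  proof -
    have "(\<integral>\<^sup>+y. f (y + R x) * k x \<partial>lborel) = (\<integral>\<^sup>+y. f y \<partial>lborel) * k x" for x
    proof -
      have "(\<integral>\<^sup>+y. f (y + R x) * k x \<partial>lborel) = (\<integral>\<^sup>+y. f (R x + y) \<partial>lborel) * k x"
        by (subst nn_integral_multc[symmetric]) (auto simp: add.commute)
      then show ?thesis by (simp add: nn_integral_lborel_translation)
    qed
    then show ?thesis unfolding c_def by (simp only:) (subst nn_integral_cmult, auto simp: mult.commute)
  qed
  finally show ?thesis
    using c_pos c_finite by (simp add: ennreal_mult_cancel_left)
qed

section \<open>The bilinear pairing and averages of its powers over the unit ball\<close>

text \<open>There is no conjugation, so that pairing a coefficient vector with a vector of functions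
  is a linear combination to which a linear isometry applies. The Hermitian product is recovered
  with \<open>vec_cnj\<close>.\<close>

definition bilin :: "complex ^ 'm \<Rightarrow> complex ^ 'm \<Rightarrow> complex" where
  "bilin c v = (\<Sum>i\<in>UNIV. c $ i * v $ i)"

definition vec_cnj :: "complex ^ 'm \<Rightarrow> complex ^ 'm" where
  "vec_cnj v = (\<chi> i. cnj (v $ i))"

lemma bilin_simps:
  "bilin (x + y) v = bilin x v + bilin y v" "bilin (x - y) v = bilin x v - bilin y v"
  "bilin v (x + y) = bilin v x + bilin v y" "bilin v (x - y) = bilin v x - bilin v y"
  "bilin (a *s x) v = a * bilin x v" "bilin v (a *s x) = a * bilin v x"
  by (simp_all add: bilin_def algebra_simps sum.distrib sum_subtractf sum_distrib_left)

lemma bilin_commute: "bilin x y = bilin y x"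
  by (simp add: bilin_def mult.commute)

lemma vec_cnj_simps:
  "vec_cnj (x - y) = vec_cnj x - vec_cnj y" "vec_cnj (a *s x) = cnj a *s vec_cnj x" "vec_cnj (vec_cnj x) = x"
  by (simp_all add: vec_cnj_def vec_eq_iff)

lemma cnj_bilin: "cnj (bilin x y) = bilin (vec_cnj x) (vec_cnj y)"
  by (simp add: bilin_def vec_cnj_def)

lemma bilin_norm: "bilin (vec_cnj x) x = complex_of_real ((norm x)\<^sup>2)"
  by (simp add: bilin_def vec_cnj_def norm_vec_def L2_set_def sum_nonneg complex_norm_square[symmetric] mult.commute)

text \<open>The isometry is a complex Householder reflection, composed with a phase that makes the Hermitian
  product of \<open>u\<close> and \<open>v\<close> real.\<close>

lemma linear_isometry_bilin:
  fixes u v :: "complex ^ 'm"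
  assumes uv: "norm u = norm v"
  obtains R where "linear R" "\<And>x. norm (R x) = norm x" "\<And>x. cmod (bilin (R x) v) = cmod (bilin x u)"
proof -
  define b where "b = bilin (vec_cnj u) v"
  define \<omega> where "\<omega> = (if b = 0 then 1 else sgn b)"
  have \<omega>: "cmod \<omega> = 1" by (simp add: \<omega>_def norm_sgn)
  define u' where "u' = \<omega> *s u"
  have nu': "norm u' = norm v"
    by (simp add: u'_def norm_smult_complex_vec \<omega> uv)
  have "bilin (vec_cnj u') v = cnj \<omega> * b"
    by (simp add: u'_def b_def vec_cnj_simps bilin_simps)
  also have "\<dots> = of_real (cmod b)"
    by (simp add: \<omega>_def sgn_eq complex_norm_square[symmetric] mult.commute power2_eq_square)
  finally have real: "bilin (vec_cnj u') v = of_real (cmod b)" .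
  then have real': "bilin (vec_cnj v) u' = of_real (cmod b)"
    by (metis bilin_commute cnj_bilin complex_cnj_complex_of_real vec_cnj_simps(3))
  define n where "n = v - u'"
  \<comment> \<open>For \<open>n = 0\<close> the division gives \<open>s = 0\<close>, so
    \<open>R\<close> is the identity and this case needs no separate construction.\<close>
  define s where "s = complex_of_real (2 / (norm n)\<^sup>2)"
  define R where "R x = x - (s * bilin x n) *s vec_cnj n" for x
  show ?thesis
  proof (rule that[of R])
    show "linear R"
      by (rule linearI)
        (simp_all add: R_def bilin_simps vec_eq_iff algebra_simps bilin_def scaleR_sum_right sum_distrib_left sum.distrib)
    show "norm (R x) = norm x" for x
    proof -
      have nn: "s * bilin n (vec_cnj n) * s = 2 * s"
        by (cases "n = 0") (simp_all add: s_def bilin_commute[of n] bilin_norm power2_eq_square field_simps bilin_simps)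
      have cs: "cnj s = s" by (simp add: s_def)
      define \<beta> where "\<beta> = bilin x n"
      have Rx: "R x = x - (s * \<beta>) *s vec_cnj n" "vec_cnj (R x) = vec_cnj x - (s * cnj \<beta>) *s n"
        by (simp_all add: R_def \<beta>_def vec_cnj_simps cs)
      have b: "bilin (vec_cnj x) (vec_cnj n) = cnj \<beta>" "bilin n x = \<beta>"
        unfolding \<beta>_def by (rule cnj_bilin[symmetric], rule bilin_commute)
      have "bilin (vec_cnj (R x)) (R x) = bilin (vec_cnj x) x - 2 * s * (\<beta> * cnj \<beta>)
          + s * bilin n (vec_cnj n) * s * (\<beta> * cnj \<beta>)"
        unfolding Rx(2) unfolding Rx(1) bilin_simps b by (simp add: algebra_simps)
      also have "\<dots> = bilin (vec_cnj x) x"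
        unfolding nn by simp
      finally have "(norm (R x))\<^sup>2 = (norm x)\<^sup>2"
        unfolding bilin_norm of_real_eq_iff .
      then show ?thesis by simp
    qed
    show "cmod (bilin (R x) v) = cmod (bilin x u)" for x
    proof -
      \<comment> \<open>The norms of \<open>v\<close> and \<open>u'\<close> agree and their
        Hermitian product is real, so the squared norm of \<open>n\<close> is twice the product of
        \<open>n\<close> with \<open>v\<close>. Thus the transpose of \<open>R\<close> carries
        \<open>v\<close> to \<open>u'\<close>.\<close>
      have "s * bilin (vec_cnj n) v *s n = n"
      proof (cases "n = 0")
        case False
        have "bilin (vec_cnj n) n = 2 * bilin (vec_cnj n) v"
          using bilin_norm[of v] bilin_norm[of u'] nu'
          by (simp add: n_def vec_cnj_simps bilin_simps real real')
        then have "s * bilin (vec_cnj n) v = 1"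
        proof -
          assume "bilin (vec_cnj n) n = 2 * bilin (vec_cnj n) v"
          then have "bilin (vec_cnj n) v = of_real ((norm n)\<^sup>2) / 2"
            unfolding bilin_norm by simp
          then show ?thesis using False by (simp add: s_def mult.commute[of 2])
        qed
        then show ?thesis by simp
      qed simp
      then have "bilin x u' = bilin x (v - (s * bilin (vec_cnj n) v) *s n)"
        by (simp add: n_def)
      also have "\<dots> = bilin (R x) v"
        by (simp add: R_def bilin_simps)
      finally have "bilin x u' = bilin (R x) v" .
      moreover have "cmod (bilin x u') = cmod (bilin x u)"
        by (simp add: u'_def bilin_simps norm_mult \<omega>)
      ultimately show ?thesis by simp
    qed
  qed
qed

text \<open>Lebesgue measure on the ball is unitarily invariant, so the integral depends only on the
  norm of \<open>v\<close>, and it is homogeneous of degree \<open>p\<close>. The constant is its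
  value at a unit axis vector: finite because the integrand is at most 1, nonzero because it is
  positive on a nonempty open set.\<close>

lemma ball_integral_bilin_powr:
  fixes p :: real
  assumes p: "0 < p"
  obtains \<kappa> where "\<kappa> \<noteq> 0" "\<kappa> \<noteq> \<infinity>"
    "\<And>v :: complex ^ 'm. (\<integral>\<^sup>+c\<in>ball 0 1. ennreal (cmod (bilin c v) powr p) \<partial>lborel) = \<kappa> * ennreal (norm v powr p)"
proof -
  define \<Phi> where "\<Phi> v = (\<integral>\<^sup>+c\<in>ball 0 1. ennreal (cmod (bilin c v) powr p) \<partial>lborel)" for v :: "complex ^ 'm"
  have meas [measurable]: "(\<lambda>c. bilin c v) \<in> borel_measurable borel" for v :: "complex ^ 'm"
    unfolding bilin_def by (intro borel_measurable_continuous_onI continuous_intros)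
  have [measurable]: "ball (0 :: complex ^ 'm) 1 \<in> sets borel" by simp
  have inv: "\<Phi> v = \<Phi> u" if uv: "norm u = norm v" for u v
  proof -
    obtain R where R: "linear R" "\<And>x. norm (R x) = norm x" "\<And>x. cmod (bilin (R x) v) = cmod (bilin x u)"
      using linear_isometry_bilin[OF uv] by metis
    have "\<Phi> v = (\<integral>\<^sup>+c. ennreal (cmod (bilin (R c) v) powr p) * indicator (ball 0 1) (R c) \<partial>lborel)"
      unfolding \<Phi>_def by (rule nn_integral_lborel_linear_isometry[OF R(1,2), symmetric]) measurable
    also have "\<dots> = \<Phi> u"
      unfolding \<Phi>_def by (intro nn_integral_cong) (simp add: R(2,3) indicator_def)
    finally show ?thesis .
  qed
  define e where "e = axis (undefined :: 'm) (1 :: complex)"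
  have e: "bilin c e = c $ undefined" for c
    by (simp add: bilin_def e_def axis_def if_distrib[where f = "\<lambda>x. _ * x"] sum.delta cong: if_cong)
  have scale: "\<Phi> v = \<Phi> e * ennreal (norm v powr p)" for v
  proof -
    have "\<Phi> v = \<Phi> (of_real (norm v) *s e)"
      by (rule inv) (simp add: norm_smult_complex_vec e_def norm_axis_1)
    also have "\<dots> = (\<integral>\<^sup>+c. (ennreal (cmod (bilin c e) powr p) * indicator (ball 0 1) c) * ennreal (norm v powr p) \<partial>lborel)"
      unfolding \<Phi>_def
      by (intro nn_integral_cong)
        (simp add: bilin_simps norm_mult powr_mult ennreal_mult mult_ac)
    also have "\<dots> = \<Phi> e * ennreal (norm v powr p)"
      unfolding \<Phi>_def by (rule nn_integral_multc) measurable
    finally show ?thesis .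
  qed
  have "\<Phi> e \<le> (\<integral>\<^sup>+c. indicator (ball (0 :: complex ^ 'm) 1) c \<partial>lborel)"
    unfolding \<Phi>_def
  proof (intro nn_integral_mono)
    fix c :: "complex ^ 'm"
    have "cmod (c $ undefined) powr p \<le> 1" if "norm c < 1"
      using p that Finite_Cartesian_Product.norm_nth_le[of c undefined] by (intro powr_le1) auto
    then show "ennreal (cmod (bilin c e) powr p) * indicator (ball 0 1) c \<le> indicator (ball 0 1) c"
      by (auto simp: indicator_def e)
  qed
  also have "\<dots> < \<infinity>"
    using emeasure_bounded_finite[of "ball (0 :: complex ^ 'm) 1"] by simp
  finally have fin: "\<Phi> e \<noteq> \<infinity>" by simp
  have "\<Phi> e \<noteq> 0"
  proof
    assume "\<Phi> e = 0"
    then have "AE c in lborel. ennreal (cmod (bilin c e) powr p) * indicator (ball 0 1) c = 0"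
      unfolding \<Phi>_def by (subst (asm) nn_integral_0_iff_AE) auto
    then have ae: "AE c in lborel. c \<notin> {c :: complex ^ 'm. c \<in> ball 0 1 \<and> c $ undefined \<noteq> 0}"
      by eventually_elim (auto simp: e indicator_def)
    have op: "open {c :: complex ^ 'm. c \<in> ball 0 1 \<and> c $ undefined \<noteq> 0}"
      unfolding mem_ball by (intro open_Collect_conj open_Collect_less open_Collect_neq continuous_intros)
    then have "{c :: complex ^ 'm. c \<in> ball 0 1 \<and> c $ undefined \<noteq> 0} \<in> null_sets lborel"
      using ae by (subst AE_iff_null_sets) auto
    then have "{c :: complex ^ 'm. c \<in> ball 0 1 \<and> c $ undefined \<noteq> 0} = {}"
      using open_not_null_lborel[OF op] by blast
    moreover have "(1 / 2 :: complex) *s e \<in> {c. c \<in> ball 0 1 \<and> c $ undefined \<noteq> 0}"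
      by (simp add: norm_smult_complex_vec e_def norm_axis_1)
    ultimately show False by blast
  qed
  with fin scale show ?thesis
    using that[of "\<Phi> e"] unfolding \<Phi>_def by blast
qed

section \<open>Moments and distributions\<close>

lemma (in finite_measure) sums_integral_power:
  fixes Y :: "'a \<Rightarrow> real"
  assumes Y [measurable]: "Y \<in> borel_measurable M" and bd: "\<And>x. \<bar>Y x\<bar> \<le> b"
    and a: "summable (\<lambda>k. \<bar>a k\<bar> * b ^ k)"
  shows "(\<lambda>k. a k * (\<integral>x. Y x ^ k \<partial>M)) sums (\<integral>x. (\<Sum>k. a k * Y x ^ k) \<partial>M)"
proof -
  have le: "\<bar>a k * Y x ^ k\<bar> \<le> \<bar>a k\<bar> * b ^ k" for k x
    by (simp add: abs_mult power_abs mult_left_mono power_mono bd)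
  have int: "integrable M (\<lambda>x. a k * Y x ^ k)" for k
    by (rule integrable_const_bound[where B = "\<bar>a k\<bar> * b ^ k"]) (use le in auto)
  have "(\<lambda>k. \<integral>x. a k * Y x ^ k \<partial>M) sums (\<integral>x. (\<Sum>k. a k * Y x ^ k) \<partial>M)"
  proof (rule sums_integral[OF int])
    show "AE x in M. summable (\<lambda>k. norm (a k * Y x ^ k))"
      using le by (intro AE_I2 summable_comparison_test[OF _ a]) auto
    have "(\<integral>x. norm (a k * Y x ^ k) \<partial>M) \<le> (\<integral>x. \<bar>a k\<bar> * b ^ k \<partial>M)" for k
      using le int by (intro integral_mono) auto
    then have "norm (\<integral>x. norm (a k * Y x ^ k) \<partial>M) \<le> measure M (space M) * (\<bar>a k\<bar> * b ^ k)" for k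
      by (simp add: mult.assoc)
    then show "summable (\<lambda>k. \<integral>x. norm (a k * Y x ^ k) \<partial>M)"
      by (intro summable_comparison_test[OF _ summable_mult[OF a]]) auto
  qed
  then show ?thesis by simp
qed

lemma power_series_coeffs_zero:
  fixes a :: "nat \<Rightarrow> real"
  assumes r: "0 < r" and sums: "\<And>x. \<bar>x\<bar> < r \<Longrightarrow> (\<lambda>n. a n * x ^ n) sums 0"
  shows "a n = 0"
proof (cases "n = 0")
  case True
  have "(\<lambda>n. a n * 0 ^ n) sums a 0"
    using powser_sums_zero[of a] by simp
  then show ?thesis
    using sums[of 0] r True by (auto dest: sums_unique2)
next
  case False
  show ?thesis
  proof (rule ccontr)
    assume "a n \<noteq> 0"
    have prem: "(\<lambda>k. a k * (x - 0) ^ k) sums ((\<lambda>_. 0) x)" if "norm (x - 0) < r" for x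
      using sums that by simp
    show False
    proof (rule powser_0_nonzero[OF r prem refl \<open>a n \<noteq> 0\<close>])
      show "0 < n" using False by simp
      fix s :: real assume "0 < s" "\<And>z. z \<in> cball (0 :: real) s - {0} \<Longrightarrow> 0 \<noteq> (0 :: real)"
      from this(2)[of s] this(1) show False by simp
    qed simp_all
  qed
qed

text \<open>The restriction on the exponent enters here. The numerator is the product of
  \<open>q - i\<close> for \<open>i < k\<close>, which vanishes only if \<open>q\<close> is a
  natural number below \<open>k\<close>; otherwise no moment is lost from the binomial
  series.\<close>

lemma gbinomial_nonzero:
  fixes q :: real
  assumes "\<And>n :: nat. q \<noteq> real n"
  shows "q gchoose k \<noteq> 0"
  using assms by (auto simp: gbinomial_prod_rev)

lemma summable_gbinomial_half: "summable (\<lambda>k. \<bar>(q :: real) gchoose k\<bar> * (1 / 2) ^ k)"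
proof -
  have "summable (\<lambda>k. (q gchoose k) * (3 / 4) ^ k)"
    using gen_binomial_real[of "3 / 4" q] by (simp add: sums_iff)
  then have "summable (\<lambda>k. norm ((q gchoose k) * (1 / 2) ^ k))"
    by (rule powser_insidea) simp
  then show ?thesis by (simp add: abs_mult power_abs)
qed

text \<open>For small \<open>s\<close> both integrals are power series in \<open>s\<close> whose
  coefficients are moments multiplied by binomial coefficients. Uniqueness of the coefficients,
  followed by division by the nonzero binomial coefficient, gives each moment.\<close>

lemma moments_eq_of_powr_eq:
  fixes q b :: real
  assumes "finite_measure M" "finite_measure N"
    and Y: "Y \<in> borel_measurable M" "\<And>x. \<bar>Y x\<bar> \<le> b"
    and Z: "Z \<in> borel_measurable N" "\<And>x. \<bar>Z x\<bar> \<le> b"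
    and b: "0 < b" and q: "\<And>n :: nat. q \<noteq> real n"
    and eq: "\<And>s. \<bar>s\<bar> * b \<le> 1 / 2 \<Longrightarrow> (\<integral>x. (1 + s * Y x) powr q \<partial>M) = (\<integral>x. (1 + s * Z x) powr q \<partial>N)"
  shows "(\<integral>x. Y x ^ k \<partial>M) = (\<integral>x. Z x ^ k \<partial>N)"
proof -
  have expand: "(\<lambda>k. (q gchoose k) * (\<integral>x. V x ^ k \<partial>L) * s ^ k) sums (\<integral>x. (1 + s * V x) powr q \<partial>L)"
    if L: "finite_measure L" and V: "V \<in> borel_measurable L" "\<And>x. \<bar>V x\<bar> \<le> b" and s: "\<bar>s\<bar> * b \<le> 1 / 2"
    for L :: "'z measure" and V s
  proof -
    interpret finite_measure L by fact
    have sV: "\<bar>s * V x\<bar> \<le> 1 / 2" for x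
      using mult_left_mono[OF V(2)[of x] abs_ge_zero[of s]] s by (simp add: abs_mult)
    have "(\<lambda>k. (q gchoose k) * (\<integral>x. (s * V x) ^ k \<partial>L)) sums (\<integral>x. (\<Sum>k. (q gchoose k) * (s * V x) ^ k) \<partial>L)"
      using V(1) sV by (intro sums_integral_power[where b = "1 / 2"] summable_gbinomial_half) auto
    moreover have "(\<Sum>k. (q gchoose k) * (s * V x) ^ k) = (1 + s * V x) powr q" for x
      using gen_binomial_real[of "s * V x" q] sV[of x] by (simp add: sums_iff)
    ultimately show ?thesis
      by (simp add: power_mult_distrib mult_ac)
  qed
  have "(q gchoose k) * (\<integral>x. Y x ^ k \<partial>M) - (q gchoose k) * (\<integral>x. Z x ^ k \<partial>N) = 0"
  proof (rule power_series_coeffs_zero[of "1 / (2 * b)"])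
    fix s :: real assume "\<bar>s\<bar> < 1 / (2 * b)"
    then have s: "\<bar>s\<bar> * b \<le> 1 / 2"
      using b by (simp add: field_simps)
    show "(\<lambda>k. ((q gchoose k) * (\<integral>x. Y x ^ k \<partial>M) - (q gchoose k) * (\<integral>x. Z x ^ k \<partial>N)) * s ^ k) sums 0"
      using sums_diff[OF expand[OF assms(1) Y s] expand[OF assms(2) Z s]] eq[OF s]
      by (simp add: left_diff_distrib)
  qed (use b in simp)
  then show ?thesis
    using gbinomial_nonzero[of q k] q by simp
qed

lemma exp_eq_of_moments_eq:
  fixes b :: real
  assumes "finite_measure M" "finite_measure N"
    and Y: "Y \<in> borel_measurable M" "\<And>x. \<bar>Y x\<bar> \<le> b"
    and Z: "Z \<in> borel_measurable N" "\<And>x. \<bar>Z x\<bar> \<le> b"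
    and eq: "\<And>k. (\<integral>x. Y x ^ k \<partial>M) = (\<integral>x. Z x ^ k \<partial>N)"
  shows "(\<integral>x. exp (Y x) \<partial>M) = (\<integral>x. exp (Z x) \<partial>N)"
proof -
  have expand: "(\<lambda>k. inverse (fact k) * (\<integral>x. V x ^ k \<partial>L)) sums (\<integral>x. exp (V x) \<partial>L)"
    if L: "finite_measure L" and V: "V \<in> borel_measurable L" "\<And>x. \<bar>V x\<bar> \<le> b" for L :: "'z measure" and V
  proof -
    interpret finite_measure L by fact
    have "summable (\<lambda>k. \<bar>inverse (fact k)\<bar> * b ^ k)"
      using summable_exp[of b] by simp
    from sums_integral_power[OF V this] show ?thesis
      by (simp add: exp_def scaleR_conv_of_real mult.commute divide_inverse)
  qed
  show ?thesis
    using expand[OF assms(1) Y] expand[OF assms(2) Z] unfolding eq by (rule sums_unique2)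
qed

section \<open>From exponential integrals to measures of closed sets, by Stone-Weierstrass\<close>

text \<open>The linear span of the exponentials of linear functionals. It is closed under products
  because exponentials multiply to exponentials, contains the constants through the exponent 0, and
  separates points: an algebra that is dense on compact sets.\<close>

inductive_set exp_ring :: "('a::euclidean_space \<Rightarrow> real) set" where
  exp: "(\<lambda>x. exp (a \<bullet> x)) \<in> exp_ring"
| scale: "f \<in> exp_ring \<Longrightarrow> (\<lambda>x. c * f x) \<in> exp_ring"
| add: "f \<in> exp_ring \<Longrightarrow> g \<in> exp_ring \<Longrightarrow> (\<lambda>x. f x + g x) \<in> exp_ring"

lemma exp_ring_continuous: "f \<in> exp_ring \<Longrightarrow> continuous_on S f"
  by (induction rule: exp_ring.induct) (auto intro!: continuous_intros)

lemma exp_ring_mult: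
  assumes "f \<in> exp_ring" "g \<in> exp_ring"
  shows "(\<lambda>x. f x * g x) \<in> exp_ring"
  using assms(1)
proof induction
  case (exp a)
  show ?case
    using assms(2)
  proof induction
    case (exp b)
    have "(\<lambda>x. exp (a \<bullet> x) * exp (b \<bullet> x)) = (\<lambda>x. exp ((a + b) \<bullet> x))"
      by (simp add: inner_add_left exp_add)
    then show ?case by (simp add: exp_ring.exp)
  next
    case (scale f c)
    then show ?case using exp_ring.scale[of _ c] by (simp add: mult_ac)
  next
    case (add f g)
    then show ?case using exp_ring.add by (simp add: distrib_left)
  qed
next
  case (scale f c)
  then show ?case using exp_ring.scale[of _ c] by (simp add: mult_ac)
next
  case (add f g')
  then show ?case using exp_ring.add by (simp add: distrib_right)
qed

lemma exp_ring_function_ring: "compact S \<Longrightarrow> function_ring_on exp_ring S"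
proof
  fix c :: real
  show "(\<lambda>_. c) \<in> exp_ring"
    using exp_ring.scale[OF exp_ring.exp[of 0], of c] by simp
next
  fix x y :: 'a assume "x \<noteq> y"
  then have "(x - y) \<bullet> x \<noteq> (x - y) \<bullet> y"
    by (metis inner_diff_right inner_eq_zero_iff right_minus_eq)
  then show "\<exists>f\<in>exp_ring. f x \<noteq> f y"
    by (intro bexI[OF _ exp_ring.exp[of "x - y"]]) simp
qed (auto intro: exp_ring.add exp_ring_mult exp_ring_continuous)

lemma (in finite_measure) integrable_bounded_continuous:
  fixes X :: "'a \<Rightarrow> 'b::euclidean_space" and f :: "'b \<Rightarrow> real"
  assumes X: "X \<in> borel_measurable M" "\<And>x. norm (X x) \<le> b" and f: "continuous_on UNIV f"
  shows "integrable M (\<lambda>x. f (X x))"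
proof -
  have "bounded (f ` cball 0 b)"
    using f by (intro compact_imp_bounded compact_continuous_image) (auto elim: continuous_on_subset)
  then obtain B where "\<And>y. y \<in> cball 0 b \<Longrightarrow> norm (f y) \<le> B"
    unfolding bounded_iff by (meson imageI)
  moreover have "(\<lambda>x. f (X x)) \<in> borel_measurable M"
    using X(1) borel_measurable_continuous_onI[OF f] by measurable
  ultimately show ?thesis
    using X(2) by (intro integrable_const_bound[where B = B]) auto
qed

text \<open>Both random vectors stay in one closed ball, where \<open>f\<close> is uniformly
  approximated by elements of \<open>exp_ring\<close>; for these the integrals agree by
  linearity.\<close>

lemma integral_continuous_eq_of_exp_eq:
  fixes f :: "'b::euclidean_space \<Rightarrow> real" and X1 :: "'x \<Rightarrow> 'b::euclidean_space" and X2 :: "'y \<Rightarrow> 'b"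
  assumes "finite_measure M" "finite_measure N"
    and X1: "X1 \<in> borel_measurable M" "\<And>x. norm (X1 x) \<le> b"
    and X2: "X2 \<in> borel_measurable N" "\<And>x. norm (X2 x) \<le> b"
    and eq: "\<And>a. (\<integral>x. exp (a \<bullet> X1 x) \<partial>M) = (\<integral>x. exp (a \<bullet> X2 x) \<partial>N)"
    and f: "continuous_on UNIV f"
  shows "(\<integral>x. f (X1 x) \<partial>M) = (\<integral>x. f (X2 x) \<partial>N)"
proof -
  interpret M: finite_measure M by fact
  interpret N: finite_measure N by fact
  note intM = M.integrable_bounded_continuous[OF X1]
  note intN = N.integrable_bounded_continuous[OF X2]
  have ring: "(\<integral>x. g (X1 x) \<partial>M) = (\<integral>x. g (X2 x) \<partial>N)" if "g \<in> exp_ring" for g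
    using that
  proof induction
    case (add f g)
    note cf = exp_ring_continuous[OF add.hyps(1)] and cg = exp_ring_continuous[OF add.hyps(2)]
    show ?case
      by (simp add: intM[OF cf] intM[OF cg] intN[OF cf] intN[OF cg] add.IH)
  qed (simp_all add: eq)
  \<comment> \<open>The total mass of both measures plus 1, so that an approximation error below
    \<open>d / c\<close> contributes strictly less than \<open>d\<close> altogether.\<close>
  define c where "c = measure M (space M) + measure N (space N) + 1"
  have c: "0 < c"
    unfolding c_def by (simp add: add_nonneg_pos)
  show ?thesis
  proof (rule ccontr)
    define d where "d = \<bar>(\<integral>x. f (X1 x) \<partial>M) - (\<integral>x. f (X2 x) \<partial>N)\<bar>"
    assume "(\<integral>x. f (X1 x) \<partial>M) \<noteq> (\<integral>x. f (X2 x) \<partial>N)"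
    then have d: "0 < d" by (simp add: d_def)
    interpret function_ring_on exp_ring "cball (0 :: 'b) b"
      by (rule exp_ring_function_ring) simp
    obtain g where g: "g \<in> exp_ring" "\<And>x. x \<in> cball 0 b \<Longrightarrow> \<bar>f x - g x\<bar> < d / c"
      using Stone_Weierstrass_basic[OF continuous_on_subset[OF f subset_UNIV], of "d / c"] c d
      by (meson divide_pos_pos)
    have g': "continuous_on UNIV g" by (rule exp_ring_continuous[OF g(1)])
    have close: "\<bar>(\<integral>x. f (X x) \<partial>L) - (\<integral>x. g (X x) \<partial>L)\<bar> \<le> d / c * measure L (space L)"
      if L: "finite_measure L" and X: "X \<in> borel_measurable L" "\<And>x. norm (X x) \<le> b" for L :: "'z measure" and X
    proof -
      interpret L: finite_measure L by fact
      have int: "integrable L (\<lambda>x. f (X x))" "integrable L (\<lambda>x. g (X x))"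
        by (rule L.integrable_bounded_continuous[OF X f], rule L.integrable_bounded_continuous[OF X g'])
      have "\<bar>(\<integral>x. f (X x) \<partial>L) - (\<integral>x. g (X x) \<partial>L)\<bar> = \<bar>\<integral>x. f (X x) - g (X x) \<partial>L\<bar>"
        using int by simp
      also have "\<dots> \<le> (\<integral>x. \<bar>f (X x) - g (X x)\<bar> \<partial>L)"
        by (rule integral_abs_bound)
      also have "\<dots> \<le> (\<integral>x. d / c \<partial>L)"
        using int X(2) g(2) by (intro integral_mono) (auto simp: less_imp_le)
      finally show ?thesis by (simp add: mult.commute)
    qed
    have "d \<le> d / c * measure M (space M) + d / c * measure N (space N)"
      using close[OF assms(1) X1] close[OF assms(2) X2] ring[OF g(1)] unfolding d_def by linarith
    also have "\<dots> = d / c * (c - 1)"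
      by (simp only: c_def add_diff_cancel_right' distrib_left)
    also have "\<dots> < d / c * c"
      using c d by (intro mult_strict_left_mono) auto
    finally show False using c by simp
  qed
qed

lemma measure_closed_eq_of_exp_eq:
  fixes X1 :: "'x \<Rightarrow> 'b::euclidean_space" and X2 :: "'y \<Rightarrow> 'b"
  assumes "finite_measure M" "finite_measure N"
    and X1: "X1 \<in> borel_measurable M" "\<And>x. norm (X1 x) \<le> b"
    and X2: "X2 \<in> borel_measurable N" "\<And>x. norm (X2 x) \<le> b"
    and eq: "\<And>a. (\<integral>x. exp (a \<bullet> X1 x) \<partial>M) = (\<integral>x. exp (a \<bullet> X2 x) \<partial>N)"
    and K: "closed K"
  shows "measure M (X1 -` K \<inter> space M) = measure N (X2 -` K \<inter> space N)"
\<comment> \<open>The empty set is split off because \<open>infdist\<close> to it is 0 by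
  convention, so the cutoffs below would not tend to its indicator.\<close>
proof (cases "K = {}")
  case False
  define f where "f n y = max 0 (1 - real n * infdist y K)" for n and y :: 'b
  have contf: "continuous_on UNIV (f n)" for n
    unfolding f_def by (intro continuous_intros)
  have limf: "(\<lambda>n. f n y) \<longlonglongrightarrow> indicator K y" for y
  proof (cases "y \<in> K")
    case True
    then show ?thesis by (simp add: f_def)
  next
    case False
    then have pos: "0 < infdist y K"
      using K \<open>K \<noteq> {}\<close> by (simp add: infdist_pos_not_in_closed)
    then obtain m :: nat where m: "1 < real m * infdist y K"
      using reals_Archimedean3 by blast
    have "f n y = 0" if "m \<le> n" for n
    proof -
      have "real m * infdist y K \<le> real n * infdist y K"
        using that pos by (intro mult_right_mono) auto
      with m show ?thesis by (simp add: f_def)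
    qed
    then have "\<forall>\<^sub>F n in sequentially. f n y = 0"
      by (auto simp: eventually_sequentially)
    with False show ?thesis
      by (simp add: tendsto_eventually)
  qed
  have bdf: "norm (f n y) \<le> 1" for n y
    by (simp add: f_def infdist_nonneg)
  have lim: "(\<lambda>n. \<integral>x. f n (X x) \<partial>L) \<longlonglongrightarrow> measure L (X -` K \<inter> space L)"
    if L: "finite_measure L" and X: "X \<in> borel_measurable L" for L :: "'z measure" and X
  proof -
    interpret L: finite_measure L by fact
    have [measurable]: "K \<in> sets borel" using K by simp
    note [measurable] = X borel_measurable_continuous_onI[OF contf]
    have "(\<lambda>n. \<integral>x. f n (X x) \<partial>L) \<longlonglongrightarrow> (\<integral>x. indicator K (X x) \<partial>L)"
      by (rule integral_dominated_convergence[where w = "\<lambda>_. 1"]) (use limf bdf in auto)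
    also have "(\<integral>x. indicator K (X x) \<partial>L) = (\<integral>x. indicator (X -` K \<inter> space L) x \<partial>L)"
      by (intro Bochner_Integration.integral_cong) (auto simp: indicator_def)
    also have "\<dots> = measure L (X -` K \<inter> space L)"
      by simp
    finally show ?thesis .
  qed
  have "(\<integral>x. f n (X1 x) \<partial>M) = (\<integral>x. f n (X2 x) \<partial>N)" for n
    by (rule integral_continuous_eq_of_exp_eq[OF assms(1-7) contf])
  then show ?thesis
    using lim[OF assms(1) X1(1)] lim[OF assms(2) X2(1)] LIMSEQ_unique by simp
qed simp

section \<open>Equidistribution of projective classes\<close>

lemma norm_vec_square_sum: "(norm (v :: complex ^ 'r))\<^sup>2 = (\<Sum>r\<in>UNIV. (cmod (v $ r))\<^sup>2)"
  by (simp add: norm_vec_def L2_set_def sum_nonneg)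

text \<open>Fubini moves the average over \<open>c\<close> inside, where it equals \<kappa> times
  the \<open>p\<close>-th power of the norm of the vector with entries \<open>sqrt (t r)\<close>
  times \<open>h r x\<close>. The square roots make the squared norm the sum with weights
  \<open>t r\<close>.\<close>

lemma nn_integral_quadratic_powr:
  fixes h :: "'r::finite \<Rightarrow> 'x \<Rightarrow> complex"
  assumes p: "0 < p" and M: "sigma_finite_measure M" and h [measurable]: "\<And>r. h r \<in> borel_measurable M"
    and t: "\<And>r. 0 \<le> t r"
    and \<kappa>: "\<And>v :: complex ^ 'r. (\<integral>\<^sup>+c\<in>ball 0 1. ennreal (cmod (bilin c v) powr p) \<partial>lborel) = \<kappa> * ennreal (norm v powr p)"
  shows "(\<integral>\<^sup>+c\<in>ball 0 1. (\<integral>\<^sup>+x. ennreal (cmod (\<Sum>r\<in>UNIV. (c $ r * of_real (sqrt (t r))) * h r x) powr p) \<partial>M) \<partial>lborel)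
     = \<kappa> * (\<integral>\<^sup>+x. ennreal ((\<Sum>r\<in>UNIV. t r * (cmod (h r x))\<^sup>2) powr (p / 2)) \<partial>M)"
proof -
  interpret pair_sigma_finite "lborel :: (complex ^ 'r) measure" M
    by (intro pair_sigma_finite.intro M lborel.sigma_finite_measure_axioms)
  define v where "v x = (\<chi> r. of_real (sqrt (t r)) * h r x)" for x
  have [measurable]: "(\<lambda>c. c $ r) \<in> borel_measurable (borel :: (complex ^ 'r) measure)" for r
    by (intro borel_measurable_continuous_onI continuous_intros)
  have [measurable]: "ball (0 :: complex ^ 'r) 1 \<in> sets borel" by simp
  have bil: "(\<Sum>r\<in>UNIV. (c $ r * of_real (sqrt (t r))) * h r x) = bilin c (v x)" for c x
    by (simp add: bilin_def v_def mult.assoc)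
  have [measurable]: "(\<lambda>(c, x). bilin c (v x)) \<in> borel_measurable (lborel \<Otimes>\<^sub>M M)"
    unfolding bil[symmetric] by measurable
  have nv: "norm (v x) powr p = (\<Sum>r\<in>UNIV. t r * (cmod (h r x))\<^sup>2) powr (p / 2)" for x
  proof -
    have sq: "(norm (v x))\<^sup>2 = (\<Sum>r\<in>UNIV. t r * (cmod (h r x))\<^sup>2)"
      unfolding norm_vec_square_sum by (simp add: v_def norm_mult power_mult_distrib t)
    have "norm (v x) powr p = ((norm (v x))\<^sup>2) powr (p / 2)"
    proof (cases "v x = 0")
      case False
      then have "((norm (v x)) powr 2) powr (p / 2) = norm (v x) powr p"
        by (simp only: powr_powr) simp
      then show ?thesis using False by (simp add: powr_realpow)
    qed simp
    then show ?thesis unfolding sq .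
  qed
  have "(\<integral>\<^sup>+c\<in>ball 0 1. (\<integral>\<^sup>+x. ennreal (cmod (bilin c (v x)) powr p) \<partial>M) \<partial>lborel)
      = (\<integral>\<^sup>+c. (\<integral>\<^sup>+x. ennreal (cmod (bilin c (v x)) powr p) * indicator (ball 0 1) c \<partial>M) \<partial>lborel)"
    by (intro nn_integral_cong nn_integral_multc[symmetric]) measurable
  also have "\<dots> = (\<integral>\<^sup>+x. (\<integral>\<^sup>+c. ennreal (cmod (bilin c (v x)) powr p) * indicator (ball 0 1) c \<partial>lborel) \<partial>M)"
    by (rule Fubini'[symmetric]) measurable
  also have "\<dots> = (\<integral>\<^sup>+x. \<kappa> * ennreal (norm (v x) powr p) \<partial>M)"
    by (simp only: \<kappa>)
  also have "\<dots> = \<kappa> * (\<integral>\<^sup>+x. ennreal (norm (v x) powr p) \<partial>M)"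
    unfolding nv by (rule nn_integral_cmult) measurable
  finally show ?thesis unfolding bil nv .
qed

section \<open>Normalised squared moduli as bounded coordinates of a projective class\<close>

definition sq_sum :: "('r::finite \<Rightarrow> 'x \<Rightarrow> complex) \<Rightarrow> 'x \<Rightarrow> real" where
  "sq_sum f x = (\<Sum>r\<in>UNIV. (cmod (f r x))\<^sup>2)"

text \<open>Unchanged when all \<open>f r x\<close> are multiplied by a common nonzero factor, hence
  a function of the projective class. It is bounded, so all its moments exist; where every
  \<open>f r x\<close> vanishes it is the zero vector.\<close>

definition sq_ratio :: "('r::finite \<Rightarrow> 'x \<Rightarrow> complex) \<Rightarrow> 'x \<Rightarrow> real ^ 'r" where
  "sq_ratio f x = (\<chi> r. (cmod (f r x))\<^sup>2 / sq_sum f x)"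

text \<open>The weight restores homogeneity: with \<open>q = p / 2\<close>, integrating a power
  \<open>q\<close> of an expression in \<open>sq_ratio\<close> against this measure gives a
  \<open>p\<close>-integral of the functions themselves, and the total mass is finite for functions
  in \<open>L\<^sup>p\<close>.\<close>

definition sq_density :: "real \<Rightarrow> 'x measure \<Rightarrow> ('r::finite \<Rightarrow> 'x \<Rightarrow> complex) \<Rightarrow> 'x measure" where
  "sq_density q M f = density M (\<lambda>x. ennreal (sq_sum f x powr q))"

lemma sq_sum_nonneg: "0 \<le> sq_sum f x"
  by (simp add: sq_sum_def sum_nonneg)

lemma norm_sq_ratio_le: "norm (sq_ratio f x) \<le> 1"
proof -
  have "norm (sq_ratio f x) \<le> (\<Sum>r\<in>UNIV. norm (sq_ratio f x $ r))"
    unfolding norm_vec_def by (rule L2_set_le_sum) simp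
  also have "\<dots> = (\<Sum>r\<in>UNIV. (cmod (f r x))\<^sup>2 / sq_sum f x)"
    by (simp add: sq_ratio_def sq_sum_nonneg)
  also have "\<dots> = sq_sum f x / sq_sum f x"
    unfolding sum_divide_distrib[symmetric] unfolding sq_sum_def ..
  also have "\<dots> \<le> 1" by simp
  finally show ?thesis .
qed

lemma sq_sum_measurable [measurable]:
  "(\<And>r. f r \<in> borel_measurable M) \<Longrightarrow> sq_sum f \<in> borel_measurable M"
  unfolding sq_sum_def by measurable

lemma sq_ratio_measurable:
  fixes f :: "'r::finite \<Rightarrow> 'x \<Rightarrow> complex"
  assumes [measurable]: "\<And>r. f r \<in> borel_measurable M"
  shows "sq_ratio f \<in> borel_measurable M"
proof (subst borel_measurable_euclidean_space, rule ballI)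
  fix b :: "real ^ 'r" assume "b \<in> Basis"
  then obtain r where b: "b = axis r 1" by (auto simp: Basis_vec_def)
  have "(\<lambda>x. sq_ratio f x \<bullet> b) = (\<lambda>x. (cmod (f r x))\<^sup>2 / sq_sum f x)"
    by (simp add: b inner_axis sq_ratio_def)
  then show "(\<lambda>x. sq_ratio f x \<bullet> b) \<in> borel_measurable M" by simp
qed

text \<open>Perturbing the coefficients of \<open>sq_sum\<close> multiplies it by \<open>1 + s (a \<bullet> sq_ratio)\<close>, whose powers generate
  all moments of \<open>a \<bullet> sq_ratio\<close> because \<open>p / 2\<close> is not a natural number.\<close>

lemma sq_ratio_equidistributed:
  fixes f :: "'r::finite \<Rightarrow> 'x \<Rightarrow> complex" and g :: "'r \<Rightarrow> 'y \<Rightarrow> complex"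
  assumes p: "0 < p" "\<And>n :: nat. p / 2 \<noteq> real n"
    and M: "sigma_finite_measure M" and N: "sigma_finite_measure N"
    and f: "\<And>r. f r \<in> borel_measurable M" and g: "\<And>r. g r \<in> borel_measurable N"
    and eq: "\<And>c :: complex ^ 'r. (\<integral>\<^sup>+x. ennreal (cmod (\<Sum>r\<in>UNIV. c $ r * f r x) powr p) \<partial>M)
       = (\<integral>\<^sup>+x. ennreal (cmod (\<Sum>r\<in>UNIV. c $ r * g r x) powr p) \<partial>N)"
    and fin: "(\<integral>\<^sup>+x. ennreal (sq_sum f x powr (p / 2)) \<partial>M) < \<infinity>"
    and K: "closed K"
  shows "measure (sq_density (p / 2) M f) (sq_ratio f -` K \<inter> space M)
       = measure (sq_density (p / 2) N g) (sq_ratio g -` K \<inter> space N)"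
    and "finite_measure (sq_density (p / 2) M f)" "finite_measure (sq_density (p / 2) N g)"
proof -
  obtain \<kappa> where \<kappa>: "\<kappa> \<noteq> 0" "\<kappa> \<noteq> \<infinity>"
    and \<kappa>_eq: "\<And>v :: complex ^ 'r. (\<integral>\<^sup>+c\<in>ball 0 1. ennreal (cmod (bilin c v) powr p) \<partial>lborel) = \<kappa> * ennreal (norm v powr p)"
    by (rule ball_integral_bilin_powr[OF p(1)]) (rule that)
  have quad: "(\<integral>\<^sup>+x. ennreal ((\<Sum>r\<in>UNIV. t r * (cmod (f r x))\<^sup>2) powr (p / 2)) \<partial>M)
      = (\<integral>\<^sup>+x. ennreal ((\<Sum>r\<in>UNIV. t r * (cmod (g r x))\<^sup>2) powr (p / 2)) \<partial>N)"
    if t: "\<And>r. 0 \<le> t r" for t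
  proof -
    have "(\<integral>\<^sup>+x. ennreal (cmod (\<Sum>r\<in>UNIV. (c $ r * of_real (sqrt (t r))) * f r x) powr p) \<partial>M)
        = (\<integral>\<^sup>+x. ennreal (cmod (\<Sum>r\<in>UNIV. (c $ r * of_real (sqrt (t r))) * g r x) powr p) \<partial>N)" for c :: "complex ^ 'r"
      using eq[of "\<chi> r. c $ r * of_real (sqrt (t r))"] by simp
    then have "\<kappa> * (\<integral>\<^sup>+x. ennreal ((\<Sum>r\<in>UNIV. t r * (cmod (f r x))\<^sup>2) powr (p / 2)) \<partial>M)
        = \<kappa> * (\<integral>\<^sup>+x. ennreal ((\<Sum>r\<in>UNIV. t r * (cmod (g r x))\<^sup>2) powr (p / 2)) \<partial>N)"
      unfolding nn_integral_quadratic_powr[OF p(1) M f t \<kappa>_eq, symmetric]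
        nn_integral_quadratic_powr[OF p(1) N g t \<kappa>_eq, symmetric] by simp
    then show ?thesis
      using \<kappa> by (simp add: ennreal_mult_cancel_left)
  qed
  define M' where "M' = sq_density (p / 2) M f"
  define N' where "N' = sq_density (p / 2) N g"
  have fin_g: "(\<integral>\<^sup>+x. ennreal (sq_sum g x powr (p / 2)) \<partial>N) < \<infinity>"
    using fin quad[of "\<lambda>_. 1"] by (simp add: sq_sum_def)
  have finite: "finite_measure (sq_density (p / 2) L h)"
    if h [measurable]: "\<And>r. h r \<in> borel_measurable L"
      and fin: "(\<integral>\<^sup>+x. ennreal (sq_sum h x powr (p / 2)) \<partial>L) < \<infinity>" for L :: "'z measure" and h :: "'r \<Rightarrow> 'z \<Rightarrow> complex"
  proof (rule finite_measureI)
    have "emeasure (sq_density (p / 2) L h) (space L) = (\<integral>\<^sup>+x. ennreal (sq_sum h x powr (p / 2)) * indicator (space L) x \<partial>L)"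
      unfolding sq_density_def by (rule emeasure_density) measurable
    also have "\<dots> = (\<integral>\<^sup>+x. ennreal (sq_sum h x powr (p / 2)) \<partial>L)"
      by (intro nn_integral_cong) simp
    finally show "emeasure (sq_density (p / 2) L h) (space (sq_density (p / 2) L h)) \<noteq> \<infinity>"
      using fin by (simp add: sq_density_def)
  qed
  show M': "finite_measure (sq_density (p / 2) M f)" and N': "finite_measure (sq_density (p / 2) N g)"
    using finite[OF f fin] finite[OF g fin_g] .
  have mf: "sq_ratio f \<in> borel_measurable M'" and mg: "sq_ratio g \<in> borel_measurable N'"
    using sq_ratio_measurable[OF f] sq_ratio_measurable[OF g] by (simp_all add: M'_def N'_def sq_density_def)
  have exp_eq: "(\<integral>x. exp (a \<bullet> sq_ratio f x) \<partial>M') = (\<integral>x. exp (a \<bullet> sq_ratio g x) \<partial>N')" for a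
  proof -
    define b where "b = norm a + 1"
    have bd: "\<bar>a \<bullet> sq_ratio h x\<bar> \<le> b" for h and x :: 'z
    proof -
      have "\<bar>a \<bullet> sq_ratio h x\<bar> \<le> norm a * norm (sq_ratio h x)"
        by (rule Cauchy_Schwarz_ineq2)
      also have "\<dots> \<le> norm a * 1"
        by (intro mult_left_mono norm_sq_ratio_le) simp
      finally show ?thesis by (simp add: b_def)
    qed
    have meas: "(\<lambda>x. a \<bullet> sq_ratio f x) \<in> borel_measurable M'" "(\<lambda>x. a \<bullet> sq_ratio g x) \<in> borel_measurable N'"
      using mf mg by measurable
    have expand: "(\<integral>x. (1 + s * (a \<bullet> sq_ratio h x)) powr (p / 2) \<partial>sq_density (p / 2) L h)
        = enn2real (\<integral>\<^sup>+x. ennreal ((\<Sum>r\<in>UNIV. (1 + s * a $ r) * (cmod (h r x))\<^sup>2) powr (p / 2)) \<partial>L)"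
      if h [measurable]: "\<And>r. h r \<in> borel_measurable L" and s: "\<bar>s\<bar> * b \<le> 1 / 2"
      for L :: "'z measure" and h :: "'r \<Rightarrow> 'z \<Rightarrow> complex" and s
    proof -
      have [measurable]: "sq_ratio h \<in> borel_measurable L" by (rule sq_ratio_measurable[OF h])
      have eq: "sq_sum h x powr (p / 2) * (1 + s * (a \<bullet> sq_ratio h x)) powr (p / 2)
          = (\<Sum>r\<in>UNIV. (1 + s * a $ r) * (cmod (h r x))\<^sup>2) powr (p / 2)" for x
      proof -
        have "\<bar>s * (a \<bullet> sq_ratio h x)\<bar> \<le> 1 / 2"
          using mult_left_mono[OF bd[of h x] abs_ge_zero[of s]] s by (simp add: abs_mult)
        then have "sq_sum h x powr (p / 2) * (1 + s * (a \<bullet> sq_ratio h x)) powr (p / 2)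
            = (sq_sum h x * (1 + s * (a \<bullet> sq_ratio h x))) powr (p / 2)"
          using sq_sum_nonneg[of h x] by (intro powr_mult[symmetric])
        also have "sq_sum h x * (1 + s * (a \<bullet> sq_ratio h x)) = (\<Sum>r\<in>UNIV. (1 + s * a $ r) * (cmod (h r x))\<^sup>2)"
        \<comment> \<open>In the degenerate case every \<open>h r x\<close> is 0 and both sides
          vanish; otherwise the denominator of the ratio cancels.\<close>
        proof (cases "sq_sum h x = 0")
          case True
          then have "(cmod (h r x))\<^sup>2 = 0" for r
            unfolding sq_sum_def by (subst (asm) sum_nonneg_eq_0_iff) auto
          then show ?thesis using True by simp
        next
          case False
          then have "sq_sum h x * (a \<bullet> sq_ratio h x) = (\<Sum>r\<in>UNIV. a $ r * (cmod (h r x))\<^sup>2)"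
            by (simp add: inner_vec_def sq_ratio_def sum_distrib_left)
          moreover have "sq_sum h x * (1 + s * (a \<bullet> sq_ratio h x)) = sq_sum h x + s * (sq_sum h x * (a \<bullet> sq_ratio h x))"
            by (simp add: distrib_left mult.left_commute)
          ultimately show ?thesis
            by (simp add: sq_sum_def distrib_right sum.distrib sum_distrib_left mult.assoc)
        qed
        finally show ?thesis .
      qed
      have "(\<integral>x. (1 + s * (a \<bullet> sq_ratio h x)) powr (p / 2) \<partial>sq_density (p / 2) L h)
          = (\<integral>x. sq_sum h x powr (p / 2) * (1 + s * (a \<bullet> sq_ratio h x)) powr (p / 2) \<partial>L)"
        unfolding sq_density_def by (subst integral_density) (auto simp: sq_sum_nonneg)
      also have "\<dots> = enn2real (\<integral>\<^sup>+x. ennreal ((\<Sum>r\<in>UNIV. (1 + s * a $ r) * (cmod (h r x))\<^sup>2) powr (p / 2)) \<partial>L)"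
        unfolding eq by (intro integral_eq_nn_integral) auto
      finally show ?thesis .
    qed
    have "(\<integral>x. (a \<bullet> sq_ratio f x) ^ k \<partial>M') = (\<integral>x. (a \<bullet> sq_ratio g x) ^ k \<partial>N')" for k
    proof (rule moments_eq_of_powr_eq[where q = "p / 2" and b = b])
      show "0 < b" by (simp add: b_def add_nonneg_pos)
      fix s :: real assume s: "\<bar>s\<bar> * b \<le> 1 / 2"
      \<comment> \<open>Small \<open>s\<close> keeps the perturbed weights nonnegative, so
        \<open>quad\<close> applies to them.\<close>
      have "0 \<le> 1 + s * a $ r" for r
      proof -
        have "\<bar>s * a $ r\<bar> \<le> \<bar>s\<bar> * b"
          using component_le_norm_cart[of a r] by (simp add: abs_mult b_def mult_left_mono)
        with s show ?thesis by linarith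
      qed
      then show "(\<integral>x. (1 + s * (a \<bullet> sq_ratio f x)) powr (p / 2) \<partial>M') = (\<integral>x. (1 + s * (a \<bullet> sq_ratio g x)) powr (p / 2) \<partial>N')"
        unfolding M'_def N'_def expand[OF f s] expand[OF g s] by (simp only: quad)
    qed (use M' N' meas bd[of f] bd[of g] p(2) in \<open>simp_all add: M'_def N'_def\<close>)
    then show ?thesis
      using M' N' meas bd[of f] bd[of g] by (intro exp_eq_of_moments_eq[where b = b]) (simp_all add: M'_def N'_def)
  qed
  have "measure M' (sq_ratio f -` K \<inter> space M') = measure N' (sq_ratio g -` K \<inter> space N')"
    using M' N' mf mg exp_eq K norm_sq_ratio_le[of f] norm_sq_ratio_le[of g]
    by (intro measure_closed_eq_of_exp_eq[where b = 1]) (simp_all add: M'_def N'_def)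
  then show "measure (sq_density (p / 2) M f) (sq_ratio f -` K \<inter> space M)
       = measure (sq_density (p / 2) N g) (sq_ratio g -` K \<inter> space N)"
    by (simp add: M'_def N'_def sq_density_def)
qed

section \<open>From equal distributions to matching points\<close>

lemma continuous_on_imp_measurable_restrict_lborel:
  fixes h :: "'a::euclidean_space \<Rightarrow> 'b::topological_space"
  assumes "continuous_on D h"
  shows "h \<in> borel_measurable (restrict_space lborel D)"
proof -
  have "sets (restrict_space lborel D) = sets (restrict_space borel D)"
    by (rule sets_restrict_space_cong) simp
  then show ?thesis
    using borel_measurable_continuous_on_restrict[OF assms] measurable_cong_sets by blast
qed

text \<open>Equality of measures is known for closed sets only, and the image of \<open>D1\<close>
  need not be closed. It is therefore exhausted by the images of compact sets \<open>C n\<close>: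
  the sets \<open>A n\<close> of points of \<open>D2\<close> matched within \<open>C n\<close> have
  the same mass as preimages containing \<open>C n\<close>, and in the limit they carry the full
  mass. The density is positive on \<open>D2\<close>, so the unmatched points form a Lebesgue null
  set.\<close>

lemma sq_ratio_match_AE:
  fixes f :: "'r::finite \<Rightarrow> 'a::euclidean_space \<Rightarrow> complex" and g :: "'r \<Rightarrow> 'b::euclidean_space \<Rightarrow> complex"
  assumes p: "0 < p" "\<And>n :: nat. p / 2 \<noteq> real n"
    and D1: "open D1" and D2: "open D2"
    and f: "\<And>r. continuous_on D1 (f r)" and g: "\<And>r. continuous_on D2 (g r)"
    and eq: "\<And>c :: complex ^ 'r. (\<integral>\<^sup>+x. ennreal (cmod (\<Sum>r\<in>UNIV. c $ r * f r x) powr p) \<partial>restrict_space lborel D1)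
       = (\<integral>\<^sup>+x. ennreal (cmod (\<Sum>r\<in>UNIV. c $ r * g r x) powr p) \<partial>restrict_space lborel D2)"
    and fin: "(\<integral>\<^sup>+x. ennreal (sq_sum f x powr (p / 2)) \<partial>restrict_space lborel D1) < \<infinity>"
    and pos1: "\<And>x. x \<in> D1 \<Longrightarrow> 0 < sq_sum f x" and pos2: "\<And>x. x \<in> D2 \<Longrightarrow> 0 < sq_sum g x"
  shows "AE w in lborel. w \<in> D2 \<longrightarrow> (\<exists>z\<in>D1. sq_ratio f z = sq_ratio g w)"
proof -
  define M where "M = restrict_space lborel D1"
  define N where "N = restrict_space lborel D2"
  have space: "space M = D1" "space N = D2"
    by (simp_all add: M_def N_def space_restrict_space)
  have M: "sigma_finite_measure M" and N: "sigma_finite_measure N"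
    unfolding M_def N_def using D1 D2
    by (auto intro!: sigma_finite_measure_restrict_space lborel.sigma_finite_measure_axioms)
  have f_meas: "f r \<in> borel_measurable M" and g_meas [measurable]: "g r \<in> borel_measurable N" for r
    unfolding M_def N_def by (auto intro: continuous_on_imp_measurable_restrict_lborel f g)
  define M' where "M' = sq_density (p / 2) M f"
  define N' where "N' = sq_density (p / 2) N g"
  note equi = sq_ratio_equidistributed[OF p M N f_meas g_meas eq[folded M_def N_def] fin[folded M_def]]
  interpret M': finite_measure M' unfolding M'_def by (rule equi(2)) (rule closed_UNIV)
  interpret N': finite_measure N' unfolding N'_def by (rule equi(3)) (rule closed_UNIV)
  have space': "space M' = D1" "space N' = D2"
    by (simp_all add: M'_def N'_def sq_density_def space)
  have equi1: "measure M' (sq_ratio f -` K \<inter> D1) = measure N' (sq_ratio g -` K \<inter> D2)" if "closed K" for K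
    using equi(1)[OF that] by (simp add: M'_def N'_def space)
  have rf: "sq_ratio f \<in> borel_measurable M'" and rg: "sq_ratio g \<in> borel_measurable N'"
    using sq_ratio_measurable[OF f_meas] sq_ratio_measurable[OF g_meas]
    by (simp_all add: M'_def N'_def sq_density_def)
  have cont: "continuous_on D1 (sq_ratio f)"
    unfolding sq_ratio_def
  proof (intro continuous_on_vec)
    fix r
    have "continuous_on D1 (sq_sum f)"
      unfolding sq_sum_def by (intro continuous_intros f)
    moreover have "sq_sum f x \<noteq> 0" if "x \<in> D1" for x
      using pos1[OF that] by simp
    ultimately show "continuous_on D1 (\<lambda>x. (\<chi> r. (cmod (f r x))\<^sup>2 / sq_sum f x) $ r)"
      unfolding vec_lambda_beta by (intro continuous_intros f ballI) auto
  qed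
  obtain C :: "nat \<Rightarrow> 'a set" where C: "\<And>n. compact (C n)" "\<And>n. C n \<subseteq> D1" "\<And>n. C n \<subseteq> interior (C (Suc n))" "\<Union> (range C) = D1"
    using open_Union_compact_subsets[OF D1] by metis
  have incC: "incseq C"
    using C(3) interior_subset by (intro incseq_SucI) blast
  define K where "K n = sq_ratio f ` C n" for n
  have K: "closed (K n)" for n
    unfolding K_def by (intro compact_imp_closed compact_continuous_image continuous_on_subset[OF cont] C(1,2))
  define A where "A n = sq_ratio g -` K n \<inter> D2" for n
  define B where "B n = sq_ratio f -` K n \<inter> D1" for n
  have sets: "A n \<in> sets N'" "B n \<in> sets M'" for n
    using measurable_sets[OF rg borel_closed[OF K]] measurable_sets[OF rf borel_closed[OF K]]
    by (simp_all add: A_def B_def space')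
  have inc: "incseq A" "incseq B"
    using incC unfolding A_def B_def K_def incseq_def by blast+
  have "(\<lambda>n. measure N' (A n)) \<longlonglongrightarrow> measure N' (\<Union>n. A n)"
    using sets inc by (intro N'.finite_Lim_measure_incseq) auto
  moreover have "(\<lambda>n. measure M' (B n)) \<longlonglongrightarrow> measure M' (\<Union>n. B n)"
    using sets inc by (intro M'.finite_Lim_measure_incseq) auto
  moreover have "measure M' (B n) = measure N' (A n)" for n
    unfolding A_def B_def by (rule equi1[OF K])
  ultimately have "measure N' (\<Union>n. A n) = measure M' (\<Union>n. B n)"
    using LIMSEQ_unique by simp
  also have "(\<Union>n. B n) = D1"
    using C(4) unfolding B_def K_def by blast
  also have "measure M' D1 = measure N' D2"
    using equi1[of UNIV] by simp
  finally have full: "measure N' (\<Union>n. A n) = measure N' (space N')"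
    by (simp add: space')
  have sU: "(\<Union>n. A n) \<in> sets N'" using sets by auto
  have "measure N' (space N' - (\<Union>n. A n)) = 0"
    using N'.finite_measure_compl[OF sU] full by simp
  then have "space N' - (\<Union>n. A n) \<in> null_sets N'"
    using sU by (auto simp: null_sets_def N'.emeasure_eq_measure)
  then have "AE w in N'. w \<notin> space N' - (\<Union>n. A n)"
    by (rule AE_not_in)
  then have "AE w in N. 0 < ennreal (sq_sum g w powr (p / 2)) \<longrightarrow> w \<notin> D2 - (\<Union>n. A n)"
    unfolding space' N'_def sq_density_def by (subst (asm) AE_density) auto
  then have "AE w in lborel. w \<in> D2 \<longrightarrow> 0 < ennreal (sq_sum g w powr (p / 2)) \<longrightarrow> w \<notin> D2 - (\<Union>n. A n)"
    unfolding N_def using D2 by (subst (asm) AE_restrict_space_iff) auto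
  then show ?thesis
  proof eventually_elim
    case (elim w)
    show ?case
    proof
      assume w: "w \<in> D2"
      then have "0 < ennreal (sq_sum g w powr (p / 2))"
        using pos2[OF w] by simp
      with elim w obtain n where "w \<in> A n" by blast
      then obtain z where "z \<in> C n" "sq_ratio g w = sq_ratio f z"
        unfolding A_def K_def by auto
      then show "\<exists>z\<in>D1. sq_ratio f z = sq_ratio g w"
        using C(2)[of n] by (intro bexI[of _ z]) auto
    qed
  qed
qed

lemma AE_lborel_imp_dense:
  fixes D :: "'a::euclidean_space set"
  assumes D: "open D" and ae: "AE w in lborel. w \<in> D \<longrightarrow> P w"
  shows "D \<subseteq> closure {w \<in> D. P w}"
proof (rule ccontr)
  define V where "V = D - closure {w \<in> D. P w}"
  assume "\<not> D \<subseteq> closure {w \<in> D. P w}"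
  then have "V \<noteq> {}" by (auto simp: V_def)
  moreover have "open V"
    using D by (simp add: V_def open_Diff)
  moreover have "AE w in lborel. w \<notin> V"
    using ae
  proof eventually_elim
    case (elim w)
    then show ?case
      using closure_subset[of "{w \<in> D. P w}"] unfolding V_def by blast
  qed
  ultimately show False
    using open_not_null_lborel[of V] AE_iff_null_sets[of V lborel] by simp
qed

text \<open>The flag selects the factor 1 or \<i>. The squared moduli of these combinations
  determine all products \<open>F a x * cnj (F b x)\<close> by the polarization identity, which
  moduli of the entries alone would not; the index \<open>(a, a, False)\<close> gives twice the
  entry.\<close>

definition polarized :: "('m \<Rightarrow> 'x \<Rightarrow> complex) \<Rightarrow> 'm \<times> 'm \<times> bool \<Rightarrow> 'x \<Rightarrow> complex" where
  "polarized F = (\<lambda>(a, b, c) x. F a x + (if c then \<i> else 1) * F b x)"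

lemma sq_sum_polarized_pos:
  fixes F :: "'m::finite \<Rightarrow> 'x \<Rightarrow> complex"
  assumes "F a x \<noteq> 0"
  shows "0 < sq_sum (polarized F) x"
proof -
  have "0 < (cmod (polarized F (a, a, False) x))\<^sup>2"
    using assms by (simp add: polarized_def mult_2[symmetric] del: mult_2_right)
  also have "\<dots> \<le> sq_sum (polarized F) x"
    unfolding sq_sum_def by (rule member_le_sum) auto
  finally show ?thesis .
qed

text \<open>Equal ratios make all squared moduli proportional with one positive factor \<kappa>.
  Polarization then makes the matrices of products \<open>G a w * cnj (G b w)\<close> and
  \<open>F a z * cnj (F b z)\<close> proportional, and the column of index \<open>a0\<close>, where
  \<open>F\<close> is 1, recovers the vectors up to a scalar.\<close>

lemma sq_ratio_polarized_eq:
  fixes F :: "'m::finite \<Rightarrow> 'x \<Rightarrow> complex" and G :: "'m \<Rightarrow> 'y \<Rightarrow> complex"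
  assumes eq: "sq_ratio (polarized F) z = sq_ratio (polarized G) w"
    and F: "F a0 z = 1" and G: "G b0 w \<noteq> 0"
  shows "\<exists>s. \<forall>a. G a w = s * F a z"
proof -
  define \<kappa> where "\<kappa> = sq_sum (polarized G) w / sq_sum (polarized F) z"
  have pos: "0 < sq_sum (polarized F) z" "0 < sq_sum (polarized G) w"
    using F G sq_sum_polarized_pos[of F a0 z] sq_sum_polarized_pos[of G b0 w] by auto
  then have \<kappa>: "0 < \<kappa>" by (simp add: \<kappa>_def)
  have sq: "(cmod (polarized G r w))\<^sup>2 = \<kappa> * (cmod (polarized F r z))\<^sup>2" for r
  proof -
    have "(cmod (polarized F r z))\<^sup>2 / sq_sum (polarized F) z = (cmod (polarized G r w))\<^sup>2 / sq_sum (polarized G) w"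
      using arg_cong[OF eq, of "\<lambda>v. v $ r"] by (simp add: sq_ratio_def)
    then show ?thesis
      using pos by (simp add: \<kappa>_def field_simps)
  qed
  have diag: "(cmod (G a w))\<^sup>2 = \<kappa> * (cmod (F a z))\<^sup>2" for a
    using sq[of "(a, a, False)"] by (simp add: polarized_def mult_2[symmetric] norm_mult power_mult_distrib del: mult_2_right)
  have re: "(cmod (x + y))\<^sup>2 = (cmod x)\<^sup>2 + (cmod y)\<^sup>2 + 2 * Re (x * cnj y)" for x y
    by (simp only: cmod_power2) (simp add: power2_eq_square algebra_simps)
  have im: "(cmod (x + \<i> * y))\<^sup>2 = (cmod x)\<^sup>2 + (cmod y)\<^sup>2 + 2 * Im (x * cnj y)" for x y
    by (simp only: cmod_power2) (simp add: power2_eq_square algebra_simps)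
  have prod: "G a w * cnj (G b w) = of_real \<kappa> * (F a z * cnj (F b z))" for a b
  proof (rule complex_eqI)
    show "Re (G a w * cnj (G b w)) = Re (of_real \<kappa> * (F a z * cnj (F b z)))"
      using sq[of "(a, b, False)"] diag[of a] diag[of b]
      by (simp add: polarized_def re distrib_left del: times_complex.sel) simp
    show "Im (G a w * cnj (G b w)) = Im (of_real \<kappa> * (F a z * cnj (F b z)))"
      using sq[of "(a, b, True)"] diag[of a] diag[of b]
      by (simp add: polarized_def im distrib_left del: times_complex.sel) simp
  qed
  have ne: "G a0 w \<noteq> 0"
    using diag[of a0] F \<kappa> by auto
  have "G a w = of_real \<kappa> / cnj (G a0 w) * F a z" for a
    using prod[of a a0] F ne by (simp add: field_simps)
  then show ?thesis by blast
qed

section \<open>Bergman spaces\<close>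

lemma holo_fun_on_const: "holo_fun_on (\<lambda>_. c) D"
  unfolding holo_fun_on_def by (auto intro!: exI[of _ "\<lambda>_. 0"])

lemma holo_fun_on_component: "holo_fun_on (\<lambda>z. z $ i) D"
  unfolding holo_fun_on_def
  by (auto intro!: exI[of _ "\<lambda>v. v $ i"] bounded_linear_imp_has_derivative bounded_linear_vec_nth)

lemma holo_fun_on_add:
  assumes "holo_fun_on f D" "holo_fun_on g D"
  shows "holo_fun_on (\<lambda>z. f z + g z) D"
  unfolding holo_fun_on_def
proof
  fix z assume "z \<in> D"
  then obtain L1 L2 where L: "(f has_derivative L1) (at z)" "\<And>c v. L1 (c *s v) = c * L1 v"
      "(g has_derivative L2) (at z)" "\<And>c v. L2 (c *s v) = c * L2 v"
    using assms unfolding holo_fun_on_def by metis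
  show "\<exists>L. ((\<lambda>z. f z + g z) has_derivative L) (at z) \<and> (\<forall>c v. L (c *s v) = c * L v)"
    by (rule exI[of _ "\<lambda>v. L1 v + L2 v"]) (simp add: has_derivative_add[OF L(1,3)] L(2,4) distrib_left)
qed

lemma holo_fun_on_cmult:
  assumes "holo_fun_on f D"
  shows "holo_fun_on (\<lambda>z. a * f z) D"
  unfolding holo_fun_on_def
proof
  fix z assume "z \<in> D"
  then obtain L where L: "(f has_derivative L) (at z)" "\<And>c v. L (c *s v) = c * L v"
    using assms unfolding holo_fun_on_def by metis
  show "\<exists>L. ((\<lambda>z. a * f z) has_derivative L) (at z) \<and> (\<forall>c v. L (c *s v) = c * L v)"
    by (rule exI[of _ "\<lambda>v. a * L v"]) (simp add: has_derivative_mult_right[OF L(1)] L(2))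
qed

lemma holo_fun_on_cong:
  assumes f: "holo_fun_on f D" and D: "open D" and eq: "\<And>z. z \<in> D \<Longrightarrow> f z = g z"
  shows "holo_fun_on g D"
  unfolding holo_fun_on_def
proof
  fix z assume z: "z \<in> D"
  then obtain L where L: "(f has_derivative L) (at z)" "\<forall>c v. L (c *s v) = c * L v"
    using f unfolding holo_fun_on_def by blast
  have "(g has_derivative L) (at z)"
    by (rule has_derivative_transform_within_open[OF L(1) D z]) (rule eq)
  with L(2) show "\<exists>L. (g has_derivative L) (at z) \<and> (\<forall>c v. L (c *s v) = c * L v)"
    by blast
qed

abbreviation bergman_nn_integral :: "real \<Rightarrow> (complex ^ 'n) set \<Rightarrow> (complex ^ 'n \<Rightarrow> complex) \<Rightarrow> ennreal" where
  "bergman_nn_integral p D \<phi> \<equiv> (\<integral>\<^sup>+z. ennreal (cmod (\<phi> z) powr p) \<partial>restrict_space lborel D)"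

text \<open>Holomorphy supplies measurability, so integrability reduces to finiteness of a
  nonnegative integral.\<close>

lemma bergman_space_iff:
  fixes D :: "(complex ^ 'n) set"
  assumes D: "open D"
  shows "\<phi> \<in> bergman_space p D \<longleftrightarrow>
    holo_fun_on \<phi> D \<and> (\<forall>z. z \<notin> D \<longrightarrow> \<phi> z = 0) \<and> bergman_nn_integral p D \<phi> < \<infinity>"
proof -
  have "set_integrable lborel D (\<lambda>z. cmod (\<phi> z) powr p) \<longleftrightarrow> bergman_nn_integral p D \<phi> < \<infinity>"
    if h: "holo_fun_on \<phi> D"
  proof -
    have [measurable]: "\<phi> \<in> borel_measurable (restrict_space lborel D)"
      by (rule continuous_on_imp_measurable_restrict_lborel[OF holo_fun_on_imp_continuous_on[OF h]])
    have "set_integrable lborel D (\<lambda>z. cmod (\<phi> z) powr p) \<longleftrightarrow> integrable (restrict_space lborel D) (\<lambda>z. cmod (\<phi> z) powr p)"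
      unfolding set_integrable_def using D by (intro integrable_restrict_space[symmetric]) simp
    also have "\<dots> \<longleftrightarrow> bergman_nn_integral p D \<phi> < \<infinity>"
      unfolding integrable_iff_bounded by simp
    finally show ?thesis .
  qed
  then show ?thesis unfolding bergman_space_def by blast
qed

lemma bergman_nn_integral_eq:
  assumes D: "open D" and \<phi>: "\<phi> \<in> bergman_space p D"
  shows "bergman_nn_integral p D \<phi> = ennreal (LINT z:D|lborel. cmod (\<phi> z) powr p)"
proof -
  have int: "integrable (restrict_space lborel D) (\<lambda>z. cmod (\<phi> z) powr p)"
    using \<phi> D unfolding bergman_space_def set_integrable_def by (subst integrable_restrict_space) auto
  have "bergman_nn_integral p D \<phi> = ennreal (\<integral>z. cmod (\<phi> z) powr p \<partial>restrict_space lborel D)"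
    by (rule nn_integral_eq_integral[OF int]) simp
  then show ?thesis
    using D by (simp add: integral_restrict_space set_lebesgue_integral_def)
qed

text \<open>A substitute for Minkowski's inequality that also covers \<open>p < 1\<close>: the sum
  is at most twice the larger term.\<close>

lemma powr_add_le:
  fixes a b p :: real
  assumes "0 \<le> a" "0 \<le> b" "0 < p"
  shows "(a + b) powr p \<le> 2 powr p * (a powr p + b powr p)"
proof -
  have "(a + b) powr p \<le> (2 * max a b) powr p"
    using assms by (intro powr_mono2) auto
  also have "\<dots> = 2 powr p * (max a b) powr p"
    using assms by (simp add: powr_mult)
  also have "\<dots> \<le> 2 powr p * (a powr p + b powr p)"
    by (intro mult_left_mono) (auto simp: max_def)
  finally show ?thesis .
qed

lemma bergman_space_add:
  fixes D :: "(complex ^ 'n) set"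
  assumes D: "open D" and p: "0 < p" and "\<phi> \<in> bergman_space p D" "\<psi> \<in> bergman_space p D"
  shows "(\<lambda>z. \<phi> z + \<psi> z) \<in> bergman_space p D"
proof -
  have h: "holo_fun_on \<phi> D" "holo_fun_on \<psi> D" and fin: "bergman_nn_integral p D \<phi> < \<infinity>" "bergman_nn_integral p D \<psi> < \<infinity>"
    using assms bergman_space_iff[OF D] by blast+
  have [measurable]: "\<phi> \<in> borel_measurable (restrict_space lborel D)" "\<psi> \<in> borel_measurable (restrict_space lborel D)"
    using h by (auto intro!: continuous_on_imp_measurable_restrict_lborel holo_fun_on_imp_continuous_on)
  have "bergman_nn_integral p D (\<lambda>z. \<phi> z + \<psi> z)
      \<le> (\<integral>\<^sup>+z. ennreal (2 powr p) * (ennreal (cmod (\<phi> z) powr p) + ennreal (cmod (\<psi> z) powr p)) \<partial>restrict_space lborel D)"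
  proof (intro nn_integral_mono)
    fix z
    have "cmod (\<phi> z + \<psi> z) powr p \<le> (cmod (\<phi> z) + cmod (\<psi> z)) powr p"
      using p by (intro powr_mono2) (auto simp: norm_triangle_ineq)
    also have "\<dots> \<le> 2 powr p * (cmod (\<phi> z) powr p + cmod (\<psi> z) powr p)"
      using p by (intro powr_add_le) auto
    finally show "ennreal (cmod (\<phi> z + \<psi> z) powr p) \<le> ennreal (2 powr p) * (ennreal (cmod (\<phi> z) powr p) + ennreal (cmod (\<psi> z) powr p))"
      by (simp add: ennreal_mult[symmetric] ennreal_plus[symmetric] del: ennreal_plus)
  qed
  also have "\<dots> = ennreal (2 powr p) * (bergman_nn_integral p D \<phi> + bergman_nn_integral p D \<psi>)"
    by (subst nn_integral_cmult, measurable, subst nn_integral_add, measurable)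
  also have "\<dots> < \<infinity>"
    using fin by (simp add: ennreal_mult_less_top)
  finally show ?thesis
    using assms bergman_space_iff[OF D] holo_fun_on_add[OF h] by simp
qed

lemma bergman_space_cmult:
  fixes D :: "(complex ^ 'n) set"
  assumes D: "open D" and \<phi>: "\<phi> \<in> bergman_space p D"
  shows "(\<lambda>z. c * \<phi> z) \<in> bergman_space p D"
proof -
  have h: "holo_fun_on \<phi> D" and fin: "bergman_nn_integral p D \<phi> < \<infinity>"
    using \<phi> bergman_space_iff[OF D] by blast+
  have [measurable]: "\<phi> \<in> borel_measurable (restrict_space lborel D)"
    using h by (auto intro!: continuous_on_imp_measurable_restrict_lborel holo_fun_on_imp_continuous_on)
  have "bergman_nn_integral p D (\<lambda>z. c * \<phi> z) = ennreal (cmod c powr p) * bergman_nn_integral p D \<phi>"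
    by (subst nn_integral_cmult[symmetric]) (auto simp: norm_mult powr_mult ennreal_mult)
  also have "\<dots> < \<infinity>"
    using fin by (simp add: ennreal_mult_less_top)
  finally show ?thesis
    using \<phi> bergman_space_iff[OF D] holo_fun_on_cmult[OF h] by simp
qed

lemma bergman_space_zero: "open D \<Longrightarrow> (\<lambda>_. 0) \<in> bergman_space p D"
  by (subst bergman_space_iff) (auto simp: holo_fun_on_const)

lemma bergman_isometry_nn_integral:
  fixes D1 D2 :: "(complex ^ 'n) set"
  assumes T: "bergman_linear_isometry p D1 D2 T" and p: "0 < p" and D: "open D1" "open D2"
    and \<phi>: "\<phi> \<in> bergman_space p D1"
  shows "bergman_nn_integral p D2 (T \<phi>) = bergman_nn_integral p D1 \<phi>"
proof -
  have T\<phi>: "T \<phi> \<in> bergman_space p D2"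
    using bij_betw_apply[of T "bergman_space p D1" "bergman_space p D2" \<phi>] T \<phi>
    unfolding bergman_linear_isometry_def by blast
  let ?I1 = "LINT z:D1|lborel. cmod (\<phi> z) powr p" and ?I2 = "LINT z:D2|lborel. cmod (T \<phi> z) powr p"
  have nonneg: "0 \<le> ?I1" "0 \<le> ?I2"
    unfolding set_lebesgue_integral_def by (auto intro!: integral_nonneg_AE)
  have "?I2 powr (1 / p) = ?I1 powr (1 / p)"
    using T \<phi> unfolding bergman_linear_isometry_def bergman_norm_def by blast
  then have "(?I2 powr (1 / p)) powr p = (?I1 powr (1 / p)) powr p" by simp
  then have "?I2 = ?I1"
    using p nonneg by (simp add: powr_powr)
  then show ?thesis
    using bergman_nn_integral_eq[OF D(1) \<phi>] bergman_nn_integral_eq[OF D(2) T\<phi>] by simp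
qed

lemma bergman_isometry_add:
  assumes "bergman_linear_isometry p D1 D2 T" "\<phi> \<in> bergman_space p D1" "\<psi> \<in> bergman_space p D1"
  shows "T (\<lambda>z. \<phi> z + \<psi> z) = (\<lambda>z. T \<phi> z + T \<psi> z)"
  using assms by (simp add: bergman_linear_isometry_def)

lemma bergman_isometry_cmult:
  assumes "bergman_linear_isometry p D1 D2 T" "\<phi> \<in> bergman_space p D1"
  shows "T (\<lambda>z. c * \<phi> z) = (\<lambda>z. c * T \<phi> z)"
  using assms by (simp add: bergman_linear_isometry_def)

lemma bergman_isometry_sum:
  fixes D1 D2 :: "(complex ^ 'n) set" and \<phi> :: "'r \<Rightarrow> complex ^ 'n \<Rightarrow> complex"
  assumes T: "bergman_linear_isometry p D1 D2 T" and p: "0 < p" and D: "open D1"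
    and S: "finite S" and \<phi>: "\<And>r. r \<in> S \<Longrightarrow> \<phi> r \<in> bergman_space p D1"
  shows "(\<lambda>z. \<Sum>r\<in>S. c r * \<phi> r z) \<in> bergman_space p D1
    \<and> T (\<lambda>z. \<Sum>r\<in>S. c r * \<phi> r z) = (\<lambda>z. \<Sum>r\<in>S. c r * T (\<phi> r) z)"
  using S \<phi>
proof (induction S)
  case empty
  show ?case
    using bergman_isometry_cmult[OF T bergman_space_zero[OF D], of 0] bergman_space_zero[OF D, of p] by simp
next
  case (insert r S)
  let ?s = "\<lambda>z. \<Sum>r\<in>S. c r * \<phi> r z"
  have s: "?s \<in> bergman_space p D1" "T ?s = (\<lambda>z. \<Sum>r\<in>S. c r * T (\<phi> r) z)"
    using insert by auto
  have r: "(\<lambda>z. c r * \<phi> r z) \<in> bergman_space p D1" "T (\<lambda>z. c r * \<phi> r z) = (\<lambda>z. c r * T (\<phi> r) z)"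
    using insert.prems[of r] by (auto intro: bergman_space_cmult[OF D] bergman_isometry_cmult[OF T])
  have "T (\<lambda>z. c r * \<phi> r z + ?s z) = (\<lambda>z. T (\<lambda>z. c r * \<phi> r z) z + T ?s z)"
    by (rule bergman_isometry_add[OF T r(1) s(1)])
  then show ?case
    using insert.hyps bergman_space_add[OF D p r(1) s(1)] by (simp add: r(2) s(2))
qed

text \<open>Comparison with the largest modulus works for every positive \<open>p\<close>, whether
  or not the power is convex.\<close>

lemma sq_sum_powr_le:
  fixes f :: "'r::finite \<Rightarrow> 'x \<Rightarrow> complex"
  assumes p: "0 < p"
  shows "sq_sum f x powr (p / 2) \<le> real CARD('r) powr (p / 2) * (\<Sum>r\<in>UNIV. cmod (f r x) powr p)"
proof -
  have "Max (range (\<lambda>r. cmod (f r x))) \<in> range (\<lambda>r. cmod (f r x))"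
    by (rule Max_in) auto
  then obtain m where m0: "Max (range (\<lambda>r. cmod (f r x))) = cmod (f m x)"
    by (rule rangeE)
  have m: "cmod (f r x) \<le> cmod (f m x)" for r
    unfolding m0[symmetric] by (rule Max_ge) auto
  have "sq_sum f x \<le> (\<Sum>r\<in>(UNIV :: 'r set). (cmod (f m x))\<^sup>2)"
    unfolding sq_sum_def by (intro sum_mono power_mono m) auto
  then have "sq_sum f x powr (p / 2) \<le> (real CARD('r) * (cmod (f m x))\<^sup>2) powr (p / 2)"
    using p sq_sum_nonneg[of f x] by (intro powr_mono2) auto
  also have "\<dots> = real CARD('r) powr (p / 2) * ((cmod (f m x))\<^sup>2) powr (p / 2)"
    by (simp add: powr_mult)
  also have "((cmod (f m x))\<^sup>2) powr (p / 2) = cmod (f m x) powr p"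
  proof (cases "f m x = 0")
    case False
    then have "(cmod (f m x) powr 2) powr (p / 2) = cmod (f m x) powr p"
      by (simp only: powr_powr) simp
    then show ?thesis using False by (simp add: powr_realpow)
  qed simp
  also have "cmod (f m x) powr p \<le> (\<Sum>r\<in>UNIV. cmod (f r x) powr p)"
    by (rule member_le_sum) auto
  finally show ?thesis by (simp add: mult_left_mono)
qed

lemma sq_sum_powr_integrable:
  fixes f :: "'r::finite \<Rightarrow> complex ^ 'n \<Rightarrow> complex"
  assumes p: "0 < p" and D: "open D" and f: "\<And>r. f r \<in> bergman_space p D"
  shows "(\<integral>\<^sup>+x. ennreal (sq_sum f x powr (p / 2)) \<partial>restrict_space lborel D) < \<infinity>"
proof -
  have h: "holo_fun_on (f r) D" and fin: "bergman_nn_integral p D (f r) < \<infinity>" for r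
    using f[of r] bergman_space_iff[OF D] by blast+
  have [measurable]: "f r \<in> borel_measurable (restrict_space lborel D)" for r
    using h by (auto intro!: continuous_on_imp_measurable_restrict_lborel holo_fun_on_imp_continuous_on)
  have "(\<integral>\<^sup>+x. ennreal (sq_sum f x powr (p / 2)) \<partial>restrict_space lborel D)
      \<le> (\<integral>\<^sup>+x. ennreal (real CARD('r) powr (p / 2)) * (\<Sum>r\<in>UNIV. ennreal (cmod (f r x) powr p)) \<partial>restrict_space lborel D)"
    using sq_sum_powr_le[OF p, of f]
    by (intro nn_integral_mono) (simp add: ennreal_mult[symmetric] sum_nonneg)
  also have "\<dots> = ennreal (real CARD('r) powr (p / 2)) * (\<Sum>r\<in>UNIV. bergman_nn_integral p D (f r))"
    by (subst nn_integral_cmult, measurable, subst nn_integral_sum, measurable)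
  also have "\<dots> < \<infinity>"
    using fin by (simp add: ennreal_mult_less_top)
  finally show ?thesis .
qed

section \<open>Coordinate functions and the construction of the biholomorphism\<close>

text \<open>The entries of the homogeneous vector (1, z), with \<open>None\<close> for the constant
  entry. They are extended by zero, as the representation of Bergman functions demands.\<close>

definition coord :: "(complex ^ 'n) set \<Rightarrow> 'n option \<Rightarrow> complex ^ 'n \<Rightarrow> complex" where
  "coord D k z = (if z \<in> D then case k of None \<Rightarrow> 1 | Some i \<Rightarrow> z $ i else 0)"

lemma coord_bergman_space:
  fixes D :: "(complex ^ 'n) set"
  assumes D: "open D" "bounded D" and p: "0 < p"
  shows "coord D k \<in> bergman_space p D"
proof -
  obtain B where B: "\<And>z. z \<in> D \<Longrightarrow> norm z \<le> B"
    using D(2) bounded_iff by blast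
  have "cmod (coord D k z) \<le> max 1 B" for z
    using B[of z] Finite_Cartesian_Product.norm_nth_le[of z]
    by (auto simp: coord_def split: option.split intro: order_trans le_max_iff_disj[THEN iffD2])
  then have "bergman_nn_integral p D (coord D k) \<le> (\<integral>\<^sup>+z. ennreal (max 1 B powr p) \<partial>restrict_space lborel D)"
    using p by (intro nn_integral_mono ennreal_leI powr_mono2) auto
  also have "\<dots> = ennreal (max 1 B powr p) * emeasure lborel D"
    using D by (simp add: emeasure_restrict_space space_restrict_space)
  also have "\<dots> < \<infinity>"
    using emeasure_bounded_finite[OF D(2)] by (simp add: ennreal_mult_less_top)
  finally have fin: "bergman_nn_integral p D (coord D k) < \<infinity>" .
  have "holo_fun_on (\<lambda>z. case k of None \<Rightarrow> 1 | Some i \<Rightarrow> z $ i) D"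
    by (cases k) (simp_all add: holo_fun_on_const holo_fun_on_component)
  then have "holo_fun_on (coord D k) D"
    by (rule holo_fun_on_cong[OF _ D(1)]) (simp add: coord_def)
  with fin show ?thesis
    unfolding bergman_space_iff[OF D(1)] by (simp add: coord_def)
qed

lemma holo_map_on_quotient:
  fixes f :: "complex ^ 'n \<Rightarrow> complex ^ 'n"
  assumes a: "holo_fun_on a D" and f: "\<And>i. holo_fun_on (\<lambda>z. f z $ i) D" and nz: "\<And>z. z \<in> D \<Longrightarrow> a z \<noteq> 0"
  shows "holo_map_on (\<lambda>z. (1 / a z) *s f z) D"
  unfolding holo_map_on_def holo_fun_on_def
proof (intro allI ballI)
  fix i z assume z: "z \<in> D"
  let ?L = "\<lambda>v. ((1 / (a z)\<^sup>2) *s (quotient_jacobian a f z *v v)) $ i"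
  have "((\<lambda>z. ((1 / a z) *s f z) $ i) has_derivative ?L) (at z)"
    by (rule bounded_linear.has_derivative[OF bounded_linear_vec_nth quotient_has_derivative[OF a f z nz[OF z]]])
  moreover have "?L (c *s v) = c * ?L v" for c v
    by (simp add: vector_scalar_commute)
  ultimately show "\<exists>L. ((\<lambda>z. ((1 / a z) *s f z) $ i) has_derivative L) (at z) \<and> (\<forall>c v. L (c *s v) = c * L v)"
    by blast
qed

text \<open>\<open>P\<close> and \<open>Q\<close> are the images of the coordinate functions of the other domain.\<close>

lemma matched_coordinates_extend:
  fixes D D' :: "(complex ^ 'n) set" and P Q :: "'n option \<Rightarrow> complex ^ 'n \<Rightarrow> complex"
  assumes D: "open D" and D': "open D'" "bounded D'" "pseudoconvex D'" "holder_boundary D'"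
    and P: "\<And>k. holo_fun_on (P k) D" and Q: "\<And>k. holo_fun_on (Q k) D'"
    and W: "W \<subseteq> D" "D \<subseteq> closure W"
    and W': "\<And>w. w \<in> W \<Longrightarrow> \<exists>z\<in>D'. \<exists>s. (\<forall>k. P k w = s * coord D' k z) \<and> (\<forall>k. coord D k w = s * Q k z)"
  defines "g \<equiv> \<lambda>w. (1 / P None w) *s (\<chi> i. P (Some i) w)"
    and "h \<equiv> \<lambda>z. (1 / Q None z) *s (\<chi> i. Q (Some i) z)"
  shows "holo_map_on g D" "\<And>w. w \<in> D \<Longrightarrow> g w \<in> D'" "\<And>w. w \<in> D \<Longrightarrow> h (g w) = w"
proof -
  have match: "\<exists>z\<in>D'. (\<chi> i. P (Some i) w) = P None w *s z \<and> P None w * Q None z = 1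
      \<and> P None w *s (\<chi> i. Q (Some i) z) = w" if "w \<in> W" for w
  proof -
    obtain z s where z: "z \<in> D'" and P: "\<And>k. P k w = s * coord D' k z" and Q: "\<And>k. coord D k w = s * Q k z"
      using W'[OF \<open>w \<in> W\<close>] by blast
    have "w \<in> D" using that W by blast
    \<comment> \<open>The index \<open>None\<close> identifies the scalar: \<open>s\<close> is
      \<open>P None w\<close>, and its product with \<open>Q None z\<close> is 1.\<close>
    then have "1 = s * Q None z" "\<And>i. w $ i = s * Q (Some i) z"
      using Q[of None] Q[of "Some _"] by (simp_all add: coord_def)
    moreover have "P None w = s" "\<And>i. P (Some i) w = s * z $ i"
      using P[of None] P[of "Some _"] z by (simp_all add: coord_def)
    ultimately show ?thesis
      using z by (intro bexI[of _ z]) (simp_all add: vec_eq_iff)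
  qed
  have main: "P None w \<noteq> 0 \<and> g w \<in> D' \<and> P None w * Q None (g w) = 1 \<and> P None w *s (\<chi> i. Q (Some i) (g w)) = w"
    if "w \<in> D" for w
    unfolding g_def
    by (rule dense_inverse_extends[OF D D', where \<phi> = "\<lambda>z. \<chi> i. Q (Some i) z" and \<psi> = "\<lambda>w. \<chi> i. P (Some i) w" and W = W])
      (use P Q W match that in auto)
  show "holo_map_on g D"
    unfolding g_def using P main by (intro holo_map_on_quotient) auto
  show "g w \<in> D'" if "w \<in> D" for w using main[OF that] by blast
  show "h (g w) = w" if "w \<in> D" for w
  proof -
    have "P None w * Q None (g w) = 1" using main[OF that] by blast
    then have "1 / Q None (g w) = P None w"
      by (metis divide_eq_eq mult_zero_right zero_neq_one)
    then show ?thesis using main[OF that] by (simp add: h_def)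
  qed
qed

theorem corollary1p3:
  fixes D1 D2 :: "(complex ^ 'n) set" and p :: real
  assumes "bounded_domain D1" and "pseudoconvex D1" and "holder_boundary D1"
    and "bounded_domain D2" and "pseudoconvex D2" and "holder_boundary D2"
    and "p > 0" and "\<not> (\<exists>k::int. even k \<and> p = of_int k)"
    and "\<exists>T. bergman_linear_isometry p D1 D2 T"
  shows "biholomorphic D1 D2"
proof -
  obtain T where T: "bergman_linear_isometry p D1 D2 T"
    using assms(9) by blast
  have D: "open D1" "bounded D1" "open D2" "bounded D2"
    using assms(1,4) by (auto simp: bounded_domain_def)
  have half: "p / 2 \<noteq> real n" for n
  proof
    assume "p / 2 = real n"
    then have "even (2 * int n) \<and> p = of_int (2 * int n)" by simp
    with assms(8) show False by blast
  qed
  have bij: "bij_betw T (bergman_space p D1) (bergman_space p D2)"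
    using T by (simp add: bergman_linear_isometry_def)
  \<comment> \<open>The flag \<open>False\<close> selects the coordinate functions of
    \<open>D1\<close> and \<open>True\<close> the preimages under \<open>T\<close> of those of
    \<open>D2\<close>. With \<open>G\<close> the image of \<open>F\<close>, each family contains an
    entry equal to 1, hence vanishes nowhere as a vector.\<close>
  define F where "F = (\<lambda>(k, b). if b then inv_into (bergman_space p D1) T (coord D2 k) else coord D1 k)"
  define G where "G a = T (F a)" for a
  have FA: "F a \<in> bergman_space p D1" for a
    using bij_betw_imp_surj_on[OF bij] coord_bergman_space[OF D(3,4) assms(7)] coord_bergman_space[OF D(1,2) assms(7)]
    by (auto simp: F_def split: prod.split intro!: inv_into_into)
  have GA: "G a \<in> bergman_space p D2" for a
    unfolding G_def by (rule bij_betw_apply[OF bij FA])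
  have F_coord: "F (k, False) = coord D1 k" for k
    by (simp add: F_def)
  have G_coord: "G (k, True) = coord D2 k" for k
    using bij_betw_inv_into_right[OF bij] coord_bergman_space[OF D(3,4) assms(7)]
    by (simp add: G_def F_def)
  have pol: "polarized F r \<in> bergman_space p D1 \<and> T (polarized F r) = polarized G r" for r
  proof -
    obtain a b c where r: "r = (a, b, c)" by (cases r)
    let ?e = "if c then \<i> else 1"
    have e: "(\<lambda>z. ?e * F b z) \<in> bergman_space p D1" "T (\<lambda>z. ?e * F b z) = (\<lambda>z. ?e * T (F b) z)"
      by (rule bergman_space_cmult[OF D(1) FA], rule bergman_isometry_cmult[OF T FA])
    have "T (\<lambda>z. F a z + ?e * F b z) = (\<lambda>z. T (F a) z + T (\<lambda>z. ?e * F b z) z)"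
      by (rule bergman_isometry_add[OF T FA e(1)])
    then show ?thesis
      using bergman_space_add[OF D(1) assms(7) FA e(1)] unfolding r polarized_def e(2) G_def by simp
  qed
  have polG: "polarized G r \<in> bergman_space p D2" for r
    using pol[of r] bij_betw_apply[OF bij, of "polarized F r"] by simp
  have eq: "bergman_nn_integral p D1 (\<lambda>x. \<Sum>r\<in>UNIV. c $ r * polarized F r x)
      = bergman_nn_integral p D2 (\<lambda>x. \<Sum>r\<in>UNIV. c $ r * polarized G r x)" for c
  proof -
    have sum: "(\<lambda>z. \<Sum>r\<in>UNIV. c $ r * polarized F r z) \<in> bergman_space p D1
      \<and> T (\<lambda>z. \<Sum>r\<in>UNIV. c $ r * polarized F r z) = (\<lambda>z. \<Sum>r\<in>UNIV. c $ r * T (polarized F r) z)"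
      by (rule bergman_isometry_sum[OF T assms(7) D(1)]) (use pol in auto)
    have "T (polarized F r) = polarized G r" for r
      using pol[of r] by blast
    then show ?thesis
      using bergman_isometry_nn_integral[OF T assms(7) D(1,3) conjunct1[OF sum]]
      unfolding conjunct2[OF sum] by simp
  qed
  have holo: "holo_fun_on (F a) D1" "holo_fun_on (G a) D2" for a
    using FA[of a] GA[of a] by (auto simp: bergman_space_def)
  have cont: "continuous_on D1 (polarized F r)" "continuous_on D2 (polarized G r)" for r
    using pol[of r] polG[of r] by (auto simp: bergman_space_def intro: holo_fun_on_imp_continuous_on)
  have F1: "F (None, False) z = 1" if "z \<in> D1" for z
    using that by (simp add: F_coord coord_def)
  have G1: "G (None, True) w = 1" if "w \<in> D2" for w
    using that by (simp add: G_coord coord_def)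
  have pos: "z \<in> D1 \<Longrightarrow> 0 < sq_sum (polarized F) z" "w \<in> D2 \<Longrightarrow> 0 < sq_sum (polarized G) w" for z w
    using F1[of z] G1[of w] sq_sum_polarized_pos[of F "(None, False)" z] sq_sum_polarized_pos[of G "(None, True)" w] by auto
  \<comment> \<open>Points with a partner of the same projective class on the other side. Both sets
    are dense: the argument is symmetric in the two families, since only equality of integrals is
    used.\<close>
  define W1 where "W1 = {z \<in> D1. \<exists>w\<in>D2. sq_ratio (polarized G) w = sq_ratio (polarized F) z}"
  define W2 where "W2 = {w \<in> D2. \<exists>z\<in>D1. sq_ratio (polarized F) z = sq_ratio (polarized G) w}"
  have W2: "D2 \<subseteq> closure W2"
    unfolding W2_def
  proof (rule AE_lborel_imp_dense[OF D(3)], rule sq_ratio_match_AE[OF assms(7) half D(1,3) cont eq])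
    show "(\<integral>\<^sup>+x. ennreal (sq_sum (polarized F) x powr (p / 2)) \<partial>restrict_space lborel D1) < \<infinity>"
      using pol by (intro sq_sum_powr_integrable[OF assms(7) D(1)]) auto
  qed (use pos in auto)
  have W1: "D1 \<subseteq> closure W1"
    unfolding W1_def
  proof (rule AE_lborel_imp_dense[OF D(1)], rule sq_ratio_match_AE[OF assms(7) half D(3,1) cont(2,1) eq[symmetric]])
    show "(\<integral>\<^sup>+x. ennreal (sq_sum (polarized G) x powr (p / 2)) \<partial>restrict_space lborel D2) < \<infinity>"
      using polG by (intro sq_sum_powr_integrable[OF assms(7) D(3)]) auto
  qed (use pos in auto)
  have match2: "\<exists>z\<in>D1. \<exists>s. (\<forall>k. G (k, False) w = s * coord D1 k z) \<and> (\<forall>k. coord D2 k w = s * F (k, True) z)"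
    if w: "w \<in> W2" for w
  proof -
    obtain z where z: "z \<in> D1" "w \<in> D2" "sq_ratio (polarized F) z = sq_ratio (polarized G) w"
      using w by (auto simp: W2_def)
    have "\<exists>s. \<forall>a. G a w = s * F a z"
      using sq_ratio_polarized_eq[OF z(3) F1[OF z(1)], of "(None, True)"] G1[OF z(2)] by simp
    then show ?thesis
      using z(1) by (metis F_coord G_coord)
  qed
  have match1: "\<exists>w\<in>D2. \<exists>s. (\<forall>k. F (k, True) z = s * coord D2 k w) \<and> (\<forall>k. coord D1 k z = s * G (k, False) w)"
    if z: "z \<in> W1" for z
  proof -
    obtain w where w: "w \<in> D2" "z \<in> D1" "sq_ratio (polarized G) w = sq_ratio (polarized F) z"
      using z by (auto simp: W1_def)
    have "\<exists>s. \<forall>a. F a z = s * G a w"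
      using sq_ratio_polarized_eq[OF w(3) G1[OF w(1)], of "(None, False)"] F1[OF w(2)] by simp
    then show ?thesis
      using w(1) by (metis F_coord G_coord)
  qed
  have "W1 \<subseteq> D1" "W2 \<subseteq> D2" by (auto simp: W1_def W2_def)
  \<comment> \<open>The map \<open>h\<close> of each application is the map \<open>g\<close> of the
    other, so the two left-inverse statements say that the maps are mutually inverse.\<close>
  note ext1 = matched_coordinates_extend[OF D(1) D(3,4) assms(5,6) holo \<open>W1 \<subseteq> D1\<close> W1 match1]
  note ext2 = matched_coordinates_extend[OF D(3) D(1,2) assms(2,3) holo(2,1) \<open>W2 \<subseteq> D2\<close> W2 match2]
  show ?thesis
    unfolding biholomorphic_def
    using ext1 ext2 by blast
qed

end
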